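(* Let $(X,S)$ be a minimal topological dynamical system with $X$ compact metric and acting group $\mathbb Z$. Let $\pi:(X,S)\to(X_\infty,S)$ be the extension to the maximal factor of order $\infty$. Then there are minimal systems $X'$, $X_\infty'$ and extensions $\theta':X'\to X$, $\pi':X'\to X_\infty'$, $\theta:X_\infty'\to X_\infty$ such that $\pi\circ\theta'=\theta\circ\pi'$, the extensions $\theta$ and $\theta'$ are almost one-to-one, and $$\boldsymbol Q^{[d]}(X')=({\pi'}^{[d]})^{-1}(\boldsymbol Q^{[d]}(X_\infty'))\quad\text{for each integer } d\ge1,$$ where ${\pi'}^{[d]}:(X')^{[d]}\to(X'_\infty)^{[d]}$ applies $\pi'$ in every coordinate.
   Context: Here $T=\mathbb Z$, generated by the homeomorphism $S$. A system is minimal if all orbits are dense. An extension is a continuous equivariant surjection. An extension $\phi:X\to Y$ is almost one-to-one if there is a dense $G_\delta$ set $X_0\subseteq X$ with $\phi^{-1}(\phi(x))=\{x\}$ for all $x\in X_0$. Cubes. $X^{[d]}=X^{2^d}$ has coordinates indexed by $\{0,1\}^d$ (equivalently subsets of $\{1,\dots,d\}$, $\emptyset\leftrightarrow(0,\dots,0)$); $x^{[d]}$ has all coordinates $x$. A facet of $\{0,1\}^d$ is a subset obtained by fixing the value of one coordinate; an upper facet is a facet containing $(1,\dots,1)$. For $t\in T$, $t^{(\alpha)}\in T^{[d]}$ has coordinate $t$ on $\alpha$ and the identity elsewhere. $\mathcal{HK}^{[d]}(T)$ (resp. $\mathcal F^{[d]}(T)$) is the subgroup of $T^{[d]}$ generated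 by $t^{(\alpha)}$, $t\in T$, $\alpha$ a facet (resp. upper facet), acting coordinatewise on $X^{[d]}$. $\boldsymbol Q^{[d]}(X)=\overline{\{\mathbf t x^{[d]}:\mathbf t\in\mathcal{HK}^{[d]}(T),x\in X\}}\subseteq X^{[d]}$. Order $\infty$. $(x,y)\in\mathbf{RP}^{[k]}(X)$ if there are nets $(\mathbf f_\lambda)$ in $\mathcal F^{[k]}(T)$, $(x_\lambda),(y_\lambda)$ in $X$, and $\mathbf a_*\in X^{2^k-1}$ with $(\mathbf f_\lambda x_\lambda^{[k]},\mathbf f_\lambda y_\lambda^{[k]})\to(x,\mathbf a_*,y,\mathbf a_* )$ (first coordinate of each block is the $\emptyset$-coordinate). $\mathbf{RP}^{[\infty]}(X)=\bigcap_{k\ge1}\mathbf{RP}^{[k]}(X)$; a system is of order $\infty$ if this is the diagonal. For minimal $X$ it is a closed invariant equivalence relation and $X_\infty=X/\mathbf{RP}^{[\infty]}(X)$ is the maximal factor of order $\infty$. *)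

theory Defs
  imports "HOL-Analysis.Analysis" "HOL-Algebra.Product_Groups" "HOL-Algebra.Generated_Groups"
begin

section \<open>Systems with acting group \<open>\<int>\<close>\<close>

definition dyn_system :: "'a topology \<Rightarrow> ('a \<Rightarrow> 'a) \<Rightarrow> bool" where
  "dyn_system X S \<longleftrightarrow> compact_space X \<and> Hausdorff_space X \<and> homeomorphic_map X X S"

text \<open>The action of \<open>n \<in> \<int>\<close>, i.e. \<open>S\<close> iterated \<open>n\<close> times; \<open>S\<close> is only
  assumed to be invertible as a self-map of the carrier.\<close>

definition act :: "'a topology \<Rightarrow> ('a \<Rightarrow> 'a) \<Rightarrow> int \<Rightarrow> 'a \<Rightarrow> 'a" where
  "act X S n = (if 0 \<le> n then S ^^ nat n else inv_into (topspace X) S ^^ nat (- n))"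

definition minimal_system :: "'a topology \<Rightarrow> ('a \<Rightarrow> 'a) \<Rightarrow> bool" where
  "minimal_system X S \<longleftrightarrow> dyn_system X S \<and>
     (\<forall>x\<in>topspace X. X closure_of range (\<lambda>n. act X S n x) = topspace X)"

definition extension ::
    "'a topology \<Rightarrow> ('a \<Rightarrow> 'a) \<Rightarrow> 'b topology \<Rightarrow> ('b \<Rightarrow> 'b) \<Rightarrow> ('a \<Rightarrow> 'b) \<Rightarrow> bool" where
  "extension X S Y R \<phi> \<longleftrightarrow> continuous_map X Y \<phi> \<and> \<phi> ` topspace X = topspace Y \<and>
     (\<forall>x\<in>topspace X. \<phi> (S x) = R (\<phi> x))"

definition almost_one_to_one :: "'a topology \<Rightarrow> ('a \<Rightarrow> 'b) \<Rightarrow> bool" where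
  "almost_one_to_one X \<phi> \<longleftrightarrow> (\<exists>X\<^sub>0. gdelta_in X X\<^sub>0 \<and> X closure_of X\<^sub>0 = topspace X \<and>
     (\<forall>x\<in>X\<^sub>0. {x'\<in>topspace X. \<phi> x' = \<phi> x} = {x}))"


section \<open>Cubes\<close>

text \<open>Vertices of \<open>{0,1}\<^sup>d\<close> are subsets of \<open>{1,\<dots>,d}\<close>. Points of \<open>X\<^sup>[\<^sup>d\<^sup>]\<close> and elements of
  \<open>T\<^sup>[\<^sup>d\<^sup>]\<close> are extensional functions on the vertices.\<close>

abbreviation vertices :: "nat \<Rightarrow> nat set set" where
  "vertices d \<equiv> Pow {1..d}"

abbreviation cube_space :: "nat \<Rightarrow> 'a topology \<Rightarrow> (nat set \<Rightarrow> 'a) topology" where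
  "cube_space d X \<equiv> product_topology (\<lambda>_. X) (vertices d)"

definition diag :: "nat \<Rightarrow> 'a \<Rightarrow> nat set \<Rightarrow> 'a" where
  "diag d x = (\<lambda>\<epsilon>\<in>vertices d. x)"

definition cube_map :: "nat \<Rightarrow> ('a \<Rightarrow> 'b) \<Rightarrow> (nat set \<Rightarrow> 'a) \<Rightarrow> nat set \<Rightarrow> 'b" where
  "cube_map d \<phi> p = (\<lambda>\<epsilon>\<in>vertices d. \<phi> (p \<epsilon>))"

definition facets :: "nat \<Rightarrow> nat set set set" where
  "facets d = (\<Union>i\<in>{1..d}. {{\<epsilon>\<in>vertices d. i \<in> \<epsilon>}, {\<epsilon>\<in>vertices d. i \<notin> \<epsilon>}})"

definition upper_facets :: "nat \<Rightarrow> nat set set set" where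
  "upper_facets d = {\<alpha>\<in>facets d. {1..d} \<in> \<alpha>}"

definition cube_group :: "nat \<Rightarrow> (nat set \<Rightarrow> int) monoid" where
  "cube_group d = product_group (vertices d) (\<lambda>_. integer_group)"

definition face_elt :: "nat \<Rightarrow> int \<Rightarrow> nat set set \<Rightarrow> nat set \<Rightarrow> int" where
  "face_elt d t \<alpha> = (\<lambda>\<epsilon>\<in>vertices d. if \<epsilon> \<in> \<alpha> then t else 0)"

definition HK_group :: "nat \<Rightarrow> (nat set \<Rightarrow> int) set" where
  "HK_group d = generate (cube_group d) {face_elt d t \<alpha> | t \<alpha>. \<alpha> \<in> facets d}"

definition F_group :: "nat \<Rightarrow> (nat set \<Rightarrow> int) set" where
  "F_group d = generate (cube_group d) {face_elt d t \<alpha> | t \<alpha>. \<alpha> \<in> upper_facets d}"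

definition cube_act ::
    "nat \<Rightarrow> 'a topology \<Rightarrow> ('a \<Rightarrow> 'a) \<Rightarrow> (nat set \<Rightarrow> int) \<Rightarrow> (nat set \<Rightarrow> 'a) \<Rightarrow> nat set \<Rightarrow> 'a" where
  "cube_act d X S t p = (\<lambda>\<epsilon>\<in>vertices d. act X S (t \<epsilon>) (p \<epsilon>))"

definition Q_cubes :: "nat \<Rightarrow> 'a topology \<Rightarrow> ('a \<Rightarrow> 'a) \<Rightarrow> (nat set \<Rightarrow> 'a) set" where
  "Q_cubes d X S = cube_space d X closure_of
     {cube_act d X S t (diag d x) | t x. t \<in> HK_group d \<and> x \<in> topspace X}"


section \<open>Regionally proximal relations and the maximal factor of order \<open>\<infinity>\<close>\<close>

text \<open>\<open>cube_point k x a\<close> is the point \<open>(x, a)\<close> of \<open>X\<^sup>[\<^sup>k\<^sup>]\<close>, with \<open>x\<close> at the vertex \<open>\<emptyset>\<close>.\<close>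

definition cube_point :: "nat \<Rightarrow> 'a \<Rightarrow> (nat set \<Rightarrow> 'a) \<Rightarrow> nat set \<Rightarrow> 'a" where
  "cube_point k x a = (\<lambda>\<epsilon>\<in>vertices k. if \<epsilon> = {} then x else a \<epsilon>)"

text \<open>A net \<open>(f\<^sub>\<lambda>, x\<^sub>\<lambda>, y\<^sub>\<lambda>)\<close> is given by its filter of eventual properties: a proper filter on
  triples. Every proper filter arises from a net in this way.\<close>

definition RP :: "nat \<Rightarrow> 'a topology \<Rightarrow> ('a \<Rightarrow> 'a) \<Rightarrow> ('a \<times> 'a) set" where
  "RP k X S = {(x, y). x \<in> topspace X \<and> y \<in> topspace X \<and>
     (\<exists>a \<in> (vertices k - {{}}) \<rightarrow>\<^sub>E topspace X. \<exists>N :: ((nat set \<Rightarrow> int) \<times> 'a \<times> 'a) filter.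
        N \<noteq> bot \<and>
        (\<forall>\<^sub>F (f, u, v) in N. f \<in> F_group k \<and> u \<in> topspace X \<and> v \<in> topspace X) \<and>
        limitin (cube_space k X) (\<lambda>(f, u, v). cube_act k X S f (diag k u)) (cube_point k x a) N \<and>
        limitin (cube_space k X) (\<lambda>(f, u, v). cube_act k X S f (diag k v)) (cube_point k y a) N)}"

definition RP_inf :: "'a topology \<Rightarrow> ('a \<Rightarrow> 'a) \<Rightarrow> ('a \<times> 'a) set" where
  "RP_inf X S = (\<Inter>k\<in>{1..}. RP k X S)"

text \<open>The factor \<open>X\<^sub>\<infinity> = X / RP\<^sup>[\<^sup>\<infinity>\<^sup>]\<close>: the quotient topology on the set of classes, the quotient
  map, and the induced map on classes.\<close>

definition X_inf :: "'a topology \<Rightarrow> ('a \<Rightarrow> 'a) \<Rightarrow> 'a set topology" where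
  "X_inf X S = topology (\<lambda>U. U \<subseteq> topspace X // RP_inf X S \<and>
     openin X {x\<in>topspace X. RP_inf X S `` {x} \<in> U})"

definition pi_inf :: "'a topology \<Rightarrow> ('a \<Rightarrow> 'a) \<Rightarrow> 'a \<Rightarrow> 'a set" where
  "pi_inf X S x = RP_inf X S `` {x}"

definition S_inf :: "('a \<Rightarrow> 'a) \<Rightarrow> 'a set \<Rightarrow> 'a set" where
  "S_inf S C = S ` C"

lemma openin_X_inf:
  "openin (X_inf X S) U \<longleftrightarrow> U \<subseteq> topspace X // RP_inf X S \<and>
     openin X {x\<in>topspace X. RP_inf X S `` {x} \<in> U}"
proof -
  let ?r = "\<lambda>x. RP_inf X S `` {x}"
  let ?L = "\<lambda>U. U \<subseteq> topspace X // RP_inf X S \<and> openin X {x\<in>topspace X. ?r x \<in> U}"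
  have "istopology ?L"
    unfolding istopology_def
  proof (intro conjI allI impI)
    fix U V assume UV: "?L U" "?L V"
    show "U \<inter> V \<subseteq> topspace X // RP_inf X S" using UV by blast
    have "{x\<in>topspace X. ?r x \<in> U \<inter> V} =
        {x\<in>topspace X. ?r x \<in> U} \<inter> {x\<in>topspace X. ?r x \<in> V}" by blast
    then show "openin X {x\<in>topspace X. ?r x \<in> U \<inter> V}"
      using UV by (simp only: openin_Int)
  next
    fix K assume K: "\<forall>U\<in>K. ?L U"
    show "\<Union>K \<subseteq> topspace X // RP_inf X S" using K by blast
    have eq: "{x\<in>topspace X. ?r x \<in> \<Union>K} = (\<Union>U\<in>K. {x\<in>topspace X. ?r x \<in> U})" by blast
    show "openin X {x\<in>topspace X. ?r x \<in> \<Union>K}"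
      unfolding eq using K by (intro openin_Union) blast
  qed
  then show ?thesis
    by (simp add: X_inf_def)
qed

lemma topspace_X_inf: "topspace (X_inf X S) = topspace X // RP_inf X S"
proof -
  have "{x\<in>topspace X. RP_inf X S `` {x} \<in> topspace X // RP_inf X S} = topspace X"
    by (auto simp: quotient_def)
  then have "openin (X_inf X S) (topspace X // RP_inf X S)"
    by (simp add: openin_X_inf)
  then show ?thesis
    using openin_subset openin_X_inf[of X S "topspace (X_inf X S)"] by blast
qed


section \<open>A universe for minimal systems\<close>

text \<open>A minimal system has a countable dense orbit, hence at most \<open>2\<^bsup>2\<^bsup>\<aleph>\<^sub>0\<^esup>\<^esup>\<close> points, so every
  minimal system is isomorphic to one carried by a subset of \<^typ>\<open>nat set set\<close>. Existence of a
  minimal system can therefore be stated over this type without loss of generality.\<close>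

lemma minimal_system_embeds:
  assumes "minimal_system (X :: 'a topology) S"
  shows "\<exists>e :: 'a \<Rightarrow> nat set set. inj_on e (topspace X)"
proof (cases "topspace X = {}")
  case False
  then obtain x0 where x0: "x0 \<in> topspace X" by blast
  define d where "d n = act X S (from_nat n) x0" for n :: nat
  have "range d = range (\<lambda>n. act X S n x0)"
  proof -
    have "range d = (\<lambda>n. act X S n x0) ` range (from_nat :: nat \<Rightarrow> int)"
      unfolding d_def by (rule image_image [symmetric])
    then show ?thesis by (simp only: surj_from_nat)
  qed
  then have dense: "X closure_of range d = topspace X"
    using assms x0 by (simp add: minimal_system_def)
  define e where "e x = {N :: nat set. x \<in> X closure_of (d ` N)}" for x
  have "inj_on e (topspace X)"
  proof (rule inj_onI, rule ccontr)
    fix x y assume xy: "x \<in> topspace X" "y \<in> topspace X" "e x = e y" "x \<noteq> y"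
    have "Hausdorff_space X"
      using assms by (simp add: minimal_system_def dyn_system_def)
    then obtain U V where UV: "openin X U" "openin X V" "x \<in> U" "y \<in> V" "disjnt U V"
      using xy(1,2,4) unfolding Hausdorff_space_def by blast
    let ?N = "{n. d n \<in> U}"
    have "\<exists>z. z \<in> d ` ?N \<and> z \<in> W" if "x \<in> W" "openin X W" for W
    proof -
      have "x \<in> X closure_of range d" using dense xy by simp
      moreover have "openin X (U \<inter> W)" "x \<in> U \<inter> W" using that UV by auto
      ultimately obtain z where "z \<in> range d" "z \<in> U \<inter> W"
        unfolding in_closure_of by blast
      then show ?thesis by auto
    qed
    then have "?N \<in> e x"
      using xy(1) unfolding e_def in_closure_of by blast
    then have "y \<in> X closure_of (d ` ?N)"
      using xy(3) unfolding e_def by blast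
    then obtain z where "z \<in> d ` ?N" "z \<in> V"
      using UV unfolding in_closure_of by blast
    then show False using UV(5) unfolding disjnt_iff by blast
  qed
  then show ?thesis by blast
qed simp

end

theory Submission
  imports Defs
begin

text \<open>Elements of \<open>HK\<^sup>[\<^sup>k\<^sup>]\<close> are the affine maps \<open>\<epsilon> \<mapsto> j + \<Sum>i\<in>\<epsilon>. n i\<close>, elements of \<open>F\<^sup>[\<^sup>k\<^sup>]\<close> those with
  \<open>j = 0\<close>. The algebraic input is that \<open>x\<^sup>[\<^sup>k\<^sup>]\<close> lies in the \<open>F\<^sup>[\<^sup>k\<^sup>]\<close>-orbit closure of every
  \<open>z \<in> Q\<^sup>[\<^sup>k\<^sup>]\<close> over \<open>x\<close>. In the Ellis group \<open>G = u L\<close> with \<open>u x = x\<close>, the point \<open>z\<close> may be written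
  \<open>h x\<^sup>[\<^sup>k\<^sup>]\<close> with \<open>h\<close> a \<open>G\<close>-valued limit of affine maps and \<open>h\<^sub>\<emptyset> = u\<close>; since \<open>h\<close> is the upper half of a limit of
  linear maps on a cube of one more dimension, a telescoping product of pullbacks along maps of
  cubes shows that \<open>h\<close> itself is, away from \<open>\<emptyset>\<close>, a limit of linear maps, and such limits are invertible.

  It follows that \<open>(x, y)\<close> is in \<open>RP\<^sup>[\<^sup>\<infinity>\<^sup>]\<close> iff \<open>(x, y, \<dots>, y)\<close> is a cube in every dimension, and that this is a closed
  invariant equivalence relation. At a point \<open>x\<close> of continuity of the lower semicontinuous maps
  \<open>x \<mapsto> \<close> orbit closure of \<open>x\<^sup>[\<^sup>k\<^sup>]\<close>, the orbit closure is the whole fibre of \<open>Q\<^sup>[\<^sup>k\<^sup>]\<close>, so coordinates can be moved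
  inside the class of \<open>x\<close> one by one: all tuples in this class are cubes.

  Let \<open>x0\<close> be a point at which the class map into the hyperspace of closed sets is continuous. Take
  \<open>Y'\<close> to be the orbit closure of the class of \<open>x0\<close> in the hyperspace and \<open>X' = {(x, A). A \<in> Y', x \<in> A}\<close>. Over points of
  continuity the fibres of \<open>Y'\<close> are singletons, which gives minimality and the two almost one-to-one extensions. Tuples
  in one member of \<open>Y'\<close> are cubes of \<open>X\<close>, by density of one such member, hence lift to cubes of \<open>X'\<close>
  over the class of \<open>x0\<close>; the map \<open>X' \<rightarrow> Y'\<close> being open, this propagates to all of \<open>Q\<^sup>[\<^sup>d\<^sup>](Y')\<close>.\<close>

section \<open>Systems\<close>

text \<open>For integer families the passage from affine to linear is subtraction of the value at
  \<open>{}\<close>. This is why limits are first normalised to values in the group \<open>G\<close>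
  and then recovered from quotients along single directions. The vertex \<open>{}\<close> stays
  exceptional throughout, since limits of linear maps are the identity there, which in general is
  not an element of \<open>G\<close>. Two Baire arguments are made, in different spaces. The one
  about diagonal orbit closures lives in \<open>X\<close> and uses a countable base. The one about
  continuity of the class map lives in the quotient \<open>X_inf X S\<close>, because both almost
  one-to-one extensions take their G-delta set from a single G-delta set of classes; it rests on
  compactness and regularity of the quotient. The two generic points need not agree, and minimality
  of the hyperspace system carries the information from one to the other.\<close>

locale dyn =
  fixes X :: "'a topology" and S :: "'a \<Rightarrow> 'a"
  assumes dyn: "dyn_system X S"
begin

lemma compact: "compact_space X" and Hausdorff: "Hausdorff_space X"
  and homeo: "homeomorphic_map X X S"
  using dyn by (auto simp: dyn_system_def)

abbreviation "T \<equiv> topspace X"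

lemma bij: "bij_betw S T T"
  using homeo by (auto simp: bij_betw_def homeomorphic_eq_everything_map)

lemma S_in [simp]: "x \<in> T \<Longrightarrow> S x \<in> T"
  using bij by (auto simp: bij_betw_def)

lemma inv_in [simp]: "x \<in> T \<Longrightarrow> inv_into T S x \<in> T"
  using bij by (metis bij_betw_def inv_into_into)

lemma S_inv [simp]: "x \<in> T \<Longrightarrow> S (inv_into T S x) = x"
  using bij by (metis bij_betw_def f_inv_into_f)

lemma inv_S [simp]: "x \<in> T \<Longrightarrow> inv_into T S (S x) = x"
  using bij by (metis bij_betw_def inv_into_f_f)

lemma act_0 [simp]: "act X S 0 x = x"
  by (simp add: act_def)

lemma funpow_in: "x \<in> T \<Longrightarrow> (S ^^ k) x \<in> T" "x \<in> T \<Longrightarrow> (inv_into T S ^^ k) x \<in> T"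
  by (induction k) auto

lemma act_in [simp]: "x \<in> T \<Longrightarrow> act X S n x \<in> T"
  by (simp add: act_def funpow_in)

lemma act_Suc: assumes "x \<in> T" shows "act X S (n + 1) x = S (act X S n x)"
proof (cases "n \<ge> 0")
  case True
  then have "nat (n + 1) = Suc (nat n)" by simp
  with True show ?thesis by (simp add: act_def)
next
  case False
  define k where "k = nat (- n) - 1"
  have k: "nat (- n) = Suc k" and n: "n = - int (Suc k)" using False by (auto simp: k_def)
  have R: "act X S n x = inv_into T S ((inv_into T S ^^ k) x)"
    using False k by (simp add: act_def)
  \<comment> \<open>For \<open>k = 0\<close>, that is \<open>n = -1\<close>, the exponent
    \<open>n + 1\<close> falls into the nonnegative branch of \<open>act\<close>.\<close>
  have "act X S (n + 1) x = (inv_into T S ^^ k) x"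
    by (cases "k = 0") (simp_all add: act_def n)
  then show ?thesis
    using R assms funpow_in by simp
qed

lemma act_1: "act X S 1 x = S x"
  by (simp add: act_def)

lemma act_pred: assumes "x \<in> T" shows "act X S (n - 1) x = inv_into T S (act X S n x)"
  using act_Suc[OF assms, of "n - 1"] assms by simp

lemma act_add: assumes "x \<in> T" shows "act X S (m + n) x = act X S m (act X S n x)"
proof (induction m rule: int_induct[where k = 0])
  case base
  then show ?case by simp
next
  case (step1 i)
  have "act X S (i + n + 1) x = S (act X S (i + n) x)" by (rule act_Suc[OF assms])
  moreover have "i + 1 + n = i + n + 1" by simp
  ultimately show ?case using step1 assms by (simp only: act_Suc act_in)
next
  case (step2 i)
  have "act X S (i + n - 1) x = inv_into T S (act X S (i + n) x)" by (rule act_pred[OF assms])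
  moreover have "i - 1 + n = i + n - 1" by simp
  ultimately show ?case using step2 assms by (simp only: act_pred act_in)
qed

lemma act_minus [simp]: "x \<in> T \<Longrightarrow> act X S (- n) (act X S n x) = x"
  "x \<in> T \<Longrightarrow> act X S n (act X S (- n) x) = x"
  by (metis act_add act_0 add.left_inverse, metis act_add act_0 add.right_inverse)

lemma continuous_S: "continuous_map X X S"
  using homeo by (simp add: homeomorphic_imp_continuous_map)

lemma continuous_inv: "continuous_map X X (inv_into T S)"
proof -
  obtain g where g: "homeomorphic_maps X X S g"
    using homeo by (auto simp: homeomorphic_map_maps)
  have "g x = inv_into T S x" if "x \<in> T" for x
  proof -
    have "g (S (inv_into T S x)) = inv_into T S x" using g inv_in[OF that] unfolding homeomorphic_maps_def by blast
    then show ?thesis using that by simp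
  qed
  moreover have "continuous_map X X g" using g unfolding homeomorphic_maps_def by blast
  ultimately show ?thesis using continuous_map_eq by blast
qed

lemma continuous_act: "continuous_map X X (act X S n)"
proof -
  have pow: "continuous_map X X (f ^^ k)" if "continuous_map X X f" for f k
  proof (induction k)
    case (Suc k)
    then show ?case using that continuous_map_compose[of X X "f ^^ k" X f]
      by (simp add: o_def)
  qed (simp add: id_def)
  show ?thesis
    unfolding act_def using pow continuous_S continuous_inv by simp
qed

end

text \<open>Stated for bare equivariant maps, so that projections of products and inclusions of
  invariant subsets are covered as well as extensions. The step to \<open>i - 1\<close> cancels
  \<open>R\<close> by its injectivity on the carrier.\<close>

lemma equivariant_act:
  assumes X: "dyn_system X S" and Y: "dyn_system Y R"
    and im: "\<And>z. z \<in> topspace X \<Longrightarrow> \<phi> z \<in> topspace Y" and eq: "\<And>z. z \<in> topspace X \<Longrightarrow> \<phi> (S z) = R (\<phi> z)"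
    and x: "x \<in> topspace X"
  shows "\<phi> (act X S n x) = act Y R n (\<phi> x)"
proof -
  interpret X: dyn X S by unfold_locales (rule X)
  interpret Y: dyn Y R by unfold_locales (rule Y)
  show ?thesis
  proof (induction n rule: int_induct[where k = 0])
    case base
    then show ?case by simp
  next
    case (step1 i)
    then show ?case using x by (simp add: X.act_Suc Y.act_Suc eq im)
  next
    case (step2 i)
    have "R (\<phi> (act X S (i - 1) x)) = act Y R i (\<phi> x)"
      using eq[of "act X S (i - 1) x"] X.act_Suc[OF x, of "i - 1"] step2 x by simp
    then have "inv_into (topspace Y) R (R (\<phi> (act X S (i - 1) x))) = act Y R (i - 1) (\<phi> x)"
      using Y.act_pred[OF im[OF x], of i] by simp
    then show ?case using im x by simp
  qed
qed

lemma extension_act: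
  assumes "dyn_system X S" "dyn_system Y R" "extension X S Y R \<phi>" "x \<in> topspace X"
  shows "\<phi> (act X S n x) = act Y R n (\<phi> x)"
proof (rule equivariant_act[OF assms(1,2) _ _ assms(4)])
  show "\<phi> z \<in> topspace Y" "\<phi> (S z) = R (\<phi> z)" if "z \<in> topspace X" for z
    using assms(3) that unfolding extension_def by blast+
qed

section \<open>Cube groups\<close>

definition aff :: "int \<Rightarrow> (nat \<Rightarrow> int) \<Rightarrow> nat set \<Rightarrow> int" where
  "aff j n \<epsilon> = j + (\<Sum>i\<in>\<epsilon>. n i)"

lemma cube_group_simps:
  "\<one>\<^bsub>cube_group d\<^esub> = (\<lambda>\<epsilon>\<in>vertices d. 0)"
  "f \<otimes>\<^bsub>cube_group d\<^esub> g = (\<lambda>\<epsilon>\<in>vertices d. f \<epsilon> + g \<epsilon>)"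
  "carrier (cube_group d) = (\<Pi>\<^sub>E \<epsilon>\<in>vertices d. UNIV)"
  by (auto simp: cube_group_def product_group_def)

lemma group_cube_group: "group (cube_group d)"
  unfolding cube_group_def by simp

lemma inv_cube_group:
  assumes "f \<in> carrier (cube_group d)"
  shows "inv\<^bsub>cube_group d\<^esub> f = (\<lambda>\<epsilon>\<in>vertices d. - f \<epsilon>)"
proof -
  interpret group "cube_group d" by (rule group_cube_group)
  show ?thesis
    using assms by (intro inv_equality) (auto simp: cube_group_simps)
qed

lemma aff_add: "aff j n \<epsilon> + aff j' n' \<epsilon> = aff (j + j') (\<lambda>i. n i + n' i) \<epsilon>"
  by (simp add: aff_def sum.distrib)

lemma aff_minus: "- aff j n \<epsilon> = aff (- j) (\<lambda>i. - n i) \<epsilon>"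
  by (simp add: aff_def sum_negf)

lemma aff_empty [simp]: "aff j n {} = j"
  by (simp add: aff_def)

lemma finite_vertex: "\<epsilon> \<in> vertices d \<Longrightarrow> finite \<epsilon>"
  by (meson PowD finite_atLeastAtMost finite_subset)

text \<open>One induction serves both groups: \<open>P\<close> singles out the admissible values at
  the vertex \<open>{}\<close>, which are \<open>j = 0\<close> for \<open>F_group\<close> and
  arbitrary for \<open>HK_group\<close>.\<close>

lemma generate_cube_group_subset:
  assumes gens: "G \<subseteq> {(\<lambda>\<epsilon>\<in>vertices d. aff j n \<epsilon>) | j n. P j}"
    and P: "P 0" "\<And>j j'. P j \<Longrightarrow> P j' \<Longrightarrow> P (j + j')" "\<And>j. P j \<Longrightarrow> P (- j)"
  shows "generate (cube_group d) G \<subseteq> {(\<lambda>\<epsilon>\<in>vertices d. aff j n \<epsilon>) | j n. P j}"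
proof
  have car: "f \<in> carrier (cube_group d)" if f: "f \<in> {(\<lambda>\<epsilon>\<in>vertices d. aff j n \<epsilon>) | j n. P j}" for f
  proof -
    obtain j n where "f = (\<lambda>\<epsilon>\<in>vertices d. aff j n \<epsilon>)" using f by blast
    then show ?thesis unfolding cube_group_simps by (simp only: restrict_PiE) blast
  qed
  fix f assume "f \<in> generate (cube_group d) G"
  then show "f \<in> {(\<lambda>\<epsilon>\<in>vertices d. aff j n \<epsilon>) | j n. P j}"
  proof induction
    case one
    have "\<one>\<^bsub>cube_group d\<^esub> = (\<lambda>\<epsilon>\<in>vertices d. aff 0 (\<lambda>_. 0) \<epsilon>)"
      by (simp add: cube_group_simps aff_def)
    with P(1) show ?case by blast
  next
    case (incl h)
    then show ?case using gens by blast
  next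
    case (inv h)
    then obtain j n where h: "h = (\<lambda>\<epsilon>\<in>vertices d. aff j n \<epsilon>)" "P j" using gens by blast
    have "inv\<^bsub>cube_group d\<^esub> h = (\<lambda>\<epsilon>\<in>vertices d. aff (- j) (\<lambda>i. - n i) \<epsilon>)"
    proof -
      have "h \<in> carrier (cube_group d)" using h by (intro car) blast
      then show ?thesis
        unfolding inv_cube_group[OF \<open>h \<in> carrier (cube_group d)\<close>]
        by (auto simp: h aff_minus intro!: restrict_ext)
    qed
    with P(3) h show ?case by blast
  next
    case (eng h1 h2)
    then obtain j n j' n' where h: "h1 = (\<lambda>\<epsilon>\<in>vertices d. aff j n \<epsilon>)" "P j"
        "h2 = (\<lambda>\<epsilon>\<in>vertices d. aff j' n' \<epsilon>)" "P j'" by blast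
    have "h1 \<otimes>\<^bsub>cube_group d\<^esub> h2 = (\<lambda>\<epsilon>\<in>vertices d. aff (j + j') (\<lambda>i. n i + n' i) \<epsilon>)"
      by (auto simp: h cube_group_simps aff_add)
    with P(2) h show ?case by blast
  qed
qed

lemma face_elt_upper:
  "i \<in> {1..d} \<Longrightarrow> face_elt d t {\<epsilon>\<in>vertices d. i \<in> \<epsilon>} = (\<lambda>\<epsilon>\<in>vertices d. aff 0 (\<lambda>k. if k = i then t else 0) \<epsilon>)"
  by (auto simp: face_elt_def aff_def fun_eq_iff restrict_def finite_vertex)

text \<open>The indicator of a lower facet is a constant minus the indicator of the opposite upper
  facet.\<close>

lemma face_elt_lower:
  "i \<in> {1..d} \<Longrightarrow> face_elt d t {\<epsilon>\<in>vertices d. i \<notin> \<epsilon>} = (\<lambda>\<epsilon>\<in>vertices d. aff t (\<lambda>k. if k = i then - t else 0) \<epsilon>)"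
  by (auto simp: face_elt_def aff_def fun_eq_iff restrict_def finite_vertex)

lemma upper_facets_eq: "upper_facets d = {{\<epsilon>\<in>vertices d. i \<in> \<epsilon>} | i. i \<in> {1..d}}"
proof -
  have "{1..d} \<in> {\<epsilon>\<in>vertices d. i \<in> \<epsilon>}" "{1..d} \<notin> {\<epsilon>\<in>vertices d. i \<notin> \<epsilon>}" if "i \<in> {1..d}" for i
    using that by auto
  then show ?thesis unfolding upper_facets_def facets_def by blast
qed

text \<open>Directions are added one at a time. The generating set \<open>G\<close> is left open
  because the upper facet elements lie in both groups; coefficients outside \<open>{1..d}\<close>
  are invisible on the vertices.\<close>

lemma upper_generated:
  assumes gen: "\<And>t i. i \<in> {1..d} \<Longrightarrow> face_elt d t {\<epsilon>\<in>vertices d. i \<in> \<epsilon>} \<in> generate (cube_group d) G"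
  shows "(\<lambda>\<epsilon>\<in>vertices d. aff 0 n \<epsilon>) \<in> generate (cube_group d) G"
proof -
  have "(\<lambda>\<epsilon>\<in>vertices d. aff 0 (\<lambda>i. if i \<in> {1..m} then n i else 0) \<epsilon>) \<in> generate (cube_group d) G"
    if "m \<le> d" for m
    using that
  proof (induction m)
    case 0
    have "(\<lambda>\<epsilon>\<in>vertices d. aff 0 (\<lambda>i. if i \<in> {1..0} then n i else 0) \<epsilon>) = \<one>\<^bsub>cube_group d\<^esub>"
      by (simp add: cube_group_simps aff_def)
    then show ?case by (metis generate.one)
  next
    case (Suc m)
    have i: "Suc m \<in> {1..d}" using Suc.prems by simp
    have "(\<lambda>\<epsilon>\<in>vertices d. aff 0 (\<lambda>i. if i \<in> {1..Suc m} then n i else 0) \<epsilon>) =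
       (\<lambda>\<epsilon>\<in>vertices d. aff 0 (\<lambda>i. if i \<in> {1..m} then n i else 0) \<epsilon>) \<otimes>\<^bsub>cube_group d\<^esub>
       face_elt d (n (Suc m)) {\<epsilon>\<in>vertices d. Suc m \<in> \<epsilon>}"
      using Suc.prems
      by (simp only: cube_group_simps face_elt_upper[OF i])
        (auto simp: aff_add intro!: restrict_ext arg_cong[where f = "\<lambda>n. aff 0 n _"] ext)
    moreover have "(\<lambda>\<epsilon>\<in>vertices d. aff 0 (\<lambda>i. if i \<in> {1..m} then n i else 0) \<epsilon>) \<in> generate (cube_group d) G"
      by (rule Suc.IH[OF Suc_leD[OF Suc.prems]])
    ultimately show ?case using generate.eng[OF _ gen[OF i, of "n (Suc m)"]] by (simp only:)
  qed
  from this[of d] have "(\<lambda>\<epsilon>\<in>vertices d. aff 0 (\<lambda>i. if i \<in> {1..d} then n i else 0) \<epsilon>) \<in> generate (cube_group d) G"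
    by simp
  moreover have "aff 0 (\<lambda>i. if i \<in> {1..d} then n i else 0) \<epsilon> = aff 0 n \<epsilon>" if "\<epsilon> \<in> vertices d" for \<epsilon>
    using that unfolding aff_def by (intro arg_cong2[where f = "(+)"] sum.cong) auto
  then have "(\<lambda>\<epsilon>\<in>vertices d. aff 0 (\<lambda>i. if i \<in> {1..d} then n i else 0) \<epsilon>) = (\<lambda>\<epsilon>\<in>vertices d. aff 0 n \<epsilon>)"
    by (rule restrict_ext)
  ultimately show ?thesis by (simp only:)
qed

lemma F_group_eq: "F_group d = {(\<lambda>\<epsilon>\<in>vertices d. aff 0 n \<epsilon>) | n. True}"
proof -
  have "F_group d \<subseteq> {(\<lambda>\<epsilon>\<in>vertices d. aff j n \<epsilon>) | j n. j = 0}"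
    unfolding F_group_def upper_facets_eq
  proof (rule generate_cube_group_subset)
    show "{face_elt d t \<alpha> |t \<alpha>. \<alpha> \<in> {{\<epsilon> \<in> vertices d. i \<in> \<epsilon>} |i. i \<in> {1..d}}}
      \<subseteq> {restrict (aff j n) (vertices d) |j n. j = 0}"
      using face_elt_upper by blast
  qed auto
  moreover have "(\<lambda>\<epsilon>\<in>vertices d. aff 0 n \<epsilon>) \<in> F_group d" for n
    unfolding F_group_def upper_facets_eq by (intro upper_generated generate.incl) blast
  ultimately show ?thesis by blast
qed

text \<open>The constant \<open>j\<close> is the product of the two opposite facet elements in
  direction 1, a direction that exists only for positive \<open>d\<close>; without facets the group
  is trivial.\<close>

lemma HK_group_eq: assumes "d \<ge> 1" shows "HK_group d = {(\<lambda>\<epsilon>\<in>vertices d. aff j n \<epsilon>) | j n. True}"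
proof -
  have "{face_elt d t \<alpha> |t \<alpha>. \<alpha> \<in> facets d} \<subseteq> {(\<lambda>\<epsilon>\<in>vertices d. aff j n \<epsilon>) | j n. True}"
  proof clarify
    fix t \<alpha> assume "\<alpha> \<in> facets d"
    then obtain i where "i \<in> {1..d}" "\<alpha> = {\<epsilon>\<in>vertices d. i \<in> \<epsilon>} \<or> \<alpha> = {\<epsilon>\<in>vertices d. i \<notin> \<epsilon>}"
      unfolding facets_def by blast
    then show "\<exists>j n. face_elt d t \<alpha> = restrict (aff j n) (vertices d) \<and> True"
      using face_elt_lower face_elt_upper by blast
  qed
  then have "HK_group d \<subseteq> {(\<lambda>\<epsilon>\<in>vertices d. aff j n \<epsilon>) | j n. True}"
    unfolding HK_group_def by (rule generate_cube_group_subset) auto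
  moreover have "(\<lambda>\<epsilon>\<in>vertices d. aff j n \<epsilon>) \<in> HK_group d" for j n
  proof -
    have i: "1 \<in> {1..d}" using assms by simp
    have up: "face_elt d t {\<epsilon>\<in>vertices d. i \<in> \<epsilon>} \<in> HK_group d" if "i \<in> {1..d}" for t i
      unfolding HK_group_def facets_def using that by (intro generate.incl) blast
    have lo: "face_elt d t {\<epsilon>\<in>vertices d. i \<notin> \<epsilon>} \<in> HK_group d" if "i \<in> {1..d}" for t i
      unfolding HK_group_def facets_def using that by (intro generate.incl) blast
    have F: "(\<lambda>\<epsilon>\<in>vertices d. aff 0 n \<epsilon>) \<in> HK_group d"
      unfolding HK_group_def by (rule upper_generated) (use up in \<open>simp add: HK_group_def\<close>)
    have "(\<lambda>\<epsilon>\<in>vertices d. aff j n \<epsilon>) = 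
       (face_elt d j {\<epsilon>\<in>vertices d. 1 \<in> \<epsilon>} \<otimes>\<^bsub>cube_group d\<^esub> face_elt d j {\<epsilon>\<in>vertices d. 1 \<notin> \<epsilon>})
         \<otimes>\<^bsub>cube_group d\<^esub> (\<lambda>\<epsilon>\<in>vertices d. aff 0 n \<epsilon>)"
      by (auto simp: cube_group_simps face_elt_def aff_def)
    then show ?thesis
      using generate.eng[OF generate.eng[OF up[OF i, of j, unfolded HK_group_def] lo[OF i, of j, unfolded HK_group_def]]
        F[unfolded HK_group_def]] unfolding HK_group_def by (simp only:)
  qed
  ultimately show ?thesis by blast
qed

lemma HK_group_0: "HK_group 0 = {(\<lambda>\<epsilon>\<in>vertices 0. 0)}"
  by (simp add: HK_group_def facets_def group.generate_empty[OF group_cube_group] cube_group_simps)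

text \<open>In dimension 0 the group contributes no constants, but \<open>act X S j x\<close> is
  again a point of the carrier, so the set of generating cubes is the same and the formula holds in
  every dimension.\<close>

lemma Q_cubes_eq:
  assumes "dyn_system X S"
  shows "Q_cubes d X S = cube_space d X closure_of
     {(\<lambda>\<epsilon>\<in>vertices d. act X S (aff j n \<epsilon>) x) | j n x. x \<in> topspace X}"
proof -
  interpret dyn X S by unfold_locales (rule assms)
  have "{cube_act d X S t (diag d x) | t x. t \<in> HK_group d \<and> x \<in> topspace X} = 
    {(\<lambda>\<epsilon>\<in>vertices d. act X S (aff j n \<epsilon>) x) | j n x. x \<in> topspace X}" (is "?L = ?R")
  proof (cases "d = 0")
    case True
    have "?L = {(\<lambda>\<epsilon>\<in>vertices d. x) |x. x \<in> topspace X}"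
      unfolding True HK_group_0 by (auto simp: cube_act_def diag_def intro!: restrict_ext)
    also have "\<dots> = ?R"
      unfolding True
    proof (intro equalityI subsetI; clarify)
      fix x assume "x \<in> T"
      have "(\<lambda>\<epsilon>\<in>vertices 0. x) = (\<lambda>\<epsilon>\<in>vertices 0. act X S (aff 0 (\<lambda>_. 0) \<epsilon>) x)"
        by (simp add: aff_def)
      then show "\<exists>j n y. (\<lambda>\<epsilon>\<in>vertices 0. x) = (\<lambda>\<epsilon>\<in>vertices 0. act X S (aff j n \<epsilon>) y) \<and> y \<in> T"
        using \<open>x \<in> T\<close> by blast
    next
      fix x j n assume "x \<in> T"
      then show "\<exists>y. (\<lambda>\<epsilon>\<in>vertices 0. act X S (aff j n \<epsilon>) x) = (\<lambda>\<epsilon>\<in>vertices 0. y) \<and> y \<in> T"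
        by (intro exI[of _ "act X S j x"]) (simp add: aff_def restrict_def fun_eq_iff)
    qed
    finally show ?thesis .
  next
    case False
    then have d: "d \<ge> 1" by simp
    have eq: "cube_act d X S (\<lambda>\<epsilon>\<in>vertices d. aff j n \<epsilon>) (diag d x) = (\<lambda>\<epsilon>\<in>vertices d. act X S (aff j n \<epsilon>) x)" for j n x
      by (auto simp: cube_act_def diag_def)
    show ?thesis unfolding HK_group_eq[OF d]
    proof (intro equalityI subsetI; clarify)
      fix x j n assume "x \<in> T"
      then show "\<exists>ja na xa. cube_act d X S (restrict (aff j n) (vertices d)) (diag d x) =
          (\<lambda>\<epsilon>\<in>vertices d. act X S (aff ja na \<epsilon>) xa) \<and> xa \<in> T"
        using eq by blast
    next
      fix x j n assume "x \<in> T"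
      then show "\<exists>t xa. (\<lambda>\<epsilon>\<in>vertices d. act X S (aff j n \<epsilon>) x) = cube_act d X S t (diag d xa) \<and>
          t \<in> {restrict (aff j n) (vertices d) |j n. True} \<and> xa \<in> T"
        using eq[of j n x, symmetric] by blast
    qed
  qed
  then show ?thesis by (simp add: Q_cubes_def)
qed

text \<open>Keeps the \<open>1\<close> in intervals \<open>{1..k}\<close> from being rewritten to
  \<open>Suc 0\<close>.\<close>

declare One_nat_def [simp del]

section \<open>Continuous maps between cube spaces\<close>

lemma continuous_map_family:
  assumes "\<And>i. i \<in> I \<Longrightarrow> continuous_map Z (Y i) (g i)"
  shows "continuous_map Z (product_topology Y I) (\<lambda>p. \<lambda>i\<in>I. g i p)"
  unfolding continuous_map_componentwise
proof (intro conjI ballI)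
  fix k assume "k \<in> I"
  then show "continuous_map Z (Y k) (\<lambda>x. (\<lambda>i\<in>I. g i x) k)"
    using assms[of k] by (simp add: restrict_apply')
qed auto

lemma continuous_map_reindex:
  assumes "\<phi> ` J \<subseteq> I"
  shows "continuous_map (product_topology (\<lambda>_. X) I) (product_topology (\<lambda>_. X) J) (\<lambda>p. \<lambda>j\<in>J. p (\<phi> j))"
  using assms by (intro continuous_map_family) (auto intro: continuous_map_product_projection)

lemma continuous_map_coordinatewise:
  assumes "\<And>i. i \<in> I \<Longrightarrow> continuous_map X Y (g i)"
  shows "continuous_map (product_topology (\<lambda>_. X) I) (product_topology (\<lambda>_. Y) I) (\<lambda>p. \<lambda>i\<in>I. g i (p i))"
proof (intro continuous_map_family)
  fix i assume i: "i \<in> I"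
  show "continuous_map (product_topology (\<lambda>_. X) I) Y (\<lambda>p. g i (p i))"
    using continuous_map_compose[OF continuous_map_product_projection[OF i] assms[OF i]] by (simp add: o_def)
qed

text \<open>The recurring passage to the limit: a closed condition that is verified on orbit points
  persists on the orbit closure.\<close>

lemma continuous_map_closure_mem:
  assumes "continuous_map X Y f" "x \<in> X closure_of A" "\<And>a. a \<in> A \<Longrightarrow> a \<in> topspace X \<Longrightarrow> f a \<in> C" "closedin Y C"
  shows "f x \<in> C"
proof -
  have "x \<in> X closure_of (topspace X \<inter> A)" using assms(2) by (metis closure_of_restrict)
  then have "f x \<in> Y closure_of f ` (topspace X \<inter> A)"
    using continuous_map_image_closure_subset[OF assms(1)] by blast
  moreover have "Y closure_of f ` (topspace X \<inter> A) \<subseteq> C"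
    using assms(3,4) by (intro closure_of_minimal) (auto simp only: image_subset_iff Int_iff)
  ultimately show ?thesis by blast
qed

lemma closure_meets:
  assumes "x \<in> X closure_of A" "openin X U" "x \<in> U"
  obtains y where "y \<in> A" "y \<in> U" "y \<in> topspace X"
proof -
  obtain y where "y \<in> A" "y \<in> U" using assms unfolding in_closure_of by metis
  then show ?thesis using that openin_subset[OF assms(2)] by (metis subsetD)
qed

lemma closure_of_superset:
  assumes "A \<subseteq> B" "X closure_of A = topspace X" shows "X closure_of B = topspace X"
  using closure_of_mono[OF assms(1), of X] closure_of_subset_topspace[of X B] assms(2) by (intro equalityI) simp_all

lemma product_neighbourhood:
  assumes "openin (product_topology (\<lambda>_. X) I) W" "p \<in> W"
  obtains U where "\<And>i. i \<in> I \<Longrightarrow> openin X (U i)" "p \<in> Pi\<^sub>E I U" "Pi\<^sub>E I U \<subseteq> W"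
proof -
  from assms have "\<exists>U. finite {i \<in> I. U i \<noteq> topspace X} \<and> (\<forall>i\<in>I. openin X (U i)) \<and> p \<in> Pi\<^sub>E I U \<and> Pi\<^sub>E I U \<subseteq> W"
    unfolding openin_product_topology_alt by (rule bspec)
  then obtain U where "\<forall>i\<in>I. openin X (U i)" "p \<in> Pi\<^sub>E I U" "Pi\<^sub>E I U \<subseteq> W"
    by (elim exE conjE)
  then show ?thesis using that[of U] by (simp only:)
qed

text \<open>Continuity gives one inclusion, and closedness of a map from a compact to a Hausdorff
  space gives the other. The second one lifts a point of an orbit closure to a limit of acting
  elements.\<close>

lemma compact_image_closure:
  assumes "continuous_map X Y f" "compact_space X" "Hausdorff_space Y" "A \<subseteq> topspace X"
  shows "f ` (X closure_of A) = Y closure_of (f ` A)"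
  using continuous_map_image_closure_subset[OF assms(1)] continuous_imp_closed_map[OF assms(1-3)] assms(4)
  unfolding closed_map_closure_of_image by blast

section \<open>Affine maps of cubes\<close>

text \<open>The condition is what pullback of cubes needs: composition with \<open>\<phi>\<close>
  turns linear functions into linear ones. No formula for \<open>\<phi>\<close> is imposed, so that
  projections and identifications of directions are treated alike.\<close>

definition linear_cube_map :: "nat \<Rightarrow> nat \<Rightarrow> (nat set \<Rightarrow> nat set) \<Rightarrow> bool" where
  "linear_cube_map k m \<phi> \<longleftrightarrow> \<phi> ` vertices k \<subseteq> vertices m \<and>
     (\<forall>n. \<exists>n'. \<forall>\<epsilon>\<in>vertices k. aff 0 n (\<phi> \<epsilon>) = aff 0 n' \<epsilon>)"

definition affine_cube_map :: "nat \<Rightarrow> nat \<Rightarrow> (nat set \<Rightarrow> nat set) \<Rightarrow> bool" where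
  "affine_cube_map k m \<phi> \<longleftrightarrow> \<phi> ` vertices k \<subseteq> vertices m \<and>
     (\<forall>n. \<exists>j' n'. \<forall>\<epsilon>\<in>vertices k. aff 0 n (\<phi> \<epsilon>) = aff j' n' \<epsilon>)"

lemma linear_imp_affine: "linear_cube_map k m \<phi> \<Longrightarrow> affine_cube_map k m \<phi>"
  unfolding linear_cube_map_def affine_cube_map_def by (elim conjE) (rule conjI, assumption, rule allI, erule allE, erule exE, intro exI)

lemma affine_cube_mapD:
  assumes "affine_cube_map k m \<phi>"
  shows "\<exists>j' n'. \<forall>\<epsilon>\<in>vertices k. aff j n (\<phi> \<epsilon>) = aff j' n' \<epsilon>"
proof -
  have "\<exists>j' n'. \<forall>\<epsilon>\<in>vertices k. aff 0 n (\<phi> \<epsilon>) = aff j' n' \<epsilon>"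
    using assms unfolding affine_cube_map_def by (elim conjE allE)
  then obtain j' n' where "\<forall>\<epsilon>\<in>vertices k. aff 0 n (\<phi> \<epsilon>) = aff j' n' \<epsilon>"
    by (elim exE)
  then have "\<forall>\<epsilon>\<in>vertices k. aff j n (\<phi> \<epsilon>) = aff (j + j') n' \<epsilon>"
    by (simp add: aff_def)
  then show ?thesis by (intro exI)
qed

text \<open>Direction \<open>i\<close> of the target reads the bit \<open>f i\<close> of the source,
  and \<open>A\<close> lists the directions that can be switched on. The pulled back coefficient of
  \<open>l\<close> collects the \<open>n i\<close> with \<open>f i = l\<close>.\<close>

lemma linear_cube_mapI:
  assumes "\<And>\<epsilon>. \<epsilon> \<in> vertices k \<Longrightarrow> \<phi> \<epsilon> = {i \<in> A. f i \<in> \<epsilon>}" "A \<subseteq> {1..m}"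
  shows "linear_cube_map k m \<phi>"
  unfolding linear_cube_map_def
proof (intro conjI allI)
  show "\<phi> ` vertices k \<subseteq> vertices m" using assms by auto
  fix n
  have fin: "finite A" using assms(2) finite_subset by blast
  have "aff 0 n (\<phi> \<epsilon>) = aff 0 (\<lambda>l. \<Sum>i\<in>{i\<in>A. f i = l}. n i) \<epsilon>" if "\<epsilon> \<in> vertices k" for \<epsilon>
  proof -
    have "(\<Sum>l\<in>\<epsilon>. \<Sum>i\<in>{i\<in>{i \<in> A. f i \<in> \<epsilon>}. f i = l}. n i) = (\<Sum>i\<in>{i \<in> A. f i \<in> \<epsilon>}. n i)"
      by (rule sum.group) (use fin finite_vertex[OF that] in auto)
    moreover have "{i\<in>{i \<in> A. f i \<in> \<epsilon>}. f i = l} = {i\<in>A. f i = l}" if "l \<in> \<epsilon>" for l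
      using that by blast
    ultimately show ?thesis using assms(1)[OF that] by (simp add: aff_def)
  qed
  then show "\<exists>n'. \<forall>\<epsilon>\<in>vertices k. aff 0 n (\<phi> \<epsilon>) = aff 0 n' \<epsilon>" by blast
qed

text \<open>The symmetric difference flips the directions in \<open>\<eta>\<close>: their
  coefficients change sign and the value at \<open>\<eta>\<close> becomes the constant. This lets
  any vertex take the role of \<open>{}\<close>.\<close>

lemma affine_cube_map_reflection:
  assumes "\<eta> \<in> vertices k"
  shows "affine_cube_map k k (\<lambda>\<epsilon>. (\<epsilon> - \<eta>) \<union> (\<eta> - \<epsilon>))"
  unfolding affine_cube_map_def
proof (intro conjI allI)
  show "(\<lambda>\<epsilon>. (\<epsilon> - \<eta>) \<union> (\<eta> - \<epsilon>)) ` vertices k \<subseteq> vertices k" using assms by blast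
  fix n
  have "aff 0 n ((\<epsilon> - \<eta>) \<union> (\<eta> - \<epsilon>)) = aff (\<Sum>i\<in>\<eta>. n i) (\<lambda>i. if i \<in> \<eta> then - n i else n i) \<epsilon>"
    if "\<epsilon> \<in> vertices k" for \<epsilon>
  proof -
    have fin: "finite \<epsilon>" "finite \<eta>" using that assms finite_vertex by blast+
    have "(\<Sum>i\<in>\<epsilon>. if i \<in> \<eta> then - n i else n i) = (\<Sum>i\<in>\<epsilon>-\<eta>. n i) - (\<Sum>i\<in>\<epsilon>\<inter>\<eta>. n i)"
      using fin by (simp add: sum.If_cases sum_negf Diff_eq)
    moreover have "(\<Sum>i\<in>\<eta>. n i) = (\<Sum>i\<in>\<eta>-\<epsilon>. n i) + (\<Sum>i\<in>\<epsilon>\<inter>\<eta>. n i)"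
    proof -
      have "\<eta> = (\<eta>-\<epsilon>) \<union> (\<epsilon>\<inter>\<eta>)" by blast
      then have "sum n \<eta> = sum n ((\<eta>-\<epsilon>) \<union> (\<epsilon>\<inter>\<eta>))" by (rule arg_cong)
      also have "\<dots> = sum n (\<eta>-\<epsilon>) + sum n (\<epsilon>\<inter>\<eta>)"
        using fin by (intro sum.union_disjoint) auto
      finally show ?thesis .
    qed
    moreover have "(\<Sum>i\<in>(\<epsilon> - \<eta>) \<union> (\<eta> - \<epsilon>). n i) = (\<Sum>i\<in>\<epsilon>-\<eta>. n i) + (\<Sum>i\<in>\<eta>-\<epsilon>. n i)"
      using fin by (intro sum.union_disjoint) auto
    ultimately show ?thesis by (simp add: aff_def)
  qed
  then show "\<exists>j' n'. \<forall>\<epsilon>\<in>vertices k. aff 0 n ((\<epsilon> - \<eta>) \<union> (\<eta> - \<epsilon>)) = aff j' n' \<epsilon>" by blast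
qed

text \<open>On the facet where the last direction is on, the coefficient \<open>n (Suc k)\<close>
  becomes a constant term, so the embedding is affine without being linear.\<close>

lemma affine_cube_map_upper: "affine_cube_map k (Suc k) (insert (Suc k))"
  unfolding affine_cube_map_def
proof (intro conjI allI)
  show "insert (Suc k) ` vertices k \<subseteq> vertices (Suc k)" by auto
  fix n
  have "aff 0 n (insert (Suc k) \<epsilon>) = aff (n (Suc k)) n \<epsilon>" if "\<epsilon> \<in> vertices k" for \<epsilon>
  proof -
    have "Suc k \<notin> \<epsilon>" using that by auto
    then show ?thesis using finite_vertex[OF that] by (simp add: aff_def)
  qed
  then show "\<exists>j' n'. \<forall>\<epsilon>\<in>vertices k. aff 0 n (insert (Suc k) \<epsilon>) = aff j' n' \<epsilon>" by blast
qed

section \<open>Cubes of a system\<close>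

context dyn
begin

abbreviation "Q k \<equiv> Q_cubes k X S"

lemmas Q_eq = Q_cubes_eq[OF dyn]

lemma compact_cube: "compact_space (cube_space k X)"
  by (simp add: compact_space_product_topology compact)

lemma Hausdorff_cube: "Hausdorff_space (cube_space k X)"
  by (simp add: Hausdorff_space_product_topology Hausdorff)

lemma closedin_Q: "closedin (cube_space k X) (Q k)"
  by (simp add: Q_cubes_def)

lemma Q_subset: "Q k \<subseteq> topspace (cube_space k X)"
  by (rule closedin_subset[OF closedin_Q])

lemma Q_in: "p \<in> Q k \<Longrightarrow> \<epsilon> \<in> vertices k \<Longrightarrow> p \<epsilon> \<in> T"
  using subsetD[OF Q_subset] by (auto simp only: topspace_product_topology dest: PiE_mem)

lemma Q_gen: "x \<in> T \<Longrightarrow> (\<lambda>\<epsilon>\<in>vertices k. act X S (aff j n \<epsilon>) x) \<in> Q k"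
proof -
  assume x: "x \<in> T"
  let ?A = "{(\<lambda>\<epsilon>\<in>vertices k. act X S (aff j n \<epsilon>) x) | j n x. x \<in> T}"
  have "?A \<subseteq> topspace (cube_space k X)"
    by (clarsimp simp only: topspace_product_topology) (simp add: restrict_PiE_iff)
  from closure_of_subset[OF this] show ?thesis unfolding Q_eq using x by blast
qed

lemma Q_image:
  assumes "continuous_map (cube_space m X) (cube_space k X) f" "p \<in> Q m"
    and "\<And>j n x. x \<in> T \<Longrightarrow> f (\<lambda>\<epsilon>\<in>vertices m. act X S (aff j n \<epsilon>) x) \<in> Q k"
  shows "f p \<in> Q k"
  by (rule continuous_map_closure_mem[OF assms(1) assms(2)[unfolded Q_eq] _ closedin_Q], elim CollectE exE conjE) (simp only: assms(3))

lemma Q_reindex: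
  assumes "affine_cube_map k m \<phi>" "p \<in> Q m"
  shows "(\<lambda>\<epsilon>\<in>vertices k. p (\<phi> \<epsilon>)) \<in> Q k"
proof (rule Q_image[OF _ assms(2)])
  have im: "\<phi> ` vertices k \<subseteq> vertices m" using assms(1) unfolding affine_cube_map_def by blast
  then show "continuous_map (cube_space m X) (cube_space k X) (\<lambda>p. \<lambda>\<epsilon>\<in>vertices k. p (\<phi> \<epsilon>))"
    by (rule continuous_map_reindex)
  fix j n x assume x: "x \<in> T"
  obtain j' n' where jn: "\<forall>\<epsilon>\<in>vertices k. aff j n (\<phi> \<epsilon>) = aff j' n' \<epsilon>"
    using affine_cube_mapD[OF assms(1)] by blast
  have "(\<lambda>\<epsilon>\<in>vertices k. (\<lambda>\<epsilon>\<in>vertices m. act X S (aff j n \<epsilon>) x) (\<phi> \<epsilon>)) =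
    (\<lambda>\<epsilon>\<in>vertices k. act X S (aff j' n' \<epsilon>) x)"
  proof (rule restrict_ext)
    fix \<epsilon> assume e: "\<epsilon> \<in> vertices k"
    then have "\<phi> \<epsilon> \<in> vertices m" using im by (rule subsetD[OF _ imageI, rotated])
    then show "(\<lambda>\<epsilon>\<in>vertices m. act X S (aff j n \<epsilon>) x) (\<phi> \<epsilon>) = act X S (aff j' n' \<epsilon>) x"
      using bspec[OF jn e] by (simp only: restrict_apply')
  qed
  then show "(\<lambda>\<epsilon>\<in>vertices k. (\<lambda>\<epsilon>\<in>vertices m. act X S (aff j n \<epsilon>) x) (\<phi> \<epsilon>)) \<in> Q k"
    using Q_gen[OF x] by (simp only:)
qed

lemma continuous_cube_act: "continuous_map (cube_space k X) (cube_space k X) (\<lambda>p. \<lambda>\<epsilon>\<in>vertices k. act X S (f \<epsilon>) (p \<epsilon>))"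
  by (intro continuous_map_coordinatewise continuous_act)

lemma Q_act:
  assumes "p \<in> Q k"
  shows "(\<lambda>\<epsilon>\<in>vertices k. act X S (aff j n \<epsilon>) (p \<epsilon>)) \<in> Q k"
proof (rule Q_image[OF continuous_cube_act assms])
  fix j' n' x assume x: "x \<in> T"
  have "(\<lambda>\<epsilon>\<in>vertices k. act X S (aff j n \<epsilon>) ((\<lambda>\<epsilon>\<in>vertices k. act X S (aff j' n' \<epsilon>) x) \<epsilon>)) =
     (\<lambda>\<epsilon>\<in>vertices k. act X S (aff (j + j') (\<lambda>i. n i + n' i) \<epsilon>) x)"
    using x by (intro restrict_ext) (simp only: restrict_apply' aff_add[symmetric] act_add)
  then show "(\<lambda>\<epsilon>\<in>vertices k. act X S (aff j n \<epsilon>) ((\<lambda>\<epsilon>\<in>vertices k. act X S (aff j' n' \<epsilon>) x) \<epsilon>)) \<in> Q k"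
    using Q_gen[OF x] by (simp only:)
qed

definition F_closure :: "nat \<Rightarrow> (nat set \<Rightarrow> 'a) \<Rightarrow> (nat set \<Rightarrow> 'a) set" where
  "F_closure k p = cube_space k X closure_of range (\<lambda>n. \<lambda>\<epsilon>\<in>vertices k. act X S (aff 0 n \<epsilon>) (p \<epsilon>))"

lemma F_closure_map:
  assumes "q \<in> F_closure k p" "continuous_map (cube_space k X) (cube_space m X) G"
    and "\<And>n. G (\<lambda>\<epsilon>\<in>vertices k. act X S (aff 0 n \<epsilon>) (p \<epsilon>)) \<in> Q m"
  shows "G q \<in> Q m"
  by (rule continuous_map_closure_mem[OF assms(2) assms(1)[unfolded F_closure_def] _ closedin_Q], elim rangeE) (simp only: assms(3))

text \<open>The two blocks in the definition of \<open>RP\<close>, read as one point of dimension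
  \<open>k + 1\<close>: the new direction \<open>Suc k\<close> selects the block, and both blocks
  carry the same \<open>a\<close> away from their first vertex.\<close>

definition double :: "nat \<Rightarrow> 'a \<Rightarrow> 'a \<Rightarrow> (nat set \<Rightarrow> 'a) \<Rightarrow> nat set \<Rightarrow> 'a" where
  "double k x y a = (\<lambda>\<epsilon>\<in>vertices (Suc k). if \<epsilon> = {} then x else if \<epsilon> = {Suc k} then y else a (\<epsilon> - {Suc k}))"

end

locale minimal = dyn +
  assumes orbit_dense: "x \<in> topspace X \<Longrightarrow> X closure_of range (\<lambda>n. act X S n x) = topspace X"

lemma minimal_iff: "minimal X S \<longleftrightarrow> minimal_system X S"
  by (auto simp: minimal_system_def minimal_def minimal_axioms_def dyn_def)

context minimal
begin

lemma orbit_meets: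
  assumes "x \<in> T" "openin X U" "U \<noteq> {}"
  shows "\<exists>n. act X S n x \<in> U"
proof -
  obtain y where "y \<in> U" using assms(3) by blast
  then have "y \<in> X closure_of range (\<lambda>n. act X S n x)"
    using orbit_dense[OF assms(1)] openin_subset[OF assms(2)] by blast
  from closure_meets[OF this assms(2) \<open>y \<in> U\<close>] show ?thesis by (metis rangeE)
qed

lemma closed_invariant:
  assumes "closedin X K" "K \<noteq> {}" "\<And>x n. x \<in> K \<Longrightarrow> act X S n x \<in> K"
  shows "K = T"
proof -
  obtain x where x: "x \<in> K" using assms(2) by blast
  then have "X closure_of range (\<lambda>n. act X S n x) \<subseteq> K"
    using assms(1,3) by (intro closure_of_minimal) auto
  then show ?thesis using orbit_dense[of x] x closedin_subset[OF assms(1)] by blast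
qed

text \<open>By minimality the second point of an approximating pair can be replaced by a translate
  \<open>act X S m u\<close> of the first without leaving an open set. The pair of
  \<open>F\<close>-translates is then a single cube with increment \<open>m\<close> in the new
  direction.\<close>

lemma RP_double:
  assumes "(x, y) \<in> RP k X S"
  shows "\<exists>a. double k x y a \<in> Q (Suc k)"
proof -
  from assms[unfolded RP_def mem_Collect_eq case_prod_conv] obtain a N where xy: "x \<in> T" "y \<in> T"
    and a: "a \<in> (vertices k - {{}}) \<rightarrow>\<^sub>E T"
    and N: "N \<noteq> bot" "\<forall>\<^sub>F (f, u, v) in N. f \<in> F_group k \<and> u \<in> T \<and> v \<in> T"
    and lim: "limitin (cube_space k X) (\<lambda>(f, u, v). cube_act k X S f (diag k u)) (cube_point k x a) N"
      "limitin (cube_space k X) (\<lambda>(f, u, v). cube_act k X S f (diag k v)) (cube_point k y a) N"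
    by (elim conjE bexE exE)
  define h where "h pq = (\<lambda>\<epsilon>\<in>vertices (Suc k). if Suc k \<in> \<epsilon> then snd pq (\<epsilon> - {Suc k}) else fst pq \<epsilon>)"
    for pq :: "(nat set \<Rightarrow> 'a) \<times> (nat set \<Rightarrow> 'a)"
  have V: "\<epsilon> - {Suc k} \<in> vertices k" "Suc k \<notin> \<epsilon> \<Longrightarrow> \<epsilon> \<in> vertices k" if "\<epsilon> \<in> vertices (Suc k)" for \<epsilon>
    using that by (auto simp: atLeastAtMostSuc_conv)
  have ch: "continuous_map (prod_topology (cube_space k X) (cube_space k X)) (cube_space (Suc k) X) h"
    unfolding h_def
  proof (intro continuous_map_family)
    fix \<epsilon> assume e: "\<epsilon> \<in> vertices (Suc k)"
    have c1: "continuous_map (prod_topology (cube_space k X) (cube_space k X)) X (\<lambda>pq. snd pq (\<epsilon> - {Suc k}))"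
      using continuous_map_compose[OF continuous_map_snd continuous_map_product_projection[OF V(1)[OF e]]]
      by (simp add: o_def)
    have c2: "continuous_map (prod_topology (cube_space k X) (cube_space k X)) X (\<lambda>pq. fst pq \<epsilon>)" if "Suc k \<notin> \<epsilon>"
      using continuous_map_compose[OF continuous_map_fst continuous_map_product_projection[OF V(2)[OF e that]]]
      by (simp add: o_def)
    show "continuous_map (prod_topology (cube_space k X) (cube_space k X)) X
          (\<lambda>pq. if Suc k \<in> \<epsilon> then snd pq (\<epsilon> - {Suc k}) else fst pq \<epsilon>)"
      using c1 c2 by (cases "Suc k \<in> \<epsilon>") simp_all
  qed
  let ?H = "\<lambda>(f, u, v). (cube_act k X S f (diag k u), cube_act k X S f (diag k v))"
  have "limitin (prod_topology (cube_space k X) (cube_space k X)) ?H (cube_point k x a, cube_point k y a) N"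
    unfolding limitin_pairwise using lim by (simp add: o_def case_prod_unfold)
  from continuous_map_limit[OF ch this]
  have lim: "limitin (cube_space (Suc k) X) (h \<circ> ?H) (h (cube_point k x a, cube_point k y a)) N" .
  have eq: "h (cube_point k x a, cube_point k y a) = double k x y a"
    unfolding h_def double_def
  proof (intro restrict_ext)
    fix \<epsilon> assume e: "\<epsilon> \<in> vertices (Suc k)"
    then show "(if Suc k \<in> \<epsilon> then snd (cube_point k x a, cube_point k y a) (\<epsilon> - {Suc k})
          else fst (cube_point k x a, cube_point k y a) \<epsilon>) =
         (if \<epsilon> = {} then x else if \<epsilon> = {Suc k} then y else a (\<epsilon> - {Suc k}))"
      using V[OF e] by (auto simp: cube_point_def)
  qed
  have "double k x y a \<in> cube_space (Suc k) X closure_of Q (Suc k)"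
    unfolding in_closure_of
  proof (intro conjI allI impI)
    show "double k x y a \<in> topspace (cube_space (Suc k) X)"
      using lim eq by (simp add: limitin_def)
    fix W assume W: "double k x y a \<in> W \<and> openin (cube_space (Suc k) X) W"
    then have "\<forall>\<^sub>F g in N. h (?H g) \<in> W"
      using lim eq by (simp add: limitin_def)
    with N(2) have "\<forall>\<^sub>F g in N. (case g of (f, u, v) \<Rightarrow> f \<in> F_group k \<and> u \<in> T \<and> v \<in> T) \<and> h (?H g) \<in> W"
      by (rule eventually_conj)
    from eventually_happens[OF this] N(1)
    obtain g where g: "case g of (f, u, v) \<Rightarrow> f \<in> F_group k \<and> u \<in> T \<and> v \<in> T" "h (?H g) \<in> W"
      by (elim exE conjE disjE) simp_all
    obtain f u v where "g = (f, u, v)" by (cases g)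
    with g have fuv: "f \<in> F_group k" "u \<in> T" "v \<in> T" "h (?H (f, u, v)) \<in> W"
      by simp_all
    obtain n where n: "f = (\<lambda>\<epsilon>\<in>vertices k. aff 0 n \<epsilon>)"
      using fuv(1) unfolding F_group_eq by (elim CollectE exE conjE)
    \<comment> \<open>With \<open>f\<close> and \<open>u\<close> frozen the condition on
      \<open>v\<close> is open in \<open>X\<close>, so the orbit of \<open>u\<close> meets
      it.\<close>
    define c where "c v = h (?H (f, u, v))" for v
    have cc: "c v = (\<lambda>\<epsilon>\<in>vertices (Suc k). if Suc k \<in> \<epsilon> then act X S (aff 0 n (\<epsilon> - {Suc k})) v else act X S (aff 0 n \<epsilon>) u)" for v
      unfolding c_def h_def n by (intro restrict_ext) (use V in \<open>simp add: cube_act_def diag_def del: Pow_iff\<close>)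
    have "continuous_map X (cube_space (Suc k) X) c"
      unfolding cc
    proof (intro continuous_map_family)
      fix \<epsilon> assume e: "\<epsilon> \<in> vertices (Suc k)"
      show "continuous_map X X (\<lambda>p. if Suc k \<in> \<epsilon> then act X S (aff 0 n (\<epsilon> - {Suc k})) p else act X S (aff 0 n \<epsilon>) u)"
        by (cases "Suc k \<in> \<epsilon>") (simp_all add: continuous_act fuv)
    qed
    then have "openin X {v \<in> T. c v \<in> W}" using W openin_continuous_map_preimage by blast
    moreover have "{v \<in> T. c v \<in> W} \<noteq> {}" using fuv by (auto simp: c_def)
    ultimately obtain m where m: "c (act X S m u) \<in> W" using orbit_meets[OF fuv(2)] by blast
    have "c (act X S m u) = (\<lambda>\<epsilon>\<in>vertices (Suc k). act X S (aff 0 (n(Suc k := m)) \<epsilon>) u)"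
      unfolding cc
    proof (intro restrict_ext)
      fix \<epsilon> assume e: "\<epsilon> \<in> vertices (Suc k)"
      have s: "sum (n(Suc k := m)) A = sum n A" if "Suc k \<notin> A" for A using that by (intro sum.cong) auto
      have "aff 0 (n(Suc k := m)) \<epsilon> = aff 0 n (\<epsilon> - {Suc k}) + m" if "Suc k \<in> \<epsilon>"
        using sum.remove[OF finite_vertex[OF e] that, of "n(Suc k := m)"] by (simp add: aff_def s)
      moreover have "aff 0 (n(Suc k := m)) \<epsilon> = aff 0 n \<epsilon>" if "Suc k \<notin> \<epsilon>"
        using s[OF that] by (simp add: aff_def)
      ultimately show "(if Suc k \<in> \<epsilon> then act X S (aff 0 n (\<epsilon> - {Suc k})) (act X S m u) else act X S (aff 0 n \<epsilon>) u)
         = act X S (aff 0 (n(Suc k := m)) \<epsilon>) u"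
        using fuv(2) by (auto simp: act_add)
    qed
    then have "c (act X S m u) \<in> Q (Suc k)" using Q_gen[OF fuv(2)] by (simp only:)
    with m show "\<exists>y. y \<in> Q (Suc k) \<and> y \<in> W" by (intro exI conjI)
  qed
  then show ?thesis unfolding closure_of_closedin[OF closedin_Q] by (rule exI[of _ a])
qed

text \<open>A generating cube of dimension \<open>k + 1\<close> splits into its two facets in
  direction \<open>Suc k\<close>. Both are translates, under one element of
  \<open>F_group k\<close>, of the diagonals at \<open>act X S j z\<close> and
  \<open>act X S (j + n (Suc k)) z\<close>. Approximation by such cubes shows that the filter is
  proper.\<close>

lemma double_RP:
  assumes "double k x y a \<in> Q (Suc k)"
  shows "(x, y) \<in> RP k X S"
proof -
  let ?P = "prod_topology (cube_space k X) (cube_space k X)"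
  \<comment> \<open>The value of \<open>a\<close> at \<open>{}\<close> does not occur in
    \<open>double\<close> and may lie outside the carrier.\<close>
  define b where "b = restrict a (vertices k - {{}})"
  have V: "\<epsilon> \<in> vertices (Suc k)" "insert (Suc k) \<epsilon> \<in> vertices (Suc k)" "Suc k \<notin> \<epsilon>" if "\<epsilon> \<in> vertices k" for \<epsilon>
    using that by auto
  have e0: "{} \<in> vertices (Suc k)" "{Suc k} \<in> vertices (Suc k)" "{} \<in> vertices k" by auto
  have dbl: "double k x y a {} = x" "double k x y a {Suc k} = y"
    using e0 by (auto simp: double_def)
  have dbla: "double k x y a \<epsilon> = a \<epsilon>" "double k x y a (insert (Suc k) \<epsilon>) = a \<epsilon>" if "\<epsilon> \<in> vertices k" "\<epsilon> \<noteq> {}" for \<epsilon>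
    using V[OF that(1)] that by (auto simp: double_def)
  have xy: "x \<in> T" "y \<in> T" using Q_in[OF assms e0(1)] Q_in[OF assms e0(2)] dbl by simp_all
  have b: "b \<in> (vertices k - {{}}) \<rightarrow>\<^sub>E T"
  proof -
    have "a \<epsilon> \<in> T" if "\<epsilon> \<in> vertices k - {{}}" for \<epsilon>
      using Q_in[OF assms V(1)] dbla(1)[of \<epsilon>] that by (metis DiffE singletonI)
    then show ?thesis unfolding b_def restrict_PiE_iff by (rule ballI)
  qed
  define r where "r p = ((\<lambda>\<epsilon>\<in>vertices k. p \<epsilon>), (\<lambda>\<epsilon>\<in>vertices k. p (insert (Suc k) \<epsilon>)))" for p :: "nat set \<Rightarrow> 'a"
  have cr: "continuous_map (cube_space (Suc k) X) ?P r"
  proof -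
    have 1: "continuous_map (cube_space (Suc k) X) (cube_space k X) (\<lambda>p. \<lambda>\<epsilon>\<in>vertices k. p \<epsilon>)"
      using continuous_map_reindex[of "\<lambda>\<epsilon>. \<epsilon>" "vertices k" "vertices (Suc k)" X] V by blast
    have 2: "continuous_map (cube_space (Suc k) X) (cube_space k X) (\<lambda>p. \<lambda>\<epsilon>\<in>vertices k. p (insert (Suc k) \<epsilon>))"
      using continuous_map_reindex[of "insert (Suc k)" "vertices k" "vertices (Suc k)" X] V by blast
    show ?thesis using 1 2 by (simp add: continuous_map_pairwise r_def o_def)
  qed
  define q where "q = (cube_point k x b, cube_point k y b)"
  have q: "r (double k x y a) = q"
    unfolding r_def q_def cube_point_def
    by (intro conjI arg_cong2[where f = Pair] restrict_ext) (auto simp: dbl dbla b_def simp del: Pow_iff)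
  have qP: "q \<in> topspace ?P"
    using continuous_map_image_subset_topspace[OF cr] subsetD[OF Q_subset assms] q by (metis image_subset_iff)
  let ?H = "\<lambda>(f, u, v). (cube_act k X S f (diag k u), cube_act k X S f (diag k v))"
  define G where "G = {(f, u, v). f \<in> F_group k \<and> u \<in> T \<and> v \<in> T}"
  \<comment> \<open>Generated by the admissible triples whose pair of cubes is close to
    \<open>q\<close>. Convergence is built in, and only properness draws on the given cube.\<close>
  define N where "N = inf (filtercomap ?H (nhdsin ?P q)) (principal G)"
  have lim: "limitin ?P ?H q N"
    unfolding limitin_def
  proof (intro conjI allI impI qP)
    fix U assume "openin ?P U \<and> q \<in> U"
    then have "eventually (\<lambda>z. z \<in> U) (nhdsin ?P q)" by (auto simp: eventually_nhdsin)
    then have "eventually (\<lambda>g. ?H g \<in> U) (filtercomap ?H (nhdsin ?P q))"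
      by (rule eventually_filtercomapI)
    then show "eventually (\<lambda>g. ?H g \<in> U) N"
      unfolding N_def by (rule filter_leD[OF inf_le1])
  qed
  have "N \<noteq> bot"
  proof
    assume "N = bot"
    then have "eventually (\<lambda>_. False) N" by simp
    then have "\<exists>P. eventually P (nhdsin ?P q) \<and> (\<forall>g. P (?H g) \<longrightarrow> g \<in> G \<longrightarrow> False)"
      by (simp only: N_def eventually_inf_principal eventually_filtercomap)
    then obtain P where P: "eventually P (nhdsin ?P q)" "\<forall>g. P (?H g) \<longrightarrow> g \<in> G \<longrightarrow> False"
      by (elim exE conjE)
    then obtain U where U: "openin ?P U" "q \<in> U" "\<And>z. z \<in> U \<Longrightarrow> P z"
      using qP by (auto simp: eventually_nhdsin)
    have "openin (cube_space (Suc k) X) {p \<in> topspace (cube_space (Suc k) X). r p \<in> U}"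
      using cr U(1) openin_continuous_map_preimage by blast
    moreover have "double k x y a \<in> {p \<in> topspace (cube_space (Suc k) X). r p \<in> U}"
      using Q_subset assms q U(2) by auto
    ultimately obtain p where p: "p \<in> {(\<lambda>\<epsilon>\<in>vertices (Suc k). act X S (aff j n \<epsilon>) x) | j n x. x \<in> T}"
        "p \<in> {p \<in> topspace (cube_space (Suc k) X). r p \<in> U}"
      by (rule closure_meets[OF assms[unfolded Q_eq]])
    from p(2) have "r p \<in> U" by (elim CollectE conjE)
    with p(1)
    obtain j n z where z: "z \<in> T" "r (\<lambda>\<epsilon>\<in>vertices (Suc k). act X S (aff j n \<epsilon>) z) \<in> U"
      by (elim CollectE exE conjE) (simp only:)
    define f where "f = (\<lambda>\<epsilon>\<in>vertices k. aff 0 n \<epsilon>)"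
    have fe: "aff j n \<epsilon> = aff 0 n \<epsilon> + j" "aff j n (insert (Suc k) \<epsilon>) = aff 0 n \<epsilon> + (j + n (Suc k))" if "\<epsilon> \<in> vertices k" for \<epsilon>
      using V(3)[OF that] finite_vertex[OF that] by (auto simp: aff_def)
    have "r (\<lambda>\<epsilon>\<in>vertices (Suc k). act X S (aff j n \<epsilon>) z) = ?H (f, act X S j z, act X S (j + n (Suc k)) z)"
      unfolding r_def cube_act_def diag_def case_prod_conv f_def
      using z(1) by (intro arg_cong2[where f = Pair] restrict_ext) (simp_all only: V fe act_add restrict_apply' act_in)
    moreover have "(f, act X S j z, act X S (j + n (Suc k)) z) \<in> G"
      using z(1) by (auto simp: G_def F_group_eq f_def)
    ultimately show False using spec[OF P(2), of "(f, act X S j z, act X S (j + n (Suc k)) z)"] U(3)[OF z(2)]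
      by (simp only: not_True_eq_False simp_thms)
  qed
  moreover have "\<forall>\<^sub>F (f, u, v) in N. f \<in> F_group k \<and> u \<in> T \<and> v \<in> T"
    unfolding N_def eventually_inf_principal G_def by (intro always_eventually) auto
  moreover have "limitin (cube_space k X) (\<lambda>(f, u, v). cube_act k X S f (diag k u)) (cube_point k x b) N"
    "limitin (cube_space k X) (\<lambda>(f, u, v). cube_act k X S f (diag k v)) (cube_point k y b) N"
    using lim unfolding limitin_pairwise q_def by (simp_all add: o_def case_prod_unfold)
  ultimately show ?thesis
    unfolding RP_def mem_Collect_eq case_prod_conv
    using xy b by (intro conjI bexI[of _ b] exI[of _ N])
qed

end

section \<open>Compact right topological semigroups\<close>

lemma finite_chain_Inter:
  assumes "finite F" "F \<noteq> {}" "\<And>A B. A \<in> F \<Longrightarrow> B \<in> F \<Longrightarrow> A \<subseteq> B \<or> B \<subseteq> A"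
  shows "\<Inter>F \<in> F"
  using assms
proof (induction F rule: finite_ne_induct)
  case (singleton x)
  then show ?case by simp
next
  case (insert x F)
  then have "\<Inter>F \<in> F" by simp
  then have "x \<subseteq> \<Inter>F \<or> \<Inter>F \<subseteq> x" using insert.prems by (metis insertCI)
  then have "\<Inter>(insert x F) = x \<or> \<Inter>(insert x F) = \<Inter>F" by auto
  then show ?case using \<open>\<Inter>F \<in> F\<close> by (metis insertCI)
qed

text \<open>The property \<open>P\<close> only has to survive intersections of closed sets, which
  covers closed subsemigroups as well as closed left ideals. Compactness keeps the intersection of a
  chain nonempty for the use of Zorn.\<close>

lemma minimal_closed_exists:
  assumes "compact_space E" "closedin E A" "A \<noteq> {}" "P A"
    and inter: "\<And>\<C>. \<C> \<noteq> {} \<Longrightarrow> (\<And>C. C \<in> \<C> \<Longrightarrow> closedin E C \<and> P C) \<Longrightarrow> P (\<Inter>\<C>)"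
  obtains M where "closedin E M" "M \<noteq> {}" "P M" "M \<subseteq> A"
    "\<And>C. closedin E C \<Longrightarrow> C \<noteq> {} \<Longrightarrow> P C \<Longrightarrow> C \<subseteq> M \<Longrightarrow> C = M"
proof -
  define \<A> where "\<A> = {C. closedin E C \<and> C \<noteq> {} \<and> P C \<and> C \<subseteq> A}"
  have "\<exists>m\<in>\<A>. \<forall>a\<in>\<A>. a \<subseteq> m \<longrightarrow> a = m"
  proof (rule predicate_Zorn)
    show "partial_order_on \<A> (relation_of (\<lambda>a b. b \<subseteq> a) \<A>)"
      by (rule partial_order_on_relation_ofI) auto
    fix C assume C: "C \<in> Chains (relation_of (\<lambda>a b. b \<subseteq> a) \<A>)"
    then have sub: "C \<subseteq> \<A>" by (rule Chains_relation_of)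
    have chain: "X \<subseteq> Y \<or> Y \<subseteq> X" if "X \<in> C" "Y \<in> C" for X Y
      using C that unfolding Chains_def relation_of_def by blast
    show "\<exists>u\<in>\<A>. \<forall>a\<in>C. u \<subseteq> a"
    proof (cases "C = {}")
      case True
      then show ?thesis using assms by (auto simp: \<A>_def)
    next
      case False
      have "\<Inter>C \<noteq> {}"
      proof (rule assms(1)[unfolded compact_space_fip, rule_format], intro conjI ballI allI impI)
        fix K assume "K \<in> C" then show "closedin E K" using sub by (auto simp: \<A>_def)
      next
        fix F assume F: "finite F \<and> F \<subseteq> C"
        show "\<Inter>F \<noteq> {}"
        proof (cases "F = {}")
          case False
          then have "\<Inter>F \<in> F" using F chain by (intro finite_chain_Inter) blast+
          then have "\<Inter>F \<in> \<A>" using F sub by blast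
          then show ?thesis by (simp add: \<A>_def)
        qed simp
      qed
      moreover have "closedin E (\<Inter>C)" "P (\<Inter>C)" "\<Inter>C \<subseteq> A"
        using False sub by (auto simp: \<A>_def intro!: closedin_Inter inter)
      ultimately have "\<Inter>C \<in> \<A>" by (simp add: \<A>_def)
      then show ?thesis by (intro bexI[of _ "\<Inter>C"]) auto
    qed
  qed
  then obtain m where "m \<in> \<A>" "\<And>a. a \<in> \<A> \<Longrightarrow> a \<subseteq> m \<Longrightarrow> a = m" by blast
  then show ?thesis using that[of m] unfolding \<A>_def by (auto simp: subset_trans)
qed

locale right_top_semigroup =
  fixes E :: "'s topology" and mul :: "'s \<Rightarrow> 's \<Rightarrow> 's" (infixl "\<cdot>" 70)
  assumes compact_E: "compact_space E" and Hausdorff_E: "Hausdorff_space E" and nonempty_E: "topspace E \<noteq> {}"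
    and mul_in: "a \<in> topspace E \<Longrightarrow> b \<in> topspace E \<Longrightarrow> a \<cdot> b \<in> topspace E"
    and mul_assoc: "a \<in> topspace E \<Longrightarrow> b \<in> topspace E \<Longrightarrow> c \<in> topspace E \<Longrightarrow> a \<cdot> b \<cdot> c = a \<cdot> (b \<cdot> c)"
    and mul_cont: "b \<in> topspace E \<Longrightarrow> continuous_map E E (\<lambda>a. a \<cdot> b)"
begin

lemma closedin_right_image: "closedin E K \<Longrightarrow> b \<in> topspace E \<Longrightarrow> closedin E ((\<lambda>a. a \<cdot> b) ` K)"
  using continuous_imp_closed_map[OF mul_cont compact_E Hausdorff_E] unfolding closed_map_def by simp

lemma closedin_right_fiber:
  assumes "closedin E K" "b \<in> topspace E" "c \<in> topspace E"
  shows "closedin E {a \<in> K. a \<cdot> b = c}"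
proof -
  have "closedin E {c}" using Hausdorff_E assms(3) by (simp add: closedin_Hausdorff_singleton)
  then have "closedin E {a \<in> topspace E. a \<cdot> b \<in> {c}}"
    by (rule closedin_continuous_map_preimage[OF mul_cont[OF assms(2)]])
  with assms(1) have "closedin E (K \<inter> {a \<in> topspace E. a \<cdot> b \<in> {c}})"
    by (rule closedin_Int)
  moreover have "K \<inter> {a \<in> topspace E. a \<cdot> b \<in> {c}} = {a \<in> K. a \<cdot> b = c}"
    using closedin_subset[OF assms(1)] by auto
  ultimately show ?thesis by simp
qed

text \<open>For \<open>e\<close> in a minimal closed subsemigroup \<open>M\<close>, the closed
  subsemigroup of all \<open>a \<cdot> e\<close> is \<open>M\<close> itself, so
  \<open>{a \<in> M. a \<cdot> e = e}\<close> is nonempty. It is a closed subsemigroup as well,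
  hence equals \<open>M\<close> and contains \<open>e\<close>.\<close>

lemma ellis_numakura:
  assumes "closedin E K" "K \<noteq> {}" "\<And>a b. a \<in> K \<Longrightarrow> b \<in> K \<Longrightarrow> a \<cdot> b \<in> K"
  shows "\<exists>e\<in>K. e \<cdot> e = e"
proof -
  obtain M where M: "closedin E M" "M \<noteq> {}" "\<And>a b. a \<in> M \<Longrightarrow> b \<in> M \<Longrightarrow> a \<cdot> b \<in> M" "M \<subseteq> K"
    and min: "\<And>C. closedin E C \<Longrightarrow> C \<noteq> {} \<Longrightarrow> (\<forall>a\<in>C. \<forall>b\<in>C. a \<cdot> b \<in> C) \<Longrightarrow> C \<subseteq> M \<Longrightarrow> C = M"
    by (rule minimal_closed_exists[OF compact_E assms(1,2), of "\<lambda>M. \<forall>a\<in>M. \<forall>b\<in>M. a \<cdot> b \<in> M"])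
      (use assms(3) in auto)
  obtain e where e: "e \<in> M" using M(2) by blast
  have ME: "M \<subseteq> topspace E" using M(1) closedin_subset by blast
  have "(\<lambda>a. a \<cdot> e) ` M = M"
  proof (rule min)
    show "closedin E ((\<lambda>a. a \<cdot> e) ` M)" using M(1) e ME by (intro closedin_right_image) auto
    show "\<forall>a\<in>(\<lambda>a. a \<cdot> e) ` M. \<forall>b\<in>(\<lambda>a. a \<cdot> e) ` M. a \<cdot> b \<in> (\<lambda>a. a \<cdot> e) ` M"
    proof clarify
      fix a b assume ab: "a \<in> M" "b \<in> M"
      have "a \<cdot> e \<cdot> (b \<cdot> e) = a \<cdot> e \<cdot> b \<cdot> e"
        using ab e ME M(3) by (simp add: mul_assoc subset_iff)
      then show "a \<cdot> e \<cdot> (b \<cdot> e) \<in> (\<lambda>a. a \<cdot> e) ` M"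
        using ab e M(3) by (metis imageI)
    qed
    show "(\<lambda>a. a \<cdot> e) ` M \<subseteq> M" using e M(3) by blast
  qed (use M in blast)
  then obtain a where a: "a \<in> M" "a \<cdot> e = e" using e by (metis imageE)
  have "{a \<in> M. a \<cdot> e = e} = M"
  proof (rule min)
    show "closedin E {a \<in> M. a \<cdot> e = e}" using M(1) e ME by (intro closedin_right_fiber) auto
    show "\<forall>a\<in>{a \<in> M. a \<cdot> e = e}. \<forall>b\<in>{a \<in> M. a \<cdot> e = e}. a \<cdot> b \<in> {a \<in> M. a \<cdot> e = e}"
      using M(3) e ME by (auto simp: mul_assoc subset_iff)
  qed (use a in auto)
  then have "e \<cdot> e = e" using e by blast
  with e M(4) show ?thesis by blast
qed

text \<open>Minimality in its usable form: each member generates the whole ideal, so any two members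
  are left multiples of one another.\<close>

definition minimal_left_ideal :: "'s set \<Rightarrow> bool" where
  "minimal_left_ideal L \<longleftrightarrow> closedin E L \<and> L \<noteq> {} \<and> (\<forall>b\<in>L. (\<lambda>a. a \<cdot> b) ` topspace E = L)"

lemma minimal_left_ideal_exists: "\<exists>L. minimal_left_ideal L"
proof -
  obtain M where M: "closedin E M" "M \<noteq> {}" "\<forall>a\<in>topspace E. \<forall>b\<in>M. a \<cdot> b \<in> M"
    and min: "\<And>C. closedin E C \<Longrightarrow> C \<noteq> {} \<Longrightarrow> (\<forall>a\<in>topspace E. \<forall>b\<in>C. a \<cdot> b \<in> C) \<Longrightarrow> C \<subseteq> M \<Longrightarrow> C = M"
    by (rule minimal_closed_exists[OF compact_E closedin_topspace nonempty_E, of "\<lambda>M. \<forall>a\<in>topspace E. \<forall>b\<in>M. a \<cdot> b \<in> M"])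
      (use mul_in in auto)
  have ME: "M \<subseteq> topspace E" using M(1) closedin_subset by blast
  have "(\<lambda>a. a \<cdot> b) ` topspace E = M" if b: "b \<in> M" for b
  proof (rule min)
    show "closedin E ((\<lambda>a. a \<cdot> b) ` topspace E)" using b ME by (intro closedin_right_image) auto
    show "\<forall>a\<in>topspace E. \<forall>c\<in>(\<lambda>a. a \<cdot> b) ` topspace E. a \<cdot> c \<in> (\<lambda>a. a \<cdot> b) ` topspace E"
    proof clarify
      fix a c assume "a \<in> topspace E" "c \<in> topspace E"
      then show "a \<cdot> (c \<cdot> b) \<in> (\<lambda>a. a \<cdot> b) ` topspace E"
        using b ME mul_in by (intro image_eqI[of _ _ "a \<cdot> c"]) (auto simp: mul_assoc)
    qed
    show "(\<lambda>a. a \<cdot> b) ` topspace E \<subseteq> M" using M(3) b by blast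
  qed (use nonempty_E in blast)
  then show ?thesis unfolding minimal_left_ideal_def using M by blast
qed

context
  fixes L u
  assumes L: "minimal_left_ideal L" and u: "u \<in> L" "u \<cdot> u = u"
begin

lemma L_in: "p \<in> L \<Longrightarrow> p \<in> topspace E"
  using L closedin_subset unfolding minimal_left_ideal_def by blast

lemma L_left: "a \<in> topspace E \<Longrightarrow> b \<in> L \<Longrightarrow> a \<cdot> b \<in> L"
  using L unfolding minimal_left_ideal_def by blast

text \<open>\<open>p\<close> is a left multiple of the idempotent \<open>v\<close>, because
  \<open>v\<close> generates the ideal.\<close>

lemma L_right_unit: assumes "p \<in> L" "v \<in> L" "v \<cdot> v = v" shows "p \<cdot> v = p"
proof -
  obtain q where q: "q \<in> topspace E" "p = q \<cdot> v"
    using L assms unfolding minimal_left_ideal_def by (metis imageE)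
  then show ?thesis using assms L_in by (simp add: mul_assoc)
qed

definition ellis_group where "ellis_group = {p \<in> L. u \<cdot> p = p}"

lemma group_in: "p \<in> ellis_group \<Longrightarrow> p \<in> topspace E"
  and group_L: "p \<in> ellis_group \<Longrightarrow> p \<in> L"
  and group_left: "p \<in> ellis_group \<Longrightarrow> u \<cdot> p = p"
  and group_right: "p \<in> ellis_group \<Longrightarrow> p \<cdot> u = p"
  and group_unit: "u \<in> ellis_group"
  using L_in L_right_unit u by (auto simp: ellis_group_def)

lemma group_mul: "p \<in> ellis_group \<Longrightarrow> q \<in> ellis_group \<Longrightarrow> p \<cdot> q \<in> ellis_group"
  using L_in L_left u by (auto simp: ellis_group_def mul_assoc[symmetric])

lemma group_sandwich: assumes "q \<in> topspace E" shows "u \<cdot> q \<cdot> u \<in> ellis_group"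
proof -
  have uE: "u \<in> topspace E" using u L_in by blast
  have "u \<cdot> (u \<cdot> q \<cdot> u) = u \<cdot> q \<cdot> u"
    using assms uE u(2) by (metis mul_assoc mul_in)
  then show ?thesis
    using L_left[of "u \<cdot> q" u] assms uE u mul_in by (simp add: ellis_group_def)
qed

lemma group_left_inverse: assumes "p \<in> ellis_group" shows "\<exists>q\<in>ellis_group. q \<cdot> p = u"
proof -
  obtain q where q: "q \<in> topspace E" "u = q \<cdot> p"
    using L u group_L[OF assms] unfolding minimal_left_ideal_def by (metis imageE)
  have uE: "u \<in> topspace E" and pE: "p \<in> topspace E" using u L_in group_in[OF assms] by blast+
  have "u \<cdot> q \<cdot> u \<cdot> p = u \<cdot> (q \<cdot> (u \<cdot> p))"
    using uE q(1) pE mul_in by (simp add: mul_assoc)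
  also have "\<dots> = u" using group_left[OF assms] q(2) u(2) by simp
  finally show ?thesis using group_sandwich[OF q(1)] by blast
qed

text \<open>In a monoid where every element has a left inverse, left inverses are two-sided: insert
  \<open>u = r \<cdot> q\<close> in front of \<open>p \<cdot> q\<close>.\<close>

lemma group_inverse_swap:
  assumes "p \<in> ellis_group" "q \<in> ellis_group" "q \<cdot> p = u" shows "p \<cdot> q = u"
proof -
  obtain r where r: "r \<in> ellis_group" "r \<cdot> q = u" using group_left_inverse[OF assms(2)] by blast
  have "p \<cdot> q = u \<cdot> (p \<cdot> q)" using group_left[OF group_mul[OF assms(1,2)]] by simp
  also have "\<dots> = r \<cdot> q \<cdot> (p \<cdot> q)" by (simp only: r(2))
  also have "\<dots> = r \<cdot> (q \<cdot> p) \<cdot> q"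
    using group_in[OF assms(1)] group_in[OF assms(2)] group_in[OF r(1)] mul_in by (simp add: mul_assoc)
  also have "\<dots> = u" using assms(3) r group_right by simp
  finally show ?thesis .
qed

end

end

text \<open>Two rounds of closure: left multiplication by a member of \<open>D\<close> is
  continuous, so \<open>D\<close> maps the closure into itself; right multiplication by any element
  is continuous, so the closure then maps itself into itself.\<close>

lemma closure_semigroup:
  assumes "compact_space Z" "Hausdorff_space Z" "D \<noteq> {}" "D \<subseteq> topspace Z"
    and mul_in: "\<And>a b. a \<in> topspace Z \<Longrightarrow> b \<in> topspace Z \<Longrightarrow> m a b \<in> topspace Z"
    and assoc: "\<And>a b c. a \<in> topspace Z \<Longrightarrow> b \<in> topspace Z \<Longrightarrow> c \<in> topspace Z \<Longrightarrow> m (m a b) c = m a (m b c)"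
    and right: "\<And>b. b \<in> topspace Z \<Longrightarrow> continuous_map Z Z (\<lambda>a. m a b)"
    and left: "\<And>d. d \<in> D \<Longrightarrow> continuous_map Z Z (m d)"
    and D: "\<And>a b. a \<in> D \<Longrightarrow> b \<in> D \<Longrightarrow> m a b \<in> D"
  shows "right_top_semigroup (subtopology Z (Z closure_of D)) m"
proof -
  let ?C = "Z closure_of D"
  have sub: "?C \<subseteq> topspace Z" by (rule closure_of_subset_topspace)
  have top: "topspace (subtopology Z ?C) = ?C" using sub by auto
  have 1: "m d b \<in> ?C" if "d \<in> D" "b \<in> ?C" for d b
    using continuous_map_closure_mem[OF left[OF that(1)] that(2) _ closedin_closure_of, of D]
      D[OF that(1)] closure_of_subset[OF assms(4)] by blast
  have 2: "m a b \<in> ?C" if "a \<in> ?C" "b \<in> ?C" for a b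
    using continuous_map_closure_mem[OF right that(1) _ closedin_closure_of, of b D] 1[OF _ that(2)] sub that by blast
  show ?thesis
  proof
    show "compact_space (subtopology Z ?C)"
      using assms(1) by (simp add: closedin_compact_space compact_space_subtopology)
    show "Hausdorff_space (subtopology Z ?C)" using assms(2) by (rule Hausdorff_space_subtopology)
    show "topspace (subtopology Z ?C) \<noteq> {}"
      unfolding top using assms(3) closure_of_subset[OF assms(4)] by blast
    fix a b c
    show "a \<in> topspace (subtopology Z ?C) \<Longrightarrow> b \<in> topspace (subtopology Z ?C) \<Longrightarrow> m a b \<in> topspace (subtopology Z ?C)"
      unfolding top by (rule 2)
    show "a \<in> topspace (subtopology Z ?C) \<Longrightarrow> b \<in> topspace (subtopology Z ?C) \<Longrightarrow> c \<in> topspace (subtopology Z ?C)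
        \<Longrightarrow> m (m a b) c = m a (m b c)"
      unfolding top using sub by (intro assoc) blast+
    show "b \<in> topspace (subtopology Z ?C) \<Longrightarrow> continuous_map (subtopology Z ?C) (subtopology Z ?C) (\<lambda>a. m a b)"
      unfolding top using sub 2 right
      by (intro continuous_map_into_subtopology continuous_map_from_subtopology) auto
  qed
qed

section \<open>The enveloping semigroup of a system and of its cubes\<close>

context dyn
begin

abbreviation cmp (infixl "\<star>" 70) where "p \<star> q \<equiv> compose T p q"

abbreviation maps :: "('a \<Rightarrow> 'a) topology" where
  "maps \<equiv> product_topology (\<lambda>_. X) T"

abbreviation map_families :: "'i set \<Rightarrow> ('i \<Rightarrow> 'a \<Rightarrow> 'a) topology" where
  "map_families I \<equiv> product_topology (\<lambda>_. maps) I"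

definition iterate :: "int \<Rightarrow> 'a \<Rightarrow> 'a" where
  "iterate n = (\<lambda>x\<in>T. act X S n x)"

definition iterates :: "'i set \<Rightarrow> ('i \<Rightarrow> int) \<Rightarrow> 'i \<Rightarrow> 'a \<Rightarrow> 'a" where
  "iterates I f = (\<lambda>i\<in>I. iterate (f i))"

definition family_cmp :: "'i set \<Rightarrow> ('i \<Rightarrow> 'a \<Rightarrow> 'a) \<Rightarrow> ('i \<Rightarrow> 'a \<Rightarrow> 'a) \<Rightarrow> 'i \<Rightarrow> 'a \<Rightarrow> 'a" where
  "family_cmp I p q = (\<lambda>i\<in>I. p i \<star> q i)"

definition ellis :: "('a \<Rightarrow> 'a) set" where
  "ellis = maps closure_of range iterate"

text \<open>The enveloping semigroup of the product action on \<open>I\<close>-tuples with exponents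
  in \<open>A\<close>. It is kept as families of self-maps of \<open>X\<close> because its elements
  act coordinatewise.\<close>

definition ellis_family :: "'i set \<Rightarrow> ('i \<Rightarrow> int) set \<Rightarrow> ('i \<Rightarrow> 'a \<Rightarrow> 'a) set" where
  "ellis_family I A = map_families I closure_of (iterates I ` A)"

lemma compact_maps: "compact_space maps" and Hausdorff_maps: "Hausdorff_space maps"
  by (simp_all add: compact_space_product_topology Hausdorff_space_product_topology compact Hausdorff)

lemma compact_map_families: "compact_space (map_families I)" and Hausdorff_map_families: "Hausdorff_space (map_families I)"
  by (simp_all add: compact_space_product_topology Hausdorff_space_product_topology compact Hausdorff)

lemma mapsD: "p \<in> topspace maps \<Longrightarrow> x \<in> T \<Longrightarrow> p x \<in> T"
  by (auto dest: PiE_mem)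

lemma maps_eqI:
  assumes "p \<in> topspace maps" "q \<in> topspace maps" "\<And>x. x \<in> T \<Longrightarrow> p x = q x"
  shows "p = q"
  using assms by (auto intro: PiE_ext)

lemma cmp_in: "p \<in> topspace maps \<Longrightarrow> q \<in> topspace maps \<Longrightarrow> p \<star> q \<in> topspace maps"
  by (auto simp: compose_def PiE_iff)

lemma cmp_assoc: "q \<in> topspace maps \<Longrightarrow> r \<in> topspace maps \<Longrightarrow> p \<star> q \<star> r = p \<star> (q \<star> r)"
  by (intro compose_assoc[symmetric]) (auto simp: PiE_iff)

lemma cmp_apply: "x \<in> T \<Longrightarrow> (p \<star> q) x = p (q x)"
  by (simp add: compose_def)

lemma iterate_in: "iterate n \<in> topspace maps"
  by (auto simp: iterate_def)

lemma iterate_apply: "x \<in> T \<Longrightarrow> iterate n x = act X S n x"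
  by (simp add: iterate_def)

lemma iterate_cmp: "iterate m \<star> iterate n = iterate (m + n)"
  by (auto simp: iterate_def compose_def act_add)

lemma iterate_0_left: "p \<in> topspace maps \<Longrightarrow> iterate 0 \<star> p = p"
  by (rule maps_eqI) (simp_all only: cmp_in iterate_in cmp_apply, simp only: iterate_apply mapsD act_0)

lemma iterate_0_right: "p \<in> topspace maps \<Longrightarrow> p \<star> iterate 0 = p"
  by (rule maps_eqI) (simp_all only: cmp_in iterate_in cmp_apply, simp only: iterate_apply act_0)

lemma cmp_right: assumes "q \<in> topspace maps" shows "continuous_map maps maps (\<lambda>p. p \<star> q)"
  unfolding compose_def by (intro continuous_map_reindex) (use assms mapsD in blast)

text \<open>Left composition is continuous for the homeomorphisms \<open>iterate n\<close>, in
  general not for their limits; this is the asymmetry behind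
  \<open>closure_semigroup\<close>.\<close>

lemma cmp_left: "continuous_map maps maps ((\<star>) (iterate n))"
proof -
  have "continuous_map maps maps (\<lambda>q. \<lambda>x\<in>T. iterate n (q x))"
    using continuous_map_eq[OF continuous_act[of n], of "iterate n"] iterate_apply[of _ n]
    by (intro continuous_map_coordinatewise) simp
  then show ?thesis by (simp add: compose_def)
qed

lemma ellis_semigroup: assumes "T \<noteq> {}" shows "right_top_semigroup (subtopology maps ellis) (\<star>)"
  unfolding ellis_def
proof (rule closure_semigroup[OF compact_maps Hausdorff_maps])
  show "a \<star> b \<in> range iterate" if "a \<in> range iterate" "b \<in> range iterate" for a b
    using that by (auto simp: iterate_cmp)
qed (use cmp_assoc cmp_right cmp_left iterate_in cmp_in in blast)+

lemma ellis_maps: "p \<in> ellis \<Longrightarrow> p \<in> topspace maps"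
  unfolding ellis_def using closure_of_subset_topspace by (rule subsetD)

lemma iterate_ellis: "iterate n \<in> ellis"
  unfolding ellis_def by (rule subsetD[OF closure_of_subset]) (use iterate_in in blast)+

lemma family_in: "p \<in> topspace (map_families I) \<Longrightarrow> i \<in> I \<Longrightarrow> p i \<in> topspace maps"
  by (simp only: topspace_product_topology[of "\<lambda>_. maps"]) (rule PiE_mem)

lemma family_topI: "(\<And>i. i \<in> I \<Longrightarrow> p i \<in> topspace maps) \<Longrightarrow> (\<lambda>i\<in>I. p i) \<in> topspace (map_families I)"
  unfolding topspace_product_topology[of "\<lambda>_. maps"] restrict_PiE_iff by (rule ballI)

lemma iterates_in: "iterates I f \<in> topspace (map_families I)"
  unfolding iterates_def by (intro family_topI iterate_in)

lemma family_eqI: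
  assumes "p \<in> topspace (map_families I)" "q \<in> topspace (map_families I)" "\<And>i. i \<in> I \<Longrightarrow> p i = q i"
  shows "p = q"
  using assms unfolding topspace_product_topology[of "\<lambda>_. maps"] by (rule PiE_ext)

lemma family_cmp_right:
  assumes "q \<in> topspace (map_families I)"
  shows "continuous_map (map_families I) (map_families I) (\<lambda>p. family_cmp I p q)"
  unfolding family_cmp_def
  by (intro continuous_map_coordinatewise cmp_right family_in[OF assms])

lemma family_cmp_left: "continuous_map (map_families I) (map_families I) (family_cmp I (iterates I f))"
proof -
  have "continuous_map (map_families I) (map_families I) (\<lambda>q. \<lambda>i\<in>I. iterate (f i) \<star> q i)"
    by (intro continuous_map_coordinatewise cmp_left)
  moreover have "family_cmp I (iterates I f) = (\<lambda>q. \<lambda>i\<in>I. iterate (f i) \<star> q i)"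
    by (intro ext) (simp add: family_cmp_def iterates_def restrict_def)
  ultimately show ?thesis by simp
qed

lemma family_semigroup:
  assumes "A \<noteq> {}" "\<And>f g. f \<in> A \<Longrightarrow> g \<in> A \<Longrightarrow> (\<lambda>i. f i + g i) \<in> A"
  shows "right_top_semigroup (subtopology (map_families I) (ellis_family I A)) (family_cmp I)"
  unfolding ellis_family_def
proof (rule closure_semigroup[OF compact_map_families Hausdorff_map_families])
  show "iterates I ` A \<noteq> {}" using assms(1) by simp
  show "iterates I ` A \<subseteq> topspace (map_families I)" using iterates_in by blast
  fix a b c assume a: "a \<in> topspace (map_families I)" and b: "b \<in> topspace (map_families I)"
  show "family_cmp I a b \<in> topspace (map_families I)"
    unfolding family_cmp_def using a b by (intro family_topI cmp_in family_in)
  assume c: "c \<in> topspace (map_families I)"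
  show "family_cmp I (family_cmp I a b) c = family_cmp I a (family_cmp I b c)"
    unfolding family_cmp_def
  proof (rule restrict_ext)
    fix i assume "i \<in> I"
    then show "(\<lambda>i\<in>I. a i \<star> b i) i \<star> c i = a i \<star> (\<lambda>i\<in>I. b i \<star> c i) i"
      using cmp_assoc[OF family_in[OF b] family_in[OF c]] by (simp only: restrict_apply')
  qed
next
  fix a b assume "a \<in> iterates I ` A" "b \<in> iterates I ` A"
  then obtain f g where fg: "f \<in> A" "g \<in> A" "a = iterates I f" "b = iterates I g" by blast
  have "family_cmp I a b = iterates I (\<lambda>i. f i + g i)"
    unfolding fg family_cmp_def iterates_def by (intro restrict_ext) (simp add: iterate_cmp)
  then show "family_cmp I a b \<in> iterates I ` A" using assms(2)[OF fg(1,2)] by (simp only: imageI)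
qed (use family_cmp_right family_cmp_left in blast)+

lemma ellis_family_top: "p \<in> ellis_family I A \<Longrightarrow> p \<in> topspace (map_families I)"
  unfolding ellis_family_def using closure_of_subset_topspace by (rule subsetD)

lemma iterates_family: "f \<in> A \<Longrightarrow> iterates I f \<in> ellis_family I A"
  unfolding ellis_family_def by (rule subsetD[OF closure_of_subset]) (use iterates_in in blast)+

lemma closedin_ellis_family: "closedin (map_families I) (ellis_family I A)"
  by (simp add: ellis_family_def)

lemma closedin_ellis: "closedin maps ellis"
  by (simp add: ellis_def)

lemma family_ellis: assumes "p \<in> ellis_family I A" "i \<in> I" shows "p i \<in> ellis"
proof (rule continuous_map_closure_mem[OF _ assms(1)[unfolded ellis_family_def] _ closedin_ellis])
  show "continuous_map (map_families I) maps (\<lambda>p. p i)"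
    by (rule continuous_map_product_projection[OF assms(2)])
  fix a assume "a \<in> iterates I ` A"
  then show "a i \<in> ellis" using assms(2) iterate_ellis by (auto simp: iterates_def)
qed

lemma family_image:
  assumes p: "p \<in> ellis_family I A" and c: "continuous_map (map_families I) (map_families J) F"
    and F: "\<And>f. f \<in> A \<Longrightarrow> \<exists>g\<in>B. F (iterates I f) = iterates J g"
  shows "F p \<in> ellis_family J B"
proof (rule continuous_map_closure_mem[OF c p[unfolded ellis_family_def] _ closedin_ellis_family])
  fix a assume "a \<in> iterates I ` A"
  then obtain f where "f \<in> A" "a = iterates I f" by blast
  with F obtain g where "g \<in> B" "F a = iterates J g" by blast
  then show "F a \<in> ellis_family J B" using iterates_family by simp
qed

lemma ellis_to_family:
  assumes p: "p \<in> ellis" and c: "continuous_map maps (map_families J) F"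
    and F: "\<And>n. \<exists>g\<in>B. F (iterate n) = iterates J g"
  shows "F p \<in> ellis_family J B"
proof (rule continuous_map_closure_mem[OF c p[unfolded ellis_def] _ closedin_ellis_family])
  fix a assume "a \<in> range iterate"
  then obtain n where "a = iterate n" by blast
  with F obtain g where "g \<in> B" "F a = iterates J g" by blast
  then show "F a \<in> ellis_family J B" using iterates_family by simp
qed

abbreviation act_family :: "'i set \<Rightarrow> ('i \<Rightarrow> 'a \<Rightarrow> 'a) \<Rightarrow> ('i \<Rightarrow> 'a) \<Rightarrow> 'i \<Rightarrow> 'a" where
  "act_family I p z \<equiv> (\<lambda>i\<in>I. p i (z i))"

lemma continuous_act_family:
  assumes "\<And>i. i \<in> I \<Longrightarrow> z i \<in> T"
  shows "continuous_map (map_families I) (product_topology (\<lambda>_. X) I) (\<lambda>p. act_family I p z)"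
proof (intro continuous_map_family)
  fix i assume i: "i \<in> I"
  show "continuous_map (map_families I) X (\<lambda>p. p i (z i))"
    using continuous_map_compose[OF continuous_map_product_projection[OF i, of "\<lambda>_. maps"]
        continuous_map_product_projection[OF assms[OF i], of "\<lambda>_. X"]] by (simp only: o_def)
qed

lemma act_family_powers:
  assumes "\<And>i. i \<in> I \<Longrightarrow> z i \<in> T"
  shows "act_family I (iterates I f) z = (\<lambda>i\<in>I. act X S (f i) (z i))"
  using assms by (intro restrict_ext) (simp add: iterates_def iterate_apply)

text \<open>Compactness turns orbit closures into orbits: each limit of translates of
  \<open>z\<close> is the image of \<open>z\<close> under an actual element of the enveloping
  semigroup.\<close>

lemma act_family_image:
  assumes "\<And>i. i \<in> I \<Longrightarrow> z i \<in> T"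
  shows "(\<lambda>p. act_family I p z) ` ellis_family I A =
    product_topology (\<lambda>_. X) I closure_of ((\<lambda>f. \<lambda>i\<in>I. act X S (f i) (z i)) ` A)"
proof -
  have "(\<lambda>p. act_family I p z) ` ellis_family I A =
    product_topology (\<lambda>_. X) I closure_of ((\<lambda>p. act_family I p z) ` iterates I ` A)"
    unfolding ellis_family_def
  proof (rule compact_image_closure[OF continuous_act_family compact_map_families])
    show "Hausdorff_space (product_topology (\<lambda>_. X) I)"
      by (simp add: Hausdorff_space_product_topology Hausdorff)
    show "iterates I ` A \<subseteq> topspace (map_families I)" using iterates_in by blast
  qed (rule assms)
  also have "(\<lambda>p. act_family I p z) ` iterates I ` A = (\<lambda>f. \<lambda>i\<in>I. act X S (f i) (z i)) ` A"
    unfolding image_image using act_family_powers[of I z, OF assms] by (intro image_cong refl)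
  finally show ?thesis .
qed

end

section \<open>The points of \<open>Q\<^sup>[\<^sup>k\<^sup>]\<close> over a fixed point\<close>

context dyn
begin

text \<open>Limits of linear exponent families, the enveloping semigroup of
  \<open>F_group k\<close>. Its companion \<open>H k\<close> uses affine families and belongs to
  \<open>HK_group k\<close> when \<open>k\<close> is positive.\<close>

abbreviation "P k \<equiv> ellis_family (vertices k) (range (aff 0))"
abbreviation "H k \<equiv> ellis_family (vertices k) (range (\<lambda>(j, n). aff j n))"

lemma P_semigroup: "right_top_semigroup (subtopology (map_families (vertices k)) (P k)) (family_cmp (vertices k))"
proof (rule family_semigroup)
  show "(\<lambda>i. f i + g i) \<in> range (aff 0)" if "f \<in> range (aff 0)" "g \<in> range (aff 0)" for f g
  proof -
    obtain m n where "f = aff 0 m" "g = aff 0 n" using \<open>f \<in> _\<close> \<open>g \<in> _\<close> by (elim rangeE)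
    then have "(\<lambda>i. f i + g i) = aff 0 (\<lambda>i. m i + n i)"
      by (simp add: aff_add fun_eq_iff)
    then show ?thesis by (simp only: rangeI)
  qed
qed simp

lemma H_semigroup: "right_top_semigroup (subtopology (map_families (vertices k)) (H k)) (family_cmp (vertices k))"
proof (rule family_semigroup)
  show "(\<lambda>i. f i + g i) \<in> range (\<lambda>(j, n). aff j n)"
    if "f \<in> range (\<lambda>(j, n). aff j n)" "g \<in> range (\<lambda>(j, n). aff j n)" for f g
  proof -
    obtain a b where "f = (\<lambda>(j, n). aff j n) a" "g = (\<lambda>(j, n). aff j n) b"
      using \<open>f \<in> _\<close> \<open>g \<in> _\<close> by (elim rangeE)
    then have "(\<lambda>i. f i + g i) = (\<lambda>(j, n). aff j n) (fst a + fst b, \<lambda>i. snd a i + snd b i)"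
      by (simp add: aff_add fun_eq_iff case_prod_unfold)
    then show ?thesis by (simp only: rangeI)
  qed
qed simp

lemma top_P: "topspace (subtopology (map_families (vertices k)) (P k)) = P k"
  and top_H: "topspace (subtopology (map_families (vertices k)) (H k)) = H k"
  and top_ellis: "topspace (subtopology maps ellis) = ellis"
  using ellis_family_top[of _ "vertices k"] ellis_maps unfolding topspace_subtopology by blast+

lemma P_mul: "p \<in> P k \<Longrightarrow> q \<in> P k \<Longrightarrow> family_cmp (vertices k) p q \<in> P k"
  using right_top_semigroup.mul_in[OF P_semigroup] unfolding top_P by blast

lemma H_mul: "p \<in> H k \<Longrightarrow> q \<in> H k \<Longrightarrow> family_cmp (vertices k) p q \<in> H k"
  using right_top_semigroup.mul_in[OF H_semigroup] unfolding top_H by blast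

lemma P_empty: assumes "p \<in> P k" shows "p {} = iterate 0"
proof -
  have e: "{} \<in> vertices k" by simp
  have "p {} \<in> {iterate 0}"
  proof (rule continuous_map_closure_mem[OF _ assms(1)[unfolded ellis_family_def]])
    show "continuous_map (map_families (vertices k)) maps (\<lambda>p. p {})"
      by (rule continuous_map_product_projection[OF e])
    show "closedin maps {iterate 0}"
      using Hausdorff_maps iterate_in by (simp only: closedin_Hausdorff_singleton)
    fix a assume "a \<in> iterates (vertices k) ` range (aff 0)"
    then obtain n where "a = iterates (vertices k) (aff 0 n)" by (elim imageE rangeE) simp
    then show "a {} \<in> {iterate 0}" by (simp add: iterates_def)
  qed
  then show ?thesis by simp
qed

lemma family_cmp_apply: "\<epsilon> \<in> I \<Longrightarrow> family_cmp I p q \<epsilon> = p \<epsilon> \<star> q \<epsilon>"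
  by (simp add: family_cmp_def)

lemma P_reindex:
  assumes "linear_cube_map k m \<phi>" "p \<in> P m"
  shows "(\<lambda>\<epsilon>\<in>vertices k. p (\<phi> \<epsilon>)) \<in> P k"
proof (rule family_image[OF assms(2)])
  have im: "\<phi> ` vertices k \<subseteq> vertices m" using assms(1) unfolding linear_cube_map_def by (rule conjunct1)
  then show "continuous_map (map_families (vertices m)) (map_families (vertices k)) (\<lambda>p. \<lambda>\<epsilon>\<in>vertices k. p (\<phi> \<epsilon>))"
    by (rule continuous_map_reindex)
  fix f :: "nat set \<Rightarrow> int" assume "f \<in> range (aff 0)"
  then obtain n where f: "f = aff 0 n" by (elim rangeE)
  obtain n' where n': "\<forall>\<epsilon>\<in>vertices k. aff 0 n (\<phi> \<epsilon>) = aff 0 n' \<epsilon>"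
    using assms(1) unfolding linear_cube_map_def by (elim conjE allE exE)
  have "(\<lambda>\<epsilon>\<in>vertices k. iterates (vertices m) f (\<phi> \<epsilon>)) = iterates (vertices k) (aff 0 n')"
    unfolding iterates_def f
  proof (rule restrict_ext)
    fix \<epsilon> assume e: "\<epsilon> \<in> vertices k"
    then have "\<phi> \<epsilon> \<in> vertices m" using im by (rule subsetD[OF _ imageI, rotated])
    then show "(\<lambda>i\<in>vertices m. iterate (aff 0 n i)) (\<phi> \<epsilon>) = iterate (aff 0 n' \<epsilon>)"
      using bspec[OF n' e] by (simp only: restrict_apply')
  qed
  then show "\<exists>g\<in>range (aff 0). (\<lambda>\<epsilon>\<in>vertices k. iterates (vertices m) f (\<phi> \<epsilon>)) = iterates (vertices k) g"
    by (intro bexI[of _ "aff 0 n'"]) simp_all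
qed

text \<open>The facet with \<open>Suc k\<close> on turns a linear map with coefficients
  \<open>n\<close> into the affine map with constant \<open>n (Suc k)\<close>, and all affine maps
  arise in this way. Compactness extends the surjectivity to limits.\<close>

lemma P_upper_half: assumes "h \<in> H k"
  shows "\<exists>f\<in>P (Suc k). \<forall>\<epsilon>\<in>vertices k. f (insert (Suc k) \<epsilon>) = h \<epsilon>"
proof -
  let ?F = "\<lambda>p. \<lambda>\<epsilon>\<in>vertices k. p (insert (Suc k) \<epsilon>)"
  have im: "insert (Suc k) ` vertices k \<subseteq> vertices (Suc k)" by auto
  have F: "?F (iterates (vertices (Suc k)) (aff 0 n)) = iterates (vertices k) (aff (n (Suc k)) n)" for n
    unfolding iterates_def
  proof (rule restrict_ext)
    fix \<epsilon> assume e: "\<epsilon> \<in> vertices k"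
    then have "insert (Suc k) \<epsilon> \<in> vertices (Suc k)" "Suc k \<notin> \<epsilon>" by auto
    then show "(\<lambda>i\<in>vertices (Suc k). iterate (aff 0 n i)) (insert (Suc k) \<epsilon>) = iterate (aff (n (Suc k)) n \<epsilon>)"
      using finite_vertex[OF e] by (simp add: aff_def)
  qed
  have "?F ` P (Suc k) = map_families (vertices k) closure_of (?F ` iterates (vertices (Suc k)) ` range (aff 0))"
    unfolding ellis_family_def
    by (rule compact_image_closure[OF continuous_map_reindex[OF im] compact_map_families Hausdorff_map_families])
      (use iterates_in in blast)
  moreover have "?F ` iterates (vertices (Suc k)) ` range (aff 0) = iterates (vertices k) ` range (\<lambda>(j, n). aff j n)"
  proof (intro equalityI subsetI)
    fix p assume "p \<in> ?F ` iterates (vertices (Suc k)) ` range (aff 0)"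
    then obtain n where "p = iterates (vertices k) (aff (n (Suc k)) n)"
      using F by (elim imageE rangeE) simp
    then show "p \<in> iterates (vertices k) ` range (\<lambda>(j, n). aff j n)"
      by (intro image_eqI[OF _ range_eqI[of _ _ "(n (Suc k), n)"]]) simp_all
  next
    fix p assume "p \<in> iterates (vertices k) ` range (\<lambda>(j, n). aff j n)"
    then obtain j n where p: "p = iterates (vertices k) (aff j n)" by (elim imageE rangeE) (simp add: case_prod_unfold)
    have "iterates (vertices k) (aff j (n(Suc k := j))) = iterates (vertices k) (aff j n)"
      unfolding iterates_def
    proof (rule restrict_ext)
      fix \<epsilon> assume "\<epsilon> \<in> vertices k"
      then have "Suc k \<notin> \<epsilon>" by auto
      then have "sum (n(Suc k := j)) \<epsilon> = sum n \<epsilon>" by (intro sum.cong) auto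
      then show "iterate (aff j (n(Suc k := j)) \<epsilon>) = iterate (aff j n \<epsilon>)" by (simp add: aff_def)
    qed
    then have "?F (iterates (vertices (Suc k)) (aff 0 (n(Suc k := j)))) = p"
      unfolding F p by simp
    then show "p \<in> ?F ` iterates (vertices (Suc k)) ` range (aff 0)"
      by (intro image_eqI[OF sym imageI[OF rangeI]])
  qed
  ultimately have "h \<in> ?F ` P (Suc k)" using assms unfolding ellis_family_def by simp
  then obtain f where "f \<in> P (Suc k)" "h = ?F f" by (elim imageE)
  then show ?thesis by (intro bexI[of _ f]) simp_all
qed

text \<open>Indicators of upper facets are linear in a single coefficient, so any limit of iterates
  may be placed on such a facet. These families are the factors of \<open>w k\<close>.\<close>

lemma P_facet: assumes "p \<in> ellis" "i \<in> {1..k}"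
  shows "(\<lambda>\<epsilon>\<in>vertices k. if i \<in> \<epsilon> then p else iterate 0) \<in> P k"
proof (rule ellis_to_family[OF assms(1)])
  show "continuous_map maps (map_families (vertices k)) (\<lambda>p. \<lambda>\<epsilon>\<in>vertices k. if i \<in> \<epsilon> then p else iterate 0)"
  proof (intro continuous_map_family)
    fix \<epsilon>
    show "continuous_map maps maps (\<lambda>p. if i \<in> \<epsilon> then p else iterate 0)"
      using continuous_map_id iterate_in by (cases "i \<in> \<epsilon>") (simp_all add: id_def)
  qed
  fix n
  have "(\<lambda>\<epsilon>\<in>vertices k. if i \<in> \<epsilon> then iterate n else iterate 0) = iterates (vertices k) (aff 0 (\<lambda>l. if l = i then n else 0))"
    unfolding iterates_def
  proof (rule restrict_ext)
    fix \<epsilon> assume "\<epsilon> \<in> vertices k"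
    from finite_vertex[OF this]
    show "(if i \<in> \<epsilon> then iterate n else iterate 0) = iterate (aff 0 (\<lambda>l. if l = i then n else 0) \<epsilon>)"
      by (simp add: aff_def)
  qed
  then show "\<exists>g\<in>range (aff 0). (\<lambda>\<epsilon>\<in>vertices k. if i \<in> \<epsilon> then iterate n else iterate 0) = iterates (vertices k) g"
    by (intro bexI[OF _ rangeI])
qed

lemma H_diagonal: assumes "p \<in> ellis" shows "(\<lambda>\<epsilon>\<in>vertices k. p) \<in> H k"
proof (rule ellis_to_family[OF assms(1)])
  show "continuous_map maps (map_families (vertices k)) (\<lambda>p. \<lambda>\<epsilon>\<in>vertices k. p)"
    using continuous_map_id by (intro continuous_map_family) (simp add: id_def)
  fix n
  have "(\<lambda>\<epsilon>\<in>vertices k. iterate n) = iterates (vertices k) ((\<lambda>(j, n). aff j n) (n, \<lambda>_. 0))"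
    unfolding iterates_def by (rule restrict_ext) (simp add: aff_def)
  then show "\<exists>g\<in>range (\<lambda>(j, n). aff j n). (\<lambda>\<epsilon>\<in>vertices k. iterate n) = iterates (vertices k) g"
    by (intro bexI[OF _ rangeI])
qed

lemma act_family_F_closure:
  assumes "p \<in> P k" "\<And>\<epsilon>. \<epsilon> \<in> vertices k \<Longrightarrow> z \<epsilon> \<in> T"
  shows "act_family (vertices k) p z \<in> F_closure k z"
proof -
  have "act_family (vertices k) p z \<in> (\<lambda>p. act_family (vertices k) p z) ` P k"
    using assms(1) by (rule imageI)
  then show ?thesis using act_family_image[of "vertices k" z "range (aff 0)", OF assms(2)]
    by (simp only: F_closure_def image_image)
qed

end

text \<open>One base point suffices: any other \<open>y\<close> is approximated by
  \<open>act X S m x\<close>, and \<open>m\<close> is absorbed into the constant of the affine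
  map.\<close>

lemma (in minimal) Q_orbit:
  assumes x: "x \<in> T" and z: "z \<in> Q k"
  shows "z \<in> cube_space k X closure_of ((\<lambda>f. \<lambda>\<epsilon>\<in>vertices k. act X S (f \<epsilon>) x) ` range (\<lambda>(j, n). aff j n))"
proof (rule subsetD[OF _ z[unfolded Q_eq]], rule closure_of_minimal)
  let ?O = "cube_space k X closure_of ((\<lambda>f. \<lambda>\<epsilon>\<in>vertices k. act X S (f \<epsilon>) x) ` range (\<lambda>(j, n). aff j n))"
  have gen: "(\<lambda>\<epsilon>\<in>vertices k. act X S (aff j n \<epsilon>) x) \<in> ?O" for j n
  proof (rule subsetD[OF closure_of_subset])
    show "(\<lambda>\<epsilon>\<in>vertices k. act X S (aff j n \<epsilon>) x) \<in> (\<lambda>f. \<lambda>\<epsilon>\<in>vertices k. act X S (f \<epsilon>) x) ` range (\<lambda>(j, n). aff j n)"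
      by (rule image_eqI[OF _ range_eqI[of _ _ "(j, n)"]]) simp_all
    show "(\<lambda>f. \<lambda>\<epsilon>\<in>vertices k. act X S (f \<epsilon>) x) ` range (\<lambda>(j, n). aff j n) \<subseteq> topspace (cube_space k X)"
      unfolding topspace_product_topology using x by (intro image_subsetI) (simp add: restrict_PiE_iff del: Pow_iff)
  qed
  show "{\<lambda>\<epsilon>\<in>vertices k. act X S (aff j n \<epsilon>) x |j n x. x \<in> T} \<subseteq> ?O"
  proof (intro subsetI, elim CollectE exE conjE)
    fix p j n y assume p: "p = (\<lambda>\<epsilon>\<in>vertices k. act X S (aff j n \<epsilon>) y)" and y: "y \<in> T"
    have c: "continuous_map X (cube_space k X) (\<lambda>y. \<lambda>\<epsilon>\<in>vertices k. act X S (aff j n \<epsilon>) y)"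
      by (intro continuous_map_family continuous_act)
    have y: "y \<in> X closure_of range (\<lambda>m. act X S m x)" using orbit_dense[OF x] y by simp
    have m: "(\<lambda>\<epsilon>\<in>vertices k. act X S (aff j n \<epsilon>) (act X S m x)) \<in> ?O" for m
    proof -
      have "(\<lambda>\<epsilon>\<in>vertices k. act X S (aff j n \<epsilon>) (act X S m x)) = (\<lambda>\<epsilon>\<in>vertices k. act X S (aff (j + m) n \<epsilon>) x)"
      proof (rule restrict_ext)
        fix \<epsilon>
        have "aff (j + m) n \<epsilon> = aff j n \<epsilon> + m" by (simp add: aff_def)
        then show "act X S (aff j n \<epsilon>) (act X S m x) = act X S (aff (j + m) n \<epsilon>) x"
          using act_add[OF x] by simp
      qed
      then show ?thesis using gen by (simp only:)
    qed
    show "p \<in> ?O"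
      unfolding p by (rule continuous_map_closure_mem[OF c y _ closedin_closure_of]) (elim rangeE, simp only: m)
  qed
qed simp

section \<open>Families with values in the Ellis group\<close>

locale ellis_unit = minimal +
  fixes L u
  assumes nonempty: "topspace X \<noteq> {}"
    and ideal: "right_top_semigroup.minimal_left_ideal (subtopology maps ellis) (\<star>) L"
    and unit: "u \<in> L" "u \<star> u = u"

sublocale ellis_unit \<subseteq> E: right_top_semigroup "subtopology maps ellis" "(\<star>)"
  by (rule ellis_semigroup[OF nonempty])

context ellis_unit
begin

definition "G = E.ellis_group L u"

lemmas G_in = E.group_in[OF ideal unit, folded G_def, unfolded top_ellis]
  and G_left = E.group_left[OF ideal unit, folded G_def]
  and G_right = E.group_right[OF ideal unit, folded G_def]
  and G_unit = E.group_unit[OF ideal unit, folded G_def]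
  and G_mul = E.group_mul[OF ideal unit, folded G_def]
  and G_sandwich = E.group_sandwich[OF ideal unit, folded G_def, unfolded top_ellis]
  and G_inv = E.group_left_inverse[OF ideal unit, folded G_def]
  and G_swap = E.group_inverse_swap[OF ideal unit, folded G_def]
  and L_left = E.L_left[OF ideal unit, unfolded top_ellis]
  and L_right_unit = E.L_right_unit[OF ideal unit]
  and L_ellis = E.L_in[OF ideal unit, unfolded top_ellis]

lemma u_ellis: "u \<in> ellis" by (rule L_ellis[OF unit(1)])

lemmas u_maps = ellis_maps[OF u_ellis]

lemma G_maps: "p \<in> G \<Longrightarrow> p \<in> topspace maps"
  by (rule ellis_maps[OF G_in])

text \<open>Elements of \<open>P k\<close> are the identity at \<open>{}\<close>, so
  \<open>u\<close> can be imposed at the other vertices only. Multiplication by \<open>w k\<close>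
  from both sides pushes \<open>P k\<close> into families with values in \<open>G\<close> away from
  \<open>{}\<close>.\<close>

definition "w k = (\<lambda>\<epsilon>\<in>vertices k. if \<epsilon> = {} then iterate 0 else u)"

text \<open>Product of the families with \<open>u\<close> on one upper facet; a vertex contained in
  several of these facets still carries \<open>u\<close> by idempotence.\<close>

lemma w_in_P: "w k \<in> P k"
proof -
  have "(\<lambda>\<epsilon>\<in>vertices k. if \<epsilon> \<inter> {1..m} = {} then iterate 0 else u) \<in> P k" if "m \<le> k" for m
    using that
  proof (induction m)
    case 0
    have "(\<lambda>\<epsilon>\<in>vertices k. if \<epsilon> \<inter> {1..0} = {} then iterate 0 else u) = iterates (vertices k) (aff 0 (\<lambda>_. 0))"
      unfolding iterates_def by (rule restrict_ext) (simp add: aff_def)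
    then show ?case using iterates_family[OF rangeI] by (simp only:)
  next
    case (Suc m)
    have i: "Suc m \<in> {1..k}" using Suc.prems by simp
    have I: "{1..Suc m} = insert (Suc m) {1..m}" by auto
    have "(\<lambda>\<epsilon>\<in>vertices k. if \<epsilon> \<inter> {1..Suc m} = {} then iterate 0 else u) =
       family_cmp (vertices k) (\<lambda>\<epsilon>\<in>vertices k. if Suc m \<in> \<epsilon> then u else iterate 0)
         (\<lambda>\<epsilon>\<in>vertices k. if \<epsilon> \<inter> {1..m} = {} then iterate 0 else u)"
      unfolding family_cmp_def
    proof (rule restrict_ext)
      fix \<epsilon> assume "\<epsilon> \<in> vertices k"
      then show "(if \<epsilon> \<inter> {1..Suc m} = {} then iterate 0 else u) =
         (\<lambda>\<epsilon>\<in>vertices k. if Suc m \<in> \<epsilon> then u else iterate 0) \<epsilon> \<star>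
         (\<lambda>\<epsilon>\<in>vertices k. if \<epsilon> \<inter> {1..m} = {} then iterate 0 else u) \<epsilon>"
        unfolding I using iterate_0_left[OF u_maps] iterate_0_right[OF u_maps] unit(2) iterate_0_left[OF iterate_in]
        by (simp del: Pow_iff)
    qed
    then show ?case using P_mul[OF P_facet[OF u_ellis i] Suc.IH] Suc.prems by (simp only: Suc_leD)
  qed
  from this[of k] have "(\<lambda>\<epsilon>\<in>vertices k. if \<epsilon> \<inter> {1..k} = {} then iterate 0 else u) \<in> P k" by simp
  moreover have "(\<lambda>\<epsilon>\<in>vertices k. if \<epsilon> \<inter> {1..k} = {} then iterate 0 else u) = w k"
    unfolding w_def by (rule restrict_ext) (simp add: Int_absorb2)
  ultimately show ?thesis by simp
qed

lemma w_apply: "\<epsilon> \<in> vertices k \<Longrightarrow> \<epsilon> \<noteq> {} \<Longrightarrow> w k \<epsilon> = u"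
  by (simp add: w_def)

definition normal :: "nat \<Rightarrow> (nat set \<Rightarrow> 'a \<Rightarrow> 'a) \<Rightarrow> bool" where
  "normal k f \<longleftrightarrow> f \<in> P k \<and> (\<forall>\<epsilon>\<in>vertices k. \<epsilon> \<noteq> {} \<longrightarrow> f \<epsilon> \<in> G)"

lemma normalD: "normal k f \<Longrightarrow> f \<in> P k" "normal k f \<Longrightarrow> \<epsilon> \<in> vertices k \<Longrightarrow> \<epsilon> \<noteq> {} \<Longrightarrow> f \<epsilon> \<in> G"
  by (simp_all add: normal_def)

lemma normal_mul:
  assumes "normal k f" "normal k g" shows "normal k (family_cmp (vertices k) f g)"
  using assms P_mul G_mul unfolding normal_def by (simp add: family_cmp_apply del: Pow_iff)

text \<open>Inverses exist in \<open>G\<close> vertex by vertex; the point is that they form a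
  family in \<open>P k\<close>. The closed subsemigroup of left multiples of \<open>f\<close>
  contains an idempotent \<open>p f\<close>. Its values away from \<open>{}\<close> are idempotents
  of \<open>L\<close>, hence \<open>u\<close> times them is \<open>u\<close>, and
  \<open>w p w\<close> inverts \<open>f\<close>.\<close>

lemma normal_inverse:
  assumes f: "normal k f"
  shows "\<exists>r. normal k r \<and> (\<forall>\<epsilon>\<in>vertices k. \<epsilon> \<noteq> {} \<longrightarrow> r \<epsilon> \<star> f \<epsilon> = u \<and> f \<epsilon> \<star> r \<epsilon> = u)"
proof -
  interpret Pk: right_top_semigroup "subtopology (map_families (vertices k)) (P k)" "family_cmp (vertices k)"
    by (rule P_semigroup)
  let ?c = "family_cmp (vertices k)"
  have fP: "f \<in> P k" by (rule normalD(1)[OF f])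
  have "\<exists>e\<in>(\<lambda>p. ?c p f) ` P k. ?c e e = e"
  proof (rule Pk.ellis_numakura)
    show "closedin (subtopology (map_families (vertices k)) (P k)) ((\<lambda>p. ?c p f) ` P k)"
      using Pk.closedin_right_image[OF closedin_topspace, unfolded top_P, OF fP] .
    show "(\<lambda>p. ?c p f) ` P k \<noteq> {}" using fP by blast
    fix a b assume "a \<in> (\<lambda>p. ?c p f) ` P k" "b \<in> (\<lambda>p. ?c p f) ` P k"
    then obtain p q where pq: "p \<in> P k" "q \<in> P k" "a = ?c p f" "b = ?c q f" by (elim imageE)
    have "?c a b = ?c (?c a q) f"
      using Pk.mul_assoc[unfolded top_P, OF P_mul[OF pq(1) fP] pq(2) fP] pq by simp
    then show "?c a b \<in> (\<lambda>p. ?c p f) ` P k"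
      using P_mul[OF P_mul[OF pq(1) fP] pq(2)] unfolding pq(3) by (rule image_eqI)
  qed
  then obtain p where p: "p \<in> P k" "?c (?c p f) (?c p f) = ?c p f" by (elim bexE imageE) simp
  define r where "r = ?c (?c (w k) p) (w k)"
  have rP: "r \<in> P k" unfolding r_def by (intro P_mul w_in_P p)
  have r: "r \<epsilon> \<in> G \<and> r \<epsilon> \<star> f \<epsilon> = u" if e: "\<epsilon> \<in> vertices k" "\<epsilon> \<noteq> {}" for \<epsilon>
  proof -
    have pe: "p \<epsilon> \<in> ellis" by (rule family_ellis[OF p(1) e(1)])
    have fe: "f \<epsilon> \<in> G" by (rule normalD(2)[OF f e])
    have re: "r \<epsilon> = u \<star> p \<epsilon> \<star> u"
      unfolding r_def family_cmp_apply[OF e(1)] w_apply[OF e] ..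
    have "p \<epsilon> \<star> f \<epsilon> \<in> L"
      by (rule L_left[OF pe E.group_L[OF ideal unit, folded G_def, OF fe]])
    moreover have "(p \<epsilon> \<star> f \<epsilon>) \<star> (p \<epsilon> \<star> f \<epsilon>) = p \<epsilon> \<star> f \<epsilon>"
      using fun_cong[OF p(2), of \<epsilon>] by (simp only: family_cmp_apply[OF e(1)])
    ultimately have "u \<star> (p \<epsilon> \<star> f \<epsilon>) = u" by (rule L_right_unit[OF unit(1)])
    moreover have "r \<epsilon> \<star> f \<epsilon> = u \<star> p \<epsilon> \<star> (u \<star> f \<epsilon>)"
      unfolding re by (rule cmp_assoc[OF u_maps G_maps[OF fe]])
    moreover have "u \<star> p \<epsilon> \<star> f \<epsilon> = u \<star> (p \<epsilon> \<star> f \<epsilon>)"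
      by (rule cmp_assoc[OF ellis_maps[OF pe] G_maps[OF fe]])
    ultimately have "r \<epsilon> \<star> f \<epsilon> = u" using G_left[OF fe] by simp
    then show ?thesis using G_sandwich[OF pe] re by simp
  qed
  have "f \<epsilon> \<star> r \<epsilon> = u" if e: "\<epsilon> \<in> vertices k" "\<epsilon> \<noteq> {}" for \<epsilon>
    using G_swap[OF normalD(2)[OF f e]] r[OF e] by blast
  then show ?thesis using r rP unfolding normal_def by (intro exI[of _ r] conjI ballI impI) simp_all
qed

lemma normalize:
  assumes "f \<in> P k" shows "normal k (family_cmp (vertices k) (family_cmp (vertices k) (w k) f) (w k))"
  unfolding normal_def
proof (intro conjI ballI impI P_mul w_in_P assms)
  fix \<epsilon> assume e: "\<epsilon> \<in> vertices k" "\<epsilon> \<noteq> {}"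
  show "family_cmp (vertices k) (family_cmp (vertices k) (w k) f) (w k) \<epsilon> \<in> G"
    using G_sandwich[OF family_ellis[OF assms e(1)]] by (simp only: family_cmp_apply[OF e(1)] w_apply[OF e])
qed

text \<open>A nonempty vertex may be sent to \<open>{}\<close>, where \<open>D\<close> is the
  identity rather than \<open>u\<close>. The factor \<open>w k\<close> repairs this and leaves
  values in \<open>G\<close> unchanged.\<close>

lemma normal_reindex:
  assumes D: "normal m D" and \<phi>: "linear_cube_map k m \<phi>"
  shows "normal k (family_cmp (vertices k) (w k) (\<lambda>\<epsilon>\<in>vertices k. D (\<phi> \<epsilon>)))"
proof -
  have im: "\<phi> ` vertices k \<subseteq> vertices m" using \<phi> unfolding linear_cube_map_def by (rule conjunct1)
  have "u \<star> D (\<phi> \<epsilon>) \<in> G" if "\<epsilon> \<in> vertices k" for \<epsilon>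
  proof (cases "\<phi> \<epsilon> = {}")
    case True
    then show ?thesis using P_empty[OF normalD(1)[OF D]] iterate_0_right[OF u_maps] G_unit by simp
  next
    case False
    then have "D (\<phi> \<epsilon>) \<in> G" by (intro normalD(2)[OF D] subsetD[OF im] imageI that)
    then show ?thesis by (simp only: G_left)
  qed
  then show ?thesis
    unfolding normal_def using P_mul[OF w_in_P P_reindex[OF \<phi> normalD(1)[OF D]]]
    by (simp add: family_cmp_apply w_apply del: Pow_iff)
qed

text \<open>The telescoping identity behind this lemma: ordering the directions of the cube,
  \<open>d\<^sub>\<epsilon>\<close> is the product of the quotients \<open>d\<^bsub>\<epsilon>\<inter>[m+1]\<^esub> d\<^bsub>\<epsilon>\<inter>[m]\<^esub>\<inverse>\<close>, which are trivial unless \<open>m + 1 \<in> \<epsilon>\<close>,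
  so that they only involve the family at vertices with last coordinate \<open>1\<close>.\<close>

lemma normal_upper_half:
  assumes D: "normal (Suc k) D" and low: "\<And>\<epsilon>. \<epsilon> \<in> vertices k \<Longrightarrow> \<epsilon> \<noteq> {} \<Longrightarrow> D \<epsilon> = u"
    and top: "D {Suc k} = u"
  shows "normal k (\<lambda>\<epsilon>\<in>vertices k. if \<epsilon> = {} then iterate 0 else D (insert (Suc k) \<epsilon>))"
proof -
  let ?c = "family_cmp (vertices k)"
  have up: "insert (Suc k) \<epsilon> \<in> vertices (Suc k)" if "\<epsilon> \<in> vertices k" for \<epsilon> using that by auto
  have dG: "D (insert (Suc k) \<epsilon>) \<in> G" if "\<epsilon> \<in> vertices k" for \<epsilon>
    by (rule normalD(2)[OF D up[OF that]]) simp
  \<comment> \<open>Interpolates between \<open>t 0 = w k\<close>, where hypothesis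
    \<open>top\<close> enters, and the claimed family at \<open>m = k\<close>.\<close>
  define t where "t m = (\<lambda>\<epsilon>\<in>vertices k. if \<epsilon> = {} then iterate 0 else D (insert (Suc k) (\<epsilon> \<inter> {1..m})))" for m :: nat
  \<comment> \<open>Agrees with \<open>t m\<close> on the facet in direction \<open>j\<close> and is
    \<open>u\<close> off it, apart from the vertex \<open>{}\<close>. Unlike \<open>t m\<close> it
    is obtained directly from a pullback of \<open>D\<close>.\<close>
  define e where "e m j = (\<lambda>\<epsilon>\<in>vertices k. if \<epsilon> = {} then iterate 0
      else if j \<in> \<epsilon> then D (insert (Suc k) (\<epsilon> \<inter> {1..m})) else u)" for m j :: nat
  have e: "normal k (e m j)" if m: "m \<le> k" and j: "j \<in> {1..k}" for m j
  proof -
    \<comment> \<open>Bit \<open>j\<close> drives the last direction, and the directions up to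
      \<open>m\<close> are kept. Off the facet the image lies in the lower half of the cube, where
      \<open>D\<close> is \<open>u\<close> or, at \<open>{}\<close>, the identity.\<close>
    define \<phi> where "\<phi> \<epsilon> = {i \<in> insert (Suc k) {1..m}. (if i = Suc k then j else i) \<in> \<epsilon>}" for \<epsilon>
    have \<phi>: "linear_cube_map k (Suc k) \<phi>"
      by (rule linear_cube_mapI[of k \<phi> "insert (Suc k) {1..m}" "\<lambda>i. if i = Suc k then j else i"])
        (use m \<phi>_def in auto)
    have "u \<star> D (\<phi> \<epsilon>) = (if j \<in> \<epsilon> then D (insert (Suc k) (\<epsilon> \<inter> {1..m})) else u)" if eps: "\<epsilon> \<in> vertices k" for \<epsilon>
    proof (cases "j \<in> \<epsilon>")
      case True
      have "\<epsilon> \<inter> {1..m} \<in> vertices k" using eps by auto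
      moreover have "\<phi> \<epsilon> = insert (Suc k) (\<epsilon> \<inter> {1..m})"
        using True eps m by (auto simp: \<phi>_def)
      ultimately show ?thesis using True dG G_left by simp
    next
      case False
      then have p: "\<phi> \<epsilon> = \<epsilon> \<inter> {1..m}" using eps m by (auto simp: \<phi>_def)
      show ?thesis
      proof (cases "\<epsilon> \<inter> {1..m} = {}")
        case True
        then show ?thesis using False p P_empty[OF normalD(1)[OF D]] iterate_0_right[OF u_maps] by simp
      next
        case ne: False
        have "\<epsilon> \<inter> {1..m} \<in> vertices k" using eps by auto
        then show ?thesis using False p low ne unit(2) by simp
      qed
    qed
    then have "?c (w k) (\<lambda>\<epsilon>\<in>vertices k. D (\<phi> \<epsilon>)) = e m j"
    proof -
      assume *: "\<And>\<epsilon>. \<epsilon> \<in> vertices k \<Longrightarrow> u \<star> D (\<phi> \<epsilon>) = (if j \<in> \<epsilon> then D (insert (Suc k) (\<epsilon> \<inter> {1..m})) else u)"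
      show ?thesis
        unfolding family_cmp_def e_def w_def
      proof (rule restrict_ext)
        fix \<epsilon> assume eps: "\<epsilon> \<in> vertices k"
        have "\<phi> {} = {}" by (simp add: \<phi>_def)
        then show "(\<lambda>\<epsilon>\<in>vertices k. if \<epsilon> = {} then iterate 0 else u) \<epsilon> \<star> (\<lambda>\<epsilon>\<in>vertices k. D (\<phi> \<epsilon>)) \<epsilon> =
           (if \<epsilon> = {} then iterate 0 else if j \<in> \<epsilon> then D (insert (Suc k) (\<epsilon> \<inter> {1..m})) else u)"
          using *[OF eps] eps P_empty[OF normalD(1)[OF D]] iterate_0_right[OF iterate_in]
          by (simp only: restrict_apply' if_False if_True simp_thms split: if_split) simp
      qed
    qed
    then show ?thesis using normal_reindex[OF D \<phi>] by simp
  qed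
  have t: "normal k (t m)" if "m \<le> k" for m
    using that
  proof (induction m)
    case 0
    have "t 0 = w k"
      unfolding t_def w_def using top by (intro restrict_ext) simp
    moreover have "normal k (w k)" using w_in_P G_unit w_apply by (simp add: normal_def)
    ultimately show ?case by simp
  next
    case (Suc m)
    have j: "Suc m \<in> {1..k}" using Suc.prems by simp
    have e1: "normal k (e (Suc m) (Suc m))" and e2: "normal k (e m (Suc m))" using e[OF _ j] Suc.prems by simp_all
    have tm: "normal k (t m)" using Suc by simp
    obtain r where r: "normal k r" "\<And>\<epsilon>. \<epsilon> \<in> vertices k \<Longrightarrow> \<epsilon> \<noteq> {} \<Longrightarrow> r \<epsilon> \<star> e m (Suc m) \<epsilon> = u"
      using normal_inverse[OF e2] by blast
    \<comment> \<open>One telescoping factor: \<open>e (Suc m) (Suc m)\<close> times the inverse of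
      \<open>e m (Suc m)\<close> times \<open>t m\<close>. Where \<open>Suc m\<close> is on, the
      last two cancel to \<open>u\<close>; at the other nonempty vertices the first two are
      \<open>u\<close> and \<open>t\<close> does not change.\<close>
    have n: "normal k (?c (e (Suc m) (Suc m)) (?c r (t m)))"
      by (intro normal_mul e1 r(1) tm)
    have "?c (e (Suc m) (Suc m)) (?c r (t m)) \<epsilon> = t (Suc m) \<epsilon>" if eps: "\<epsilon> \<in> vertices k" for \<epsilon>
    proof (cases "\<epsilon> = {}")
      case True
      then show ?thesis using P_empty[OF normalD(1)[OF n]] by (simp add: t_def)
    next
      case ne: False
      have sub: "\<epsilon> \<inter> {1..m} \<in> vertices k" for m using eps by auto
      show ?thesis
      proof (cases "Suc m \<in> \<epsilon>")
        case True
        have eq: "e (Suc m) (Suc m) \<epsilon> = t (Suc m) \<epsilon>" "e m (Suc m) \<epsilon> = t m \<epsilon>"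
          using True ne eps by (simp_all add: e_def t_def)
        have "?c (e (Suc m) (Suc m)) (?c r (t m)) \<epsilon> = t (Suc m) \<epsilon> \<star> u"
          using r(2)[OF eps ne] by (simp only: family_cmp_apply[OF eps] eq)
        also have "\<dots> = t (Suc m) \<epsilon>" unfolding eq(1)[symmetric] by (rule G_right[OF normalD(2)[OF e1 eps ne]])
        finally show ?thesis .
      next
        case False
        have eq: "e (Suc m) (Suc m) \<epsilon> = u" "e m (Suc m) \<epsilon> = u" using False ne eps by (simp_all add: e_def)
        have "{1..Suc m} = insert (Suc m) {1..m}" by auto
        then have "\<epsilon> \<inter> {1..Suc m} = \<epsilon> \<inter> {1..m}" using False by auto
        then have tt: "t (Suc m) \<epsilon> = t m \<epsilon>" using eps by (simp add: t_def)
        have "r \<epsilon> = u" using r(2)[OF eps ne] G_right[OF normalD(2)[OF r(1) eps ne]] eq by simp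
        then show ?thesis
          using G_left[OF normalD(2)[OF tm eps ne]] by (simp only: family_cmp_apply[OF eps] eq tt)
      qed
    qed
    moreover have "t (Suc m) \<in> topspace (map_families (vertices k))"
      unfolding t_def
    proof (intro family_topI)
      fix \<epsilon> assume eps: "\<epsilon> \<in> vertices k"
      then have "\<epsilon> \<inter> {1..Suc m} \<in> vertices k" by auto
      then show "(if \<epsilon> = {} then iterate 0 else D (insert (Suc k) (\<epsilon> \<inter> {1..Suc m}))) \<in> topspace maps"
        using iterate_in[of 0] G_maps[OF dG, of "\<epsilon> \<inter> {1..Suc m}"] by presburger
    qed
    ultimately have "?c (e (Suc m) (Suc m)) (?c r (t m)) = t (Suc m)"
      by (intro family_eqI[OF ellis_family_top[OF normalD(1)[OF n]]])
    then show ?case using n by simp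
  qed
  have "t k = (\<lambda>\<epsilon>\<in>vertices k. if \<epsilon> = {} then iterate 0 else D (insert (Suc k) \<epsilon>))"
    unfolding t_def
  proof (rule restrict_ext)
    fix \<epsilon> assume "\<epsilon> \<in> vertices k"
    then have "\<epsilon> \<inter> {1..k} = \<epsilon>" by auto
    then show "(if \<epsilon> = {} then iterate 0 else D (insert (Suc k) (\<epsilon> \<inter> {1..k}))) = (if \<epsilon> = {} then iterate 0 else D (insert (Suc k) \<epsilon>))"
      by simp
  qed
  then show ?thesis using t[of k] by simp
qed

theorem diagonal_in_F_closure:
  assumes z: "z \<in> Q k" and x: "x \<in> T" "z {} = x" "u x = x"
  shows "(\<lambda>\<epsilon>\<in>vertices k. x) \<in> F_closure k z"
proof -
  let ?c = "family_cmp (vertices k)"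
  have e0: "{} \<in> vertices k" by simp
  have zT: "z \<epsilon> \<in> T" if "\<epsilon> \<in> vertices k" for \<epsilon> by (rule Q_in[OF z that])
  have "z \<in> (\<lambda>p. act_family (vertices k) p (\<lambda>_. x)) ` H k"
    unfolding act_family_image[of "vertices k" "\<lambda>_. x", OF x(1)] using Q_orbit[OF x(1) z] .
  then obtain h where h: "h \<in> H k" "z = act_family (vertices k) h (\<lambda>_. x)" by (elim imageE)
  have zh: "z \<epsilon> = h \<epsilon> x" if "\<epsilon> \<in> vertices k" for \<epsilon> unfolding h(2) by (rule restrict_apply'[OF that])
  have hE: "h \<epsilon> \<in> ellis" if "\<epsilon> \<in> vertices k" for \<epsilon> by (rule family_ellis[OF h(1) that])
  \<comment> \<open>The value of \<open>h\<close> at \<open>{}\<close>, cut down to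
    \<open>G\<close>. Right multiplication by its inverse \<open>b\<close> normalises that value to
    \<open>u\<close>; since \<open>b\<close> fixes \<open>x\<close>, the points reached from
    \<open>x\<close> are still those of \<open>z\<close> up to an application of
    \<open>u\<close>.\<close>
  define a where "a = u \<star> h {} \<star> u"
  have aG: "a \<in> G" unfolding a_def by (rule G_sandwich[OF hE[OF e0]])
  have ax: "a x = x" using x zh[OF e0] by (simp add: a_def cmp_apply)
  obtain b where b: "b \<in> G" "b \<star> a = u" using G_inv[OF aG] by blast
  have ab: "a \<star> b = u" by (rule G_swap[OF aG b])
  have bx: "b x = x"
    using fun_cong[OF b(2), of x] x ax by (simp add: cmp_apply)
  let ?u = "\<lambda>\<epsilon>\<in>vertices k. u"
  define h2 where "h2 = ?c (?c (?c ?u h) ?u) (\<lambda>\<epsilon>\<in>vertices k. b)"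
  have h2: "h2 \<in> H k" unfolding h2_def by (intro H_mul H_diagonal u_ellis h(1) G_in[OF b(1)])
  have h2e: "h2 \<epsilon> = u \<star> h \<epsilon> \<star> u \<star> b" if "\<epsilon> \<in> vertices k" for \<epsilon>
    unfolding h2_def using that by (simp add: family_cmp_apply del: Pow_iff)
  have h2G: "h2 \<epsilon> \<in> G" if "\<epsilon> \<in> vertices k" for \<epsilon>
    unfolding h2e[OF that] by (rule G_mul[OF G_sandwich[OF hE[OF that]] b(1)])
  have h2_0: "h2 {} = u" unfolding h2e[OF e0] a_def[symmetric] by (rule ab)
  have h2x: "h2 \<epsilon> x = u (z \<epsilon>)" if "\<epsilon> \<in> vertices k" for \<epsilon>
    unfolding h2e[OF that] zh[OF that] using x bx by (simp add: cmp_apply)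
  obtain f where f: "f \<in> P (Suc k)" "\<And>\<epsilon>. \<epsilon> \<in> vertices k \<Longrightarrow> f (insert (Suc k) \<epsilon>) = h2 \<epsilon>"
    using P_upper_half[OF h2] by blast
  define F where "F = family_cmp (vertices (Suc k)) (family_cmp (vertices (Suc k)) (w (Suc k)) f) (w (Suc k))"
  have F: "normal (Suc k) F" unfolding F_def by (rule normalize[OF f(1)])
  have up: "insert (Suc k) \<epsilon> \<in> vertices (Suc k)" "\<epsilon> \<in> vertices (Suc k)" if "\<epsilon> \<in> vertices k" for \<epsilon>
    using that by auto
  have Fup: "F (insert (Suc k) \<epsilon>) = h2 \<epsilon>" if "\<epsilon> \<in> vertices k" for \<epsilon>
  proof -
    have "F (insert (Suc k) \<epsilon>) = u \<star> h2 \<epsilon> \<star> u"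
      unfolding F_def family_cmp_apply[OF up(1)[OF that]] w_apply[OF up(1)[OF that] insert_not_empty] f(2)[OF that] ..
    then show ?thesis by (simp only: G_left[OF h2G[OF that]] G_right[OF h2G[OF that]])
  qed
  have lin: "linear_cube_map k (Suc k) (\<lambda>\<epsilon>. {i \<in> {1..k}. i \<in> \<epsilon>})"
    by (rule linear_cube_mapI[of k _ "{1..k}" "\<lambda>i. i"]) auto
  have id: "{i \<in> {1..k}. i \<in> \<epsilon>} = \<epsilon>" if "\<epsilon> \<in> vertices k" for \<epsilon> using that by auto
  \<comment> \<open>\<open>f1\<close> is the lower half of \<open>F\<close>. Its inverse
    \<open>r\<close> is spread over both halves by forgetting direction \<open>Suc k\<close>, so
    that the product \<open>D\<close> of \<open>F\<close> and \<open>R\<close> is trivial on the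
    lower half and is \<open>h2\<close> times \<open>r\<close> on the upper one.\<close>
  have "normal k (?c (w k) (\<lambda>\<epsilon>\<in>vertices k. F {i \<in> {1..k}. i \<in> \<epsilon>}))"
    by (rule normal_reindex[OF F lin])
  then obtain f1 where f1: "normal k f1" "f1 = ?c (w k) (\<lambda>\<epsilon>\<in>vertices k. F {i \<in> {1..k}. i \<in> \<epsilon>})" by blast
  have f1e: "f1 \<epsilon> = F \<epsilon>" if "\<epsilon> \<in> vertices k" "\<epsilon> \<noteq> {}" for \<epsilon>
    unfolding f1(2) family_cmp_apply[OF that(1)] w_apply[OF that] restrict_apply'[OF that(1)] id[OF that(1)]
    by (rule G_left[OF normalD(2)[OF F up(2)[OF that(1)] that(2)]])
  obtain r where r: "normal k r" "\<And>\<epsilon>. \<epsilon> \<in> vertices k \<Longrightarrow> \<epsilon> \<noteq> {} \<Longrightarrow> r \<epsilon> \<star> f1 \<epsilon> = u \<and> f1 \<epsilon> \<star> r \<epsilon> = u"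
    using normal_inverse[OF f1(1)] by blast
  have lin2: "linear_cube_map (Suc k) k (\<lambda>\<epsilon>. {i \<in> {1..k}. i \<in> \<epsilon>})"
    by (rule linear_cube_mapI[of "Suc k" _ "{1..k}" "\<lambda>i. i"]) auto
  define R where "R = family_cmp (vertices (Suc k)) (w (Suc k)) (\<lambda>\<epsilon>\<in>vertices (Suc k). r {i \<in> {1..k}. i \<in> \<epsilon>})"
  have R: "normal (Suc k) R" unfolding R_def by (rule normal_reindex[OF r(1) lin2])
  have Re: "R \<epsilon> = u \<star> r {i \<in> {1..k}. i \<in> \<epsilon>}" if "\<epsilon> \<in> vertices (Suc k)" "\<epsilon> \<noteq> {}" for \<epsilon>
    unfolding R_def family_cmp_apply[OF that(1)] w_apply[OF that] restrict_apply'[OF that(1)] ..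
  define D where "D = family_cmp (vertices (Suc k)) F R"
  have D: "normal (Suc k) D" unfolding D_def by (rule normal_mul[OF F R])
  have Dlow: "D \<epsilon> = u" if "\<epsilon> \<in> vertices k" "\<epsilon> \<noteq> {}" for \<epsilon>
    unfolding D_def family_cmp_apply[OF up(2)[OF that(1)]] Re[OF up(2)[OF that(1)] that(2)] id[OF that(1)]
      G_left[OF normalD(2)[OF r(1) that]]
    using r(2)[OF that] f1e[OF that] by simp
  have upid: "{i \<in> {1..k}. i \<in> insert (Suc k) \<epsilon>} = \<epsilon>" if "\<epsilon> \<in> vertices k" for \<epsilon> using that by auto
  have Dup: "D (insert (Suc k) \<epsilon>) = h2 \<epsilon> \<star> (u \<star> r \<epsilon>)" if "\<epsilon> \<in> vertices k" for \<epsilon>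
    unfolding D_def family_cmp_apply[OF up(1)[OF that]] Re[OF up(1)[OF that] insert_not_empty] upid[OF that] Fup[OF that] ..
  have Dtop: "D {Suc k} = u"
    using Dup[OF e0] h2_0 P_empty[OF normalD(1)[OF r(1)]] iterate_0_right[OF u_maps] unit(2) by simp
  define t where "t = (\<lambda>\<epsilon>\<in>vertices k. if \<epsilon> = {} then iterate 0 else D (insert (Suc k) \<epsilon>))"
  have t: "normal k t" unfolding t_def by (rule normal_upper_half[OF D Dlow Dtop])
  \<comment> \<open>Cancels the factor \<open>r\<close>, which exhibits \<open>h2\<close> away from
    \<open>{}\<close> as a member of \<open>P k\<close>.\<close>
  define q where "q = ?c t f1"
  have q: "normal k q" unfolding q_def by (rule normal_mul[OF t f1(1)])
  have qe: "q \<epsilon> = h2 \<epsilon>" if eps: "\<epsilon> \<in> vertices k" "\<epsilon> \<noteq> {}" for \<epsilon>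
  proof -
    have "q \<epsilon> = h2 \<epsilon> \<star> r \<epsilon> \<star> f1 \<epsilon>"
      using eps(2) Dup[OF eps(1)] G_left[OF normalD(2)[OF r(1) eps]]
      unfolding q_def family_cmp_apply[OF eps(1)] t_def restrict_apply'[OF eps(1)] by simp
    also have "\<dots> = h2 \<epsilon> \<star> (r \<epsilon> \<star> f1 \<epsilon>)"
      by (rule cmp_assoc[OF G_maps[OF normalD(2)[OF r(1) eps]] G_maps[OF normalD(2)[OF f1(1) eps]]])
    also have "\<dots> = h2 \<epsilon>" using r(2)[OF eps] G_right[OF h2G[OF eps(1)]] by simp
    finally show ?thesis .
  qed
  obtain s where s: "normal k s" "\<And>\<epsilon>. \<epsilon> \<in> vertices k \<Longrightarrow> \<epsilon> \<noteq> {} \<Longrightarrow> s \<epsilon> \<star> q \<epsilon> = u"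
    using normal_inverse[OF q] by blast
  \<comment> \<open>Away from \<open>{}\<close>, \<open>w k\<close> turns
    \<open>z \<epsilon>\<close> into \<open>u (z \<epsilon>) = q \<epsilon> x\<close>, and the
    inverse \<open>s\<close> of \<open>q\<close> brings this to \<open>u x = x\<close>.\<close>
  have "act_family (vertices k) (?c s (w k)) z \<in> F_closure k z"
    by (rule act_family_F_closure[OF P_mul[OF normalD(1)[OF s(1)] w_in_P] zT])
  moreover have "act_family (vertices k) (?c s (w k)) z = (\<lambda>\<epsilon>\<in>vertices k. x)"
  proof (rule restrict_ext)
    fix \<epsilon> assume eps: "\<epsilon> \<in> vertices k"
    show "?c s (w k) \<epsilon> (z \<epsilon>) = x"
    proof (cases "\<epsilon> = {}")
      case True
      then show ?thesis
        using P_empty[OF P_mul[OF normalD(1)[OF s(1)] w_in_P]] x by (simp add: iterate_apply)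
    next
      case False
      have "?c s (w k) \<epsilon> (z \<epsilon>) = s \<epsilon> (u (z \<epsilon>))"
        unfolding family_cmp_apply[OF eps] w_apply[OF eps False] by (rule cmp_apply[OF zT[OF eps]])
      also have "\<dots> = s \<epsilon> (q \<epsilon> x)" by (simp only: h2x[OF eps, symmetric] qe[OF eps False])
      also have "\<dots> = u x" unfolding s(2)[OF eps False, symmetric] by (rule cmp_apply[OF x(1), symmetric])
      finally show ?thesis using x by simp
    qed
  qed
  ultimately show ?thesis by simp
qed

end

text \<open>The members of \<open>L\<close> that fix \<open>x\<close> form a closed subsemigroup, to
  which \<open>ellis_numakura\<close> applies. It is nonempty because the orbit of
  \<open>p x\<close> is dense, so some \<open>q\<close> in the enveloping semigroup takes
  \<open>p x\<close> back to \<open>x\<close>.\<close>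

lemma (in minimal) ellis_unit_exists:
  assumes x: "x \<in> T"
  shows "\<exists>L u. ellis_unit X S L u \<and> u x = x"
proof -
  have ne: "T \<noteq> {}" using x by blast
  interpret E: right_top_semigroup "subtopology maps ellis" "(\<star>)" by (rule ellis_semigroup[OF ne])
  obtain L where L: "E.minimal_left_ideal L" using E.minimal_left_ideal_exists by blast
  have cl: "closedin (subtopology maps ellis) L" and "L \<noteq> {}" using L unfolding E.minimal_left_ideal_def by blast+
  then obtain p where p: "p \<in> L" by blast
  have LE: "L \<subseteq> ellis" using closedin_subset[OF cl] unfolding top_ellis .
  have left: "a \<star> b \<in> L" if "a \<in> ellis" "b \<in> L" for a b
    using L that unfolding E.minimal_left_ideal_def top_ellis by blast
  have pm: "p \<in> topspace maps" using ellis_maps LE p by blast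
  have ev: "continuous_map maps X (\<lambda>q. q y)" if "y \<in> T" for y
    by (rule continuous_map_product_projection[OF that])
  have "X closure_of ((\<lambda>q. q (p x)) ` range iterate) = (\<lambda>q. q (p x)) ` ellis"
    unfolding ellis_def
    by (rule compact_image_closure[OF ev[OF mapsD[OF pm x]] compact_maps Hausdorff, symmetric]) (use iterate_in in blast)
  moreover have "(\<lambda>q. q (p x)) ` range iterate = range (\<lambda>n. act X S n (p x))"
    unfolding image_image using mapsD[OF pm x] by (simp only: iterate_apply)
  ultimately have "x \<in> (\<lambda>q. q (p x)) ` ellis"
    using orbit_dense[OF mapsD[OF pm x]] x by simp
  then obtain q where q: "q \<in> ellis" "q (p x) = x" by (elim imageE) simp
  define K where "K = {a \<in> L. a x = x}"
  have "\<exists>e\<in>K. e \<star> e = e"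
  proof (rule E.ellis_numakura)
    have "closedin maps {a \<in> topspace maps. a x \<in> {x}}"
      by (rule closedin_continuous_map_preimage[OF ev[OF x]]) (simp add: closedin_Hausdorff_singleton Hausdorff x)
    then have "closedin (subtopology maps ellis) (ellis \<inter> {a \<in> topspace maps. a x \<in> {x}})"
      by (rule closedin_subtopology_Int_closed)
    from closedin_Int[OF cl this]
    have "closedin (subtopology maps ellis) (L \<inter> (ellis \<inter> {a \<in> topspace maps. a x \<in> {x}}))" .
    moreover have "L \<inter> (ellis \<inter> {a \<in> topspace maps. a x \<in> {x}}) = K"
      unfolding K_def using LE ellis_maps by blast
    ultimately show "closedin (subtopology maps ellis) K" by simp
    have "q \<star> p \<in> K" unfolding K_def using left[OF q(1) p] q(2) x by (simp add: cmp_apply)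
    then show "K \<noteq> {}" by blast
    fix a b assume "a \<in> K" "b \<in> K"
    then show "a \<star> b \<in> K" unfolding K_def using left LE x by (simp add: cmp_apply subset_iff)
  qed
  then obtain u where u: "u \<in> L" "u x = x" "u \<star> u = u" unfolding K_def by blast
  have "ellis_unit X S L u"
    by (intro ellis_unit.intro ellis_unit_axioms.intro minimal_axioms ne L u)
  with u(2) show ?thesis by blast
qed

theorem (in minimal) Q_diagonal:
  assumes z: "z \<in> Q k" shows "(\<lambda>\<epsilon>\<in>vertices k. z {}) \<in> F_closure k z"
proof -
  have x: "z {} \<in> T" by (rule Q_in[OF z]) simp
  obtain L u where Lu: "ellis_unit X S L u" "u (z {}) = z {}" using ellis_unit_exists[OF x] by blast
  show ?thesis by (rule ellis_unit.diagonal_in_F_closure[OF Lu(1) z x refl Lu(2)])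
qed

section \<open>The regionally proximal relation of infinite order\<close>

context minimal
begin

definition corner :: "nat \<Rightarrow> 'a \<Rightarrow> 'a \<Rightarrow> nat set \<Rightarrow> 'a" where
  "corner k x y = (\<lambda>\<epsilon>\<in>vertices k. if \<epsilon> = {} then x else y)"

lemma Q_lower: assumes "p \<in> Q (Suc k)" shows "(\<lambda>\<epsilon>\<in>vertices k. p \<epsilon>) \<in> Q k"
proof -
  have "linear_cube_map k (Suc k) (\<lambda>\<epsilon>. {i \<in> {1..k}. i \<in> \<epsilon>})"
    by (rule linear_cube_mapI[of k _ "{1..k}" "\<lambda>i. i"]) auto
  from Q_reindex[OF linear_imp_affine[OF this] assms]
  have "(\<lambda>\<epsilon>\<in>vertices k. p {i \<in> {1..k}. i \<in> \<epsilon>}) \<in> Q k" .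
  moreover have "(\<lambda>\<epsilon>\<in>vertices k. p {i \<in> {1..k}. i \<in> \<epsilon>}) = (\<lambda>\<epsilon>\<in>vertices k. p \<epsilon>)"
    by (rule restrict_ext) (rule arg_cong[where f = p], auto)
  ultimately show ?thesis by simp
qed

text \<open>Elements of \<open>F_group k\<close> act trivially at \<open>{}\<close>, so putting
  \<open>a\<close> there commutes with their action and survives the limit.\<close>

lemma Q_move:
  assumes "q \<in> F_closure k p" and corner: "(\<lambda>\<epsilon>\<in>vertices k. if \<epsilon> = {} then a else p \<epsilon>) \<in> Q k"
  shows "(\<lambda>\<epsilon>\<in>vertices k. if \<epsilon> = {} then a else q \<epsilon>) \<in> Q k"
proof (rule F_closure_map[OF assms(1)])
  have a: "a \<in> T" using Q_in[OF corner, of "{}"] by simp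
  show "continuous_map (cube_space k X) (cube_space k X) (\<lambda>q. \<lambda>\<epsilon>\<in>vertices k. if \<epsilon> = {} then a else q \<epsilon>)"
  proof (intro continuous_map_family)
    fix \<epsilon> assume "\<epsilon> \<in> vertices k"
    then show "continuous_map (cube_space k X) X (\<lambda>q. if \<epsilon> = {} then a else q \<epsilon>)"
      using a continuous_map_product_projection[of \<epsilon> "vertices k" "\<lambda>_. X"] by (cases "\<epsilon> = {}") simp_all
  qed
  fix n
  have "(\<lambda>\<epsilon>\<in>vertices k. if \<epsilon> = {} then a else (\<lambda>\<epsilon>\<in>vertices k. act X S (aff 0 n \<epsilon>) (p \<epsilon>)) \<epsilon>) =
    (\<lambda>\<epsilon>\<in>vertices k. act X S (aff 0 n \<epsilon>) ((\<lambda>\<epsilon>\<in>vertices k. if \<epsilon> = {} then a else p \<epsilon>) \<epsilon>))"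
    by (rule restrict_ext) simp
  then show "(\<lambda>\<epsilon>\<in>vertices k. if \<epsilon> = {} then a else (\<lambda>\<epsilon>\<in>vertices k. act X S (aff 0 n \<epsilon>) (p \<epsilon>)) \<epsilon>) \<in> Q k"
    using Q_act[OF corner, of 0 n] by (simp only:)
qed

text \<open>The lower half of the double cube lies over \<open>y\<close>, so it can be moved to the
  diagonal at \<open>y\<close>. Moving both halves in parallel turns the upper half into
  \<open>(x, y, ..., y)\<close>.\<close>

lemma RP_corner:
  assumes "(y, x) \<in> RP k X S"
  shows "corner k x y \<in> Q k"
proof -
  obtain a where a: "double k y x a \<in> Q (Suc k)" using RP_double[OF assms] by (elim exE)
  let ?D = "double k y x a"
  have D: "?D {} = y" "?D {Suc k} = x" by (simp_all add: double_def)
  have xT: "x \<in> T" using Q_in[OF a, of "{Suc k}"] D by simp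
  define z where "z = (\<lambda>\<epsilon>\<in>vertices k. ?D \<epsilon>)"
  have z: "z \<in> Q k" unfolding z_def by (rule Q_lower[OF a])
  have "z {} = y" using D by (simp add: z_def)
  with Q_diagonal[OF z] have y: "(\<lambda>\<epsilon>\<in>vertices k. y) \<in> F_closure k z" by simp
  \<comment> \<open>Both halves are copies of \<open>p\<close>, except for \<open>x\<close> at the
    bottom of the upper half.\<close>
  define g where "g p = (\<lambda>\<epsilon>\<in>vertices (Suc k). if \<epsilon> = {Suc k} then x else p (\<epsilon> - {Suc k}))" for p
  have V: "\<epsilon> - {Suc k} \<in> vertices k" if "\<epsilon> \<in> vertices (Suc k)" for \<epsilon>
    using that by (auto simp: atLeastAtMostSuc_conv)
  have "g (\<lambda>\<epsilon>\<in>vertices k. y) \<in> Q (Suc k)"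
  proof (rule F_closure_map[OF y])
    show "continuous_map (cube_space k X) (cube_space (Suc k) X) g"
      unfolding g_def
    proof (intro continuous_map_family)
      fix \<epsilon> assume e: "\<epsilon> \<in> vertices (Suc k)"
      show "continuous_map (cube_space k X) X (\<lambda>p. if \<epsilon> = {Suc k} then x else p (\<epsilon> - {Suc k}))"
        using xT continuous_map_product_projection[OF V[OF e], of "\<lambda>_. X"] by (cases "\<epsilon> = {Suc k}") simp_all
    qed
    fix n
    \<comment> \<open>Coefficient 0 in direction \<open>Suc k\<close> makes the two halves move in
      parallel and keeps \<open>x\<close> in place at \<open>{Suc k}\<close>.\<close>
    have "g (\<lambda>\<epsilon>\<in>vertices k. act X S (aff 0 n \<epsilon>) (z \<epsilon>)) =
       (\<lambda>\<epsilon>\<in>vertices (Suc k). act X S (aff 0 (n(Suc k := 0)) \<epsilon>) (?D \<epsilon>))"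
      unfolding g_def
    proof (rule restrict_ext)
      fix \<epsilon> assume e: "\<epsilon> \<in> vertices (Suc k)"
      have "sum (n(Suc k := 0)) \<epsilon> = sum (n(Suc k := 0)) (\<epsilon> - {Suc k})"
        using finite_vertex[OF e] by (intro sum.mono_neutral_right) auto
      also have "\<dots> = sum n (\<epsilon> - {Suc k})" by (intro sum.cong) auto
      finally have n: "aff 0 (n(Suc k := 0)) \<epsilon> = aff 0 n (\<epsilon> - {Suc k})" by (simp add: aff_def)
      show "(if \<epsilon> = {Suc k} then x else (\<lambda>\<epsilon>\<in>vertices k. act X S (aff 0 n \<epsilon>) (z \<epsilon>)) (\<epsilon> - {Suc k})) =
         act X S (aff 0 (n(Suc k := 0)) \<epsilon>) (?D \<epsilon>)"
      proof (cases "\<epsilon> = {Suc k}")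
        case True
        then show ?thesis using D by (simp add: aff_def)
      next
        case False
        have "\<epsilon> - {Suc k} \<in> vertices (Suc k)" using e by auto
        then have "?D (\<epsilon> - {Suc k}) = ?D \<epsilon>" using False e by (auto simp: double_def)
        then show ?thesis
          using False V[OF e] unfolding n z_def by (simp only: restrict_apply' if_False)
      qed
    qed
    then show "g (\<lambda>\<epsilon>\<in>vertices k. act X S (aff 0 n \<epsilon>) (z \<epsilon>)) \<in> Q (Suc k)"
      using Q_act[OF a] by (simp only:)
  qed
  from Q_reindex[OF affine_cube_map_upper this]
  have "(\<lambda>\<epsilon>\<in>vertices k. g (\<lambda>\<epsilon>\<in>vertices k. y) (insert (Suc k) \<epsilon>)) \<in> Q k" .
  moreover have "(\<lambda>\<epsilon>\<in>vertices k. g (\<lambda>\<epsilon>\<in>vertices k. y) (insert (Suc k) \<epsilon>)) = corner k x y"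
    unfolding corner_def
  proof (rule restrict_ext)
    fix \<epsilon> assume e: "\<epsilon> \<in> vertices k"
    have i: "insert (Suc k) \<epsilon> \<in> vertices (Suc k)" and n: "Suc k \<notin> \<epsilon>" using e by auto
    have "insert (Suc k) \<epsilon> = {Suc k} \<longleftrightarrow> \<epsilon> = {}" "insert (Suc k) \<epsilon> - {Suc k} = \<epsilon>" using n by auto
    then show "g (\<lambda>\<epsilon>\<in>vertices k. y) (insert (Suc k) \<epsilon>) = (if \<epsilon> = {} then x else y)"
      using i e by (simp only: g_def restrict_apply')
  qed
  ultimately show ?thesis by simp
qed

text \<open>Here \<open>a\<close> is constantly \<open>y\<close>. The loss of one dimension
  disappears in the intersection over all \<open>k\<close>.\<close>

lemma corner_RP:
  assumes "corner (Suc k) x y \<in> Q (Suc k)"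
  shows "(x, y) \<in> RP k X S"
proof -
  have "corner (Suc k) x y = double k x y (\<lambda>_. y)"
    unfolding corner_def double_def by (rule restrict_ext) simp
  then show ?thesis using double_RP assms by simp
qed

text \<open>Reflection in direction \<open>Suc k\<close> exchanges the two blocks of a double
  cube.\<close>

lemma RP_sym: assumes "(x, y) \<in> RP k X S" shows "(y, x) \<in> RP k X S"
proof -
  obtain a where a: "double k x y a \<in> Q (Suc k)" using RP_double[OF assms] by (elim exE)
  have s: "{Suc k} \<in> vertices (Suc k)" by simp
  have "(\<lambda>\<epsilon>\<in>vertices (Suc k). double k x y a ((\<epsilon> - {Suc k}) \<union> ({Suc k} - \<epsilon>))) = double k y x a"
    unfolding double_def
  proof (rule restrict_ext)
    fix \<epsilon> assume e: "\<epsilon> \<in> vertices (Suc k)"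
    have r: "(\<epsilon> - {Suc k}) \<union> ({Suc k} - \<epsilon>) \<in> vertices (Suc k)" using e by auto
    show "(\<lambda>\<epsilon>\<in>vertices (Suc k). if \<epsilon> = {} then x else if \<epsilon> = {Suc k} then y else a (\<epsilon> - {Suc k}))
        ((\<epsilon> - {Suc k}) \<union> ({Suc k} - \<epsilon>)) = (if \<epsilon> = {} then y else if \<epsilon> = {Suc k} then x else a (\<epsilon> - {Suc k}))"
    proof (cases "Suc k \<in> \<epsilon>")
      case True
      then have "(\<epsilon> - {Suc k}) \<union> ({Suc k} - \<epsilon>) = \<epsilon> - {Suc k}" by auto
      then show ?thesis unfolding restrict_apply'[OF r] using True by auto
    next
      case False
      then have "(\<epsilon> - {Suc k}) \<union> ({Suc k} - \<epsilon>) = insert (Suc k) \<epsilon>" "\<epsilon> - {Suc k} = \<epsilon>" by auto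
      then show ?thesis unfolding restrict_apply'[OF r] using False by auto
    qed
  qed
  then show ?thesis using double_RP Q_reindex[OF affine_cube_map_reflection[OF s] a] by simp
qed

lemma RP_inf_iff: "(x, y) \<in> RP_inf X S \<longleftrightarrow> (\<forall>k\<ge>1. corner k x y \<in> Q k)"
proof
  assume "(x, y) \<in> RP_inf X S"
  then have "(x, y) \<in> RP k X S" if "k \<ge> 1" for k
    unfolding RP_inf_def by (rule INT_D) (simp add: that)
  then show "\<forall>k\<ge>1. corner k x y \<in> Q k"
    using RP_corner[OF RP_sym] by simp
next
  assume "\<forall>k\<ge>1. corner k x y \<in> Q k"
  then show "(x, y) \<in> RP_inf X S" unfolding RP_inf_def by (intro INT_I corner_RP) simp
qed

abbreviation "R \<equiv> RP_inf X S"

lemma RP_inf_in: "(x, y) \<in> R \<Longrightarrow> x \<in> T \<and> y \<in> T"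
proof -
  assume "(x, y) \<in> R"
  then have "(x, y) \<in> RP 1 X S" unfolding RP_inf_def by (rule INT_D) simp
  then show ?thesis unfolding RP_def mem_Collect_eq case_prod_conv by (elim conjE) (intro conjI)
qed

lemma RP_inf_sym: "(x, y) \<in> R \<Longrightarrow> (y, x) \<in> R"
  unfolding RP_inf_def by (auto intro: RP_sym)

lemma RP_inf_refl: assumes "x \<in> T" shows "(x, x) \<in> R"
proof -
  have "corner k x x = (\<lambda>\<epsilon>\<in>vertices k. act X S (aff 0 (\<lambda>_. 0) \<epsilon>) x)" for k
    unfolding corner_def by (rule restrict_ext) (simp add: aff_def)
  then show ?thesis unfolding RP_inf_iff using Q_gen[OF assms] by (simp only:) blast
qed

text \<open>The \<open>F\<close>-orbit closure of \<open>(z, y, ..., y)\<close> contains the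
  diagonal at \<open>z\<close>. The same motion with \<open>x\<close> placed at \<open>{}\<close>
  takes \<open>(x, y, ..., y)\<close> to \<open>(x, z, ..., z)\<close>.\<close>

lemma RP_inf_trans: assumes "(x, y) \<in> R" "(y, z) \<in> R" shows "(x, z) \<in> R"
  unfolding RP_inf_iff
proof (intro allI impI)
  fix k :: nat assume k: "k \<ge> 1"
  have zy: "corner k z y \<in> Q k" and xy: "corner k x y \<in> Q k"
    using RP_inf_sym[OF assms(2)] assms(1) k unfolding RP_inf_iff by blast+
  have "(\<lambda>\<epsilon>\<in>vertices k. z) \<in> F_closure k (corner k z y)"
    using Q_diagonal[OF zy] by (simp add: corner_def)
  moreover have "(\<lambda>\<epsilon>\<in>vertices k. if \<epsilon> = {} then x else corner k z y \<epsilon>) = corner k x y"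
    unfolding corner_def by (rule restrict_ext) simp
  ultimately have "(\<lambda>\<epsilon>\<in>vertices k. if \<epsilon> = {} then x else (\<lambda>\<epsilon>\<in>vertices k. z) \<epsilon>) \<in> Q k"
    using Q_move[of "\<lambda>\<epsilon>\<in>vertices k. z" k "corner k z y" x] xy by simp
  moreover have "(\<lambda>\<epsilon>\<in>vertices k. if \<epsilon> = {} then x else (\<lambda>\<epsilon>\<in>vertices k. z) \<epsilon>) = corner k x z"
    unfolding corner_def by (rule restrict_ext) simp
  ultimately show "corner k x z \<in> Q k" by simp
qed

lemma equiv_RP_inf: "equiv T R"
proof -
  have "R \<subseteq> T \<times> T" using RP_inf_in by (intro subrelI) simp
  moreover have "refl_on T R" using RP_inf_refl RP_inf_in by (simp add: refl_on_def)
  moreover have "sym R" by (rule symI, rule RP_inf_sym)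
  moreover have "trans R" by (rule transI, rule RP_inf_trans)
  ultimately show ?thesis by (simp add: equiv_def)
qed

lemma RP_inf_act: assumes "(x, y) \<in> R" shows "(act X S n x, act X S n y) \<in> R"
  unfolding RP_inf_iff
proof (intro allI impI)
  fix k :: nat assume "k \<ge> 1"
  then have "corner k x y \<in> Q k" using assms unfolding RP_inf_iff by blast
  from Q_act[OF this, of n "\<lambda>_. 0"]
  have "(\<lambda>\<epsilon>\<in>vertices k. act X S (aff n (\<lambda>_. 0) \<epsilon>) (corner k x y \<epsilon>)) \<in> Q k" .
  moreover have "(\<lambda>\<epsilon>\<in>vertices k. act X S (aff n (\<lambda>_. 0) \<epsilon>) (corner k x y \<epsilon>)) = corner k (act X S n x) (act X S n y)"
    unfolding corner_def by (rule restrict_ext) (simp add: aff_def)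
  ultimately show "corner k (act X S n x) (act X S n y) \<in> Q k" by simp
qed

lemma RP_inf_closed: "closedin (prod_topology X X) R"
proof -
  have "R = (\<Inter>k\<in>{1..}. {xy \<in> topspace (prod_topology X X). corner k (fst xy) (snd xy) \<in> Q k})"
    using RP_inf_in by (auto simp: RP_inf_iff)
  moreover have "closedin (prod_topology X X) {xy \<in> topspace (prod_topology X X). corner k (fst xy) (snd xy) \<in> Q k}" for k
  proof (rule closedin_continuous_map_preimage[OF _ closedin_Q])
    show "continuous_map (prod_topology X X) (cube_space k X) (\<lambda>xy. corner k (fst xy) (snd xy))"
      unfolding corner_def
    proof (intro continuous_map_family)
      fix \<epsilon>
      show "continuous_map (prod_topology X X) X (\<lambda>p. if \<epsilon> = {} then fst p else snd p)"
        by (cases "\<epsilon> = {}") (simp_all add: continuous_map_fst continuous_map_snd)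
    qed
  qed
  ultimately show ?thesis by (simp only:) (intro closedin_Inter, auto)
qed

section \<open>Cubes with entries in one class\<close>

text \<open>Separability comes from a dense orbit: the balls of radius \<open>1/(m+1)\<close> around
  its points form a base.\<close>

lemma countable_base:
  assumes "metrizable_space X"
  obtains \<B> where "countable \<B>" "\<And>B. B \<in> \<B> \<Longrightarrow> openin X B"
    "\<And>U x. openin X U \<Longrightarrow> x \<in> U \<Longrightarrow> \<exists>B\<in>\<B>. x \<in> B \<and> B \<subseteq> U"
proof (cases "T = {}")
  case True
  then have "\<exists>B\<in>{{}}. x \<in> B \<and> B \<subseteq> U" if "openin X U" "x \<in> U" for U x
    using openin_subset[OF that(1)] that(2) by blast
  then show ?thesis by (intro that[of "{{}}"]) auto
next
  case False
  then obtain x0 where x0: "x0 \<in> T" by blast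
  obtain M d where M: "Metric_space M d" and X: "X = Metric_space.mtopology M d"
    using assms unfolding metrizable_space_def by blast
  interpret Metric_space M d by (rule M)
  define \<B> where "\<B> = (\<lambda>(n, m). mball (act X S n x0) (inverse (Suc m))) ` (UNIV :: (int \<times> nat) set)"
  have TM: "T = M" unfolding X by simp
  have "\<exists>B\<in>\<B>. x \<in> B \<and> B \<subseteq> U" if U: "openin X U" and x: "x \<in> U" for U x
  proof -
    obtain r where r: "r > 0" "mball x r \<subseteq> U" using U x unfolding X openin_mtopology by blast
    obtain m where m: "inverse (real (Suc m)) < r / 2" using reals_Archimedean[of "r / 2"] r(1) by auto
    have xM: "x \<in> M" using U x unfolding X openin_mtopology by blast
    have op: "openin X (mball x (inverse (Suc m)))" unfolding X by simp
    obtain n where n: "act X S n x0 \<in> mball x (inverse (Suc m))"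
      using orbit_meets[OF x0 op] xM by fastforce
    let ?B = "mball (act X S n x0) (inverse (Suc m))"
    have "x \<in> ?B" using n by (simp add: commute)
    moreover have "?B \<subseteq> mball x r"
    proof
      fix y assume y: "y \<in> ?B"
      have "d x y \<le> d x (act X S n x0) + d (act X S n x0) y"
        using y n by (intro triangle) auto
      then show "y \<in> mball x r" using y n m by auto
    qed
    moreover have "?B \<in> \<B>" unfolding \<B>_def by (rule image_eqI[of _ _ "(n, m)"]) simp_all
    ultimately show ?thesis using r(2) by blast
  qed
  moreover have "openin X B" if "B \<in> \<B>" for B using that unfolding \<B>_def X by auto
  moreover have "countable \<B>" unfolding \<B>_def by simp
  ultimately show ?thesis by (intro that[of \<B>]) auto
qed

text \<open>The point is a point of continuity of the lower semicontinuous maps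
  \<open>x \<mapsto> F_closure k x\<^sup>[\<^sup>k\<^sup>]\<close>, for all \<open>k\<close> at once.\<close>

lemma generic_point:
  assumes "metrizable_space X" and ne: "T \<noteq> {}"
  shows "\<exists>x0\<in>T. \<forall>k. \<forall>z\<in>Q k. z {} = x0 \<longrightarrow> z \<in> F_closure k (\<lambda>\<epsilon>\<in>vertices k. x0)"
proof -
  obtain \<B> where \<B>: "countable \<B>" "\<And>B. B \<in> \<B> \<Longrightarrow> openin X B"
    "\<And>U x. openin X U \<Longrightarrow> x \<in> U \<Longrightarrow> \<exists>B\<in>\<B>. x \<in> B \<and> B \<subseteq> U"
    by (rule countable_base[OF assms(1)]) (rule that)
  \<comment> \<open>One countable index set covers all dimensions, so a single Baire argument yields
    one point for every \<open>k\<close>.\<close>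
  define I where "I = (SIGMA k:UNIV. (vertices k \<rightarrow>\<^sub>E \<B>))"
  have cI: "countable I" unfolding I_def using \<B>(1) by (intro countable_SIGMA countable_PiE) auto
  \<comment> \<open>Points whose diagonal has an \<open>F\<close>-translate in the given basic
    box.\<close>
  define O' where "O' kb = (\<Union>n. \<Inter>\<epsilon>\<in>vertices (fst kb). {x \<in> T. act X S (aff 0 n \<epsilon>) x \<in> snd kb \<epsilon>})"
    for kb :: "nat \<times> (nat set \<Rightarrow> 'a set)"
  have openO: "openin X (O' kb)" if "kb \<in> I" for kb
    unfolding O'_def
  proof (intro openin_Union ballI, elim imageE)
    fix U n assume U: "U = (\<Inter>\<epsilon>\<in>vertices (fst kb). {x \<in> T. act X S (aff 0 n \<epsilon>) x \<in> snd kb \<epsilon>})"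
    show "openin X U"
      unfolding U
    proof (rule openin_INT2)
      fix \<epsilon> assume "\<epsilon> \<in> vertices (fst kb)"
      moreover have "snd kb \<in> vertices (fst kb) \<rightarrow>\<^sub>E \<B>" using that unfolding I_def by (elim SigmaE) simp
      ultimately have "openin X (snd kb \<epsilon>)" using \<B>(2) PiE_mem by metis
      then show "openin X {x \<in> T. act X S (aff 0 n \<epsilon>) x \<in> snd kb \<epsilon>}"
        by (rule openin_continuous_map_preimage[OF continuous_act])
    qed auto
  qed
  \<comment> \<open>Adding the exterior makes the set dense; a point of \<open>D kb\<close> in the
    closure of \<open>O' kb\<close> must belong to \<open>O' kb\<close>.\<close>
  define D where "D kb = O' kb \<union> (T - X closure_of O' kb)" for kb
  have "X closure_of \<Inter>(D ` I) = T"
  proof (rule Baire_category)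
    show "completely_metrizable_space X \<or> locally_compact_space X \<and> regular_space X"
      using compact Hausdorff by (simp add: compact_imp_locally_compact_space compact_Hausdorff_imp_regular_space)
    show "countable (D ` I)" using cI by simp
    fix U assume "U \<in> D ` I"
    then obtain kb where kb: "kb \<in> I" "U = D kb" by blast
    have "X closure_of U = T"
    proof (intro equalityI closure_of_subset_topspace subsetI)
      fix x assume x: "x \<in> T"
      show "x \<in> X closure_of U"
      proof (cases "x \<in> X closure_of O' kb")
        case True
        then show ?thesis using closure_of_mono[of "O' kb" U X] kb by (auto simp: D_def)
      next
        case False
        then show ?thesis using closure_of_subset[of U X] x kb openin_subset[OF openO[OF kb(1)]] by (auto simp: D_def)
      qed
    qed
    then show "openin X U \<and> X closure_of U = T"
      using openO[OF kb(1)] kb by (auto simp: D_def intro!: openin_Un openin_diff)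
  qed
  then have "T \<inter> \<Inter>(D ` I) \<noteq> {}"
    using ne by (metis closure_of_restrict closure_of_empty)
  then obtain x0 where x0: "x0 \<in> T" "\<And>kb. kb \<in> I \<Longrightarrow> x0 \<in> D kb" by blast
  have "z \<in> F_closure k (\<lambda>\<epsilon>\<in>vertices k. x0)" if z: "z \<in> Q k" "z {} = x0" for k z
    unfolding F_closure_def in_closure_of
  proof (intro conjI allI impI)
    show zt: "z \<in> topspace (cube_space k X)" by (rule subsetD[OF Q_subset z(1)])
    fix W assume W: "z \<in> W \<and> openin (cube_space k X) W"
    then have W': "openin (cube_space k X) W" "z \<in> W" by simp_all
    obtain U where U: "\<And>\<epsilon>. \<epsilon> \<in> vertices k \<Longrightarrow> openin X (U \<epsilon>)" "z \<in> Pi\<^sub>E (vertices k) U" "Pi\<^sub>E (vertices k) U \<subseteq> W"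
      by (rule product_neighbourhood[OF W']) (rule that)
    have "\<forall>\<epsilon>\<in>vertices k. \<exists>B\<in>\<B>. z \<epsilon> \<in> B \<and> B \<subseteq> U \<epsilon>"
      using \<B>(3)[OF U(1) PiE_mem[OF U(2)]] by (rule ballI)
    then obtain b where b: "\<And>\<epsilon>. \<epsilon> \<in> vertices k \<Longrightarrow> b \<epsilon> \<in> \<B> \<and> z \<epsilon> \<in> b \<epsilon> \<and> b \<epsilon> \<subseteq> U \<epsilon>" by metis
    define kb where "kb = (k, restrict b (vertices k))"
    have kb: "kb \<in> I" using b by (auto simp: I_def kb_def)
    have mem: "x \<in> O' kb \<longleftrightarrow> x \<in> T \<and> (\<exists>n. \<forall>\<epsilon>\<in>vertices k. act X S (aff 0 n \<epsilon>) x \<in> b \<epsilon>)" for x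
      unfolding O'_def kb_def by auto
    have "x0 \<in> X closure_of O' kb"
      unfolding in_closure_of
    proof (intro conjI allI impI x0(1))
      fix N assume N: "x0 \<in> N \<and> openin X N"
      \<comment> \<open>The box is cut down to \<open>N\<close> at \<open>{}\<close>, where
        \<open>F\<close>-elements act trivially, so the base point of the approximating cube is
        forced into \<open>N\<close>.\<close>
      define B where "B \<epsilon> = (if \<epsilon> = {} then b \<epsilon> \<inter> N else b \<epsilon>)" for \<epsilon>
      have "openin (cube_space k X) (Pi\<^sub>E (vertices k) B)"
      proof -
        have "openin X (B \<epsilon>)" if "\<epsilon> \<in> vertices k" for \<epsilon>
          using conjunct2[OF N] \<B>(2)[OF conjunct1[OF b[OF that]]] by (cases "\<epsilon> = {}") (simp_all add: B_def openin_Int)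
        moreover have "finite (vertices k)" by simp
        ultimately show ?thesis by (simp add: openin_PiE_gen)
      qed
      moreover have "z \<in> Pi\<^sub>E (vertices k) B"
        using zt b N z(2) by (auto simp: B_def PiE_iff)
      ultimately obtain p where p: "p \<in> {\<lambda>\<epsilon>\<in>vertices k. act X S (aff j n \<epsilon>) x |j n x. x \<in> T}" "p \<in> Pi\<^sub>E (vertices k) B"
        by (rule closure_meets[OF z(1)[unfolded Q_eq]])
      from p(1) obtain j n x where x: "x \<in> T" "p = (\<lambda>\<epsilon>\<in>vertices k. act X S (aff j n \<epsilon>) x)"
        by (elim CollectE exE conjE)
      have "act X S (aff 0 n \<epsilon>) (act X S j x) \<in> B \<epsilon>" if "\<epsilon> \<in> vertices k" for \<epsilon>
      proof -
        have "p \<epsilon> \<in> B \<epsilon>" by (rule PiE_mem[OF p(2) that])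
        moreover have "aff j n \<epsilon> = aff 0 n \<epsilon> + j" by (simp add: aff_def)
        ultimately show ?thesis using x that act_add[OF x(1)] by simp
      qed
      then have *: "\<forall>\<epsilon>\<in>vertices k. act X S (aff 0 n \<epsilon>) (act X S j x) \<in> B \<epsilon>" by blast
      then have "act X S j x \<in> O' kb" unfolding mem
      proof (intro conjI exI ballI act_in x(1))
        fix \<epsilon> assume "\<epsilon> \<in> vertices k"
        then have "act X S (aff 0 n \<epsilon>) (act X S j x) \<in> B \<epsilon>" using * by (rule bspec[rotated])
        then show "act X S (aff 0 n \<epsilon>) (act X S j x) \<in> b \<epsilon>" by (simp add: B_def split: if_splits)
      qed
      moreover have "act X S j x \<in> N" using *[rule_format, of "{}"] by (simp add: B_def)
      ultimately show "\<exists>y. y \<in> O' kb \<and> y \<in> N" by blast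
    qed
    then have "x0 \<in> O' kb" using x0(2)[OF kb] by (simp add: D_def)
    then obtain n where n: "\<forall>\<epsilon>\<in>vertices k. act X S (aff 0 n \<epsilon>) x0 \<in> b \<epsilon>" unfolding mem by blast
    have "(\<lambda>\<epsilon>\<in>vertices k. act X S (aff 0 n \<epsilon>) ((\<lambda>\<epsilon>\<in>vertices k. x0) \<epsilon>)) \<in> W"
    proof (rule subsetD[OF U(3)])
      show "(\<lambda>\<epsilon>\<in>vertices k. act X S (aff 0 n \<epsilon>) ((\<lambda>\<epsilon>\<in>vertices k. x0) \<epsilon>)) \<in> Pi\<^sub>E (vertices k) U"
        unfolding restrict_PiE_iff using n b by (intro ballI) (simp del: Pow_iff, blast)
    qed
    then show "\<exists>y. y \<in> range (\<lambda>n. \<lambda>\<epsilon>\<in>vertices k. act X S (aff 0 n \<epsilon>) ((\<lambda>\<epsilon>\<in>vertices k. x0) \<epsilon>)) \<and> y \<in> W"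
      by (rule exI[of _ "\<lambda>\<epsilon>\<in>vertices k. act X S (aff 0 n \<epsilon>) ((\<lambda>\<epsilon>\<in>vertices k. x0) \<epsilon>)", OF conjI, rotated])
        (rule range_eqI[of _ _ n], rule refl)
  qed
  then show ?thesis using x0(1) by blast
qed

text \<open>A coordinate still equal to \<open>x0\<close> is brought to \<open>{}\<close> by a
  reflection. There the cube is a limit of \<open>F\<close>-translates of the diagonal, and the same
  translates of \<open>(a, x0, ..., x0)\<close> put \<open>a\<close> in that place. Induction starts
  at the diagonal, so each coordinate is \<open>x0\<close> until its turn comes.\<close>

lemma class_cubes:
  assumes gen: "\<forall>z\<in>Q k. z {} = x0 \<longrightarrow> z \<in> F_closure k (\<lambda>\<epsilon>\<in>vertices k. x0)" and x0: "x0 \<in> T" and k: "k \<ge> 1"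
    and p: "p \<in> topspace (cube_space k X)" "\<And>\<epsilon>. \<epsilon> \<in> vertices k \<Longrightarrow> (x0, p \<epsilon>) \<in> R"
  shows "p \<in> Q k"
proof -
  have step0: "(\<lambda>\<epsilon>\<in>vertices k. if \<epsilon> = {} then a else z \<epsilon>) \<in> Q k"
    if z: "z \<in> Q k" "z {} = x0" and a: "(x0, a) \<in> R" for z a
  proof (rule Q_move)
    show "z \<in> F_closure k (\<lambda>\<epsilon>\<in>vertices k. x0)" using gen z by blast
    have "(\<lambda>\<epsilon>\<in>vertices k. if \<epsilon> = {} then a else (\<lambda>\<epsilon>\<in>vertices k. x0) \<epsilon>) = corner k a x0"
      unfolding corner_def by (rule restrict_ext) simp
    then show "(\<lambda>\<epsilon>\<in>vertices k. if \<epsilon> = {} then a else (\<lambda>\<epsilon>\<in>vertices k. x0) \<epsilon>) \<in> Q k"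
      using RP_inf_sym[OF a] k unfolding RP_inf_iff by simp
  qed
  have step: "(\<lambda>\<epsilon>\<in>vertices k. if \<epsilon> = \<eta> then a else z \<epsilon>) \<in> Q k"
    if z: "z \<in> Q k" "z \<eta> = x0" and a: "(x0, a) \<in> R" and eta: "\<eta> \<in> vertices k" for z a \<eta>
  proof -
    define s where "s \<epsilon> = (\<epsilon> - \<eta>) \<union> (\<eta> - \<epsilon>)" for \<epsilon>
    have s: "affine_cube_map k k s" unfolding s_def by (rule affine_cube_map_reflection[OF eta])
    have sV: "s \<epsilon> \<in> vertices k" if "\<epsilon> \<in> vertices k" for \<epsilon> using that eta by (auto simp: s_def)
    have ss: "s (s \<epsilon>) = \<epsilon>" and s0: "s {} = \<eta>" and se: "s \<epsilon> = {} \<longleftrightarrow> \<epsilon> = \<eta>" for \<epsilon> by (auto simp: s_def)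
    have z1: "(\<lambda>\<epsilon>\<in>vertices k. z (s \<epsilon>)) \<in> Q k" by (rule Q_reindex[OF s z(1)])
    have "(\<lambda>\<epsilon>\<in>vertices k. if \<epsilon> = {} then a else (\<lambda>\<epsilon>\<in>vertices k. z (s \<epsilon>)) \<epsilon>) \<in> Q k"
      by (rule step0[OF z1 _ a]) (simp add: s0 z)
    from Q_reindex[OF s this]
    have "(\<lambda>\<epsilon>\<in>vertices k. (\<lambda>\<epsilon>\<in>vertices k. if \<epsilon> = {} then a else (\<lambda>\<epsilon>\<in>vertices k. z (s \<epsilon>)) \<epsilon>) (s \<epsilon>)) \<in> Q k" .
    moreover have "(\<lambda>\<epsilon>\<in>vertices k. (\<lambda>\<epsilon>\<in>vertices k. if \<epsilon> = {} then a else (\<lambda>\<epsilon>\<in>vertices k. z (s \<epsilon>)) \<epsilon>) (s \<epsilon>)) =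
       (\<lambda>\<epsilon>\<in>vertices k. if \<epsilon> = \<eta> then a else z \<epsilon>)"
    proof (rule restrict_ext)
      fix \<epsilon> assume "\<epsilon> \<in> vertices k"
      then show "(\<lambda>\<epsilon>\<in>vertices k. if \<epsilon> = {} then a else (\<lambda>\<epsilon>\<in>vertices k. z (s \<epsilon>)) \<epsilon>) (s \<epsilon>) = (if \<epsilon> = \<eta> then a else z \<epsilon>)"
        using sV by (simp only: restrict_apply' se ss)
    qed
    ultimately show ?thesis by simp
  qed
  have "(\<lambda>\<epsilon>\<in>vertices k. if \<epsilon> \<in> V then p \<epsilon> else x0) \<in> Q k" if "finite V" "V \<subseteq> vertices k" for V
    using that
  proof (induction V rule: finite_induct)
    case empty
    have "(\<lambda>\<epsilon>\<in>vertices k. if \<epsilon> \<in> {} then p \<epsilon> else x0) = (\<lambda>\<epsilon>\<in>vertices k. act X S (aff 0 (\<lambda>_. 0) \<epsilon>) x0)"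
      by (rule restrict_ext) (simp add: aff_def)
    then show ?case using Q_gen[OF x0] by (simp only:)
  next
    case (insert \<eta> V)
    have eta: "\<eta> \<in> vertices k" and V: "V \<subseteq> vertices k" using insert.prems by (simp_all del: Pow_iff)
    have "(\<lambda>\<epsilon>\<in>vertices k. if \<epsilon> = \<eta> then p \<eta> else (\<lambda>\<epsilon>\<in>vertices k. if \<epsilon> \<in> V then p \<epsilon> else x0) \<epsilon>) \<in> Q k"
      by (rule step[OF insert.IH[OF V] _ p(2)[OF eta] eta]) (use eta insert.hyps in \<open>simp del: Pow_iff\<close>)
    moreover have "(\<lambda>\<epsilon>\<in>vertices k. if \<epsilon> = \<eta> then p \<eta> else (\<lambda>\<epsilon>\<in>vertices k. if \<epsilon> \<in> V then p \<epsilon> else x0) \<epsilon>) =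
      (\<lambda>\<epsilon>\<in>vertices k. if \<epsilon> \<in> insert \<eta> V then p \<epsilon> else x0)"
      by (rule restrict_ext) simp
    ultimately show ?case by (simp only:)
  qed
  from this[of "vertices k"] have "(\<lambda>\<epsilon>\<in>vertices k. if \<epsilon> \<in> vertices k then p \<epsilon> else x0) \<in> Q k" by simp
  moreover have "(\<lambda>\<epsilon>\<in>vertices k. if \<epsilon> \<in> vertices k then p \<epsilon> else x0) = p"
    using p(1) by (auto simp: PiE_iff extensional_def fun_eq_iff restrict_def)
  ultimately show ?thesis by simp
qed

end

section \<open>Constructions of systems\<close>

lemma dyn_systemI:
  assumes "compact_space X" "Hausdorff_space X" "continuous_map X X f" "continuous_map X X g"
    "\<And>x. x \<in> topspace X \<Longrightarrow> g (f x) = x" "\<And>x. x \<in> topspace X \<Longrightarrow> f (g x) = x"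
  shows "dyn_system X f"
proof -
  have "homeomorphic_maps X X f g" using assms(3-6) by (simp add: homeomorphic_maps_def)
  then show ?thesis using assms(1,2) unfolding dyn_system_def homeomorphic_map_maps by blast
qed

lemma dyn_system_prod:
  assumes "dyn_system X S" "dyn_system Y R"
  shows "dyn_system (prod_topology X Y) (map_prod S R)"
proof -
  interpret X: dyn X S by unfold_locales (rule assms)
  interpret Y: dyn Y R by unfold_locales (rule assms)
  have c: "continuous_map (prod_topology X Y) (prod_topology X Y) (map_prod f g)"
    if "continuous_map X X f" "continuous_map Y Y g" for f g
    using that by (simp add: map_prod_def continuous_map_prod_top)
  show ?thesis
  proof (rule dyn_systemI)
    show "compact_space (prod_topology X Y)" "Hausdorff_space (prod_topology X Y)"
      by (simp_all add: compact_space_prod_topology Hausdorff_space_prod_topology X.compact Y.compact X.Hausdorff Y.Hausdorff)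
    show "continuous_map (prod_topology X Y) (prod_topology X Y) (map_prod S R)"
      by (intro c X.continuous_S Y.continuous_S)
    show "continuous_map (prod_topology X Y) (prod_topology X Y) (map_prod (inv_into X.T S) (inv_into Y.T R))"
      by (intro c X.continuous_inv Y.continuous_inv)
  qed auto
qed

lemma act_prod:
  assumes "dyn_system X S" "dyn_system Y R" "x \<in> topspace X" "y \<in> topspace Y"
  shows "act (prod_topology X Y) (map_prod S R) n (x, y) = (act X S n x, act Y R n y)"
proof -
  have "fst (act (prod_topology X Y) (map_prod S R) n (x, y)) = act X S n (fst (x, y))"
    by (rule equivariant_act[OF dyn_system_prod[OF assms(1,2)] assms(1)]) (use assms in auto)
  moreover have "snd (act (prod_topology X Y) (map_prod S R) n (x, y)) = act Y R n (snd (x, y))"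
    by (rule equivariant_act[OF dyn_system_prod[OF assms(1,2)] assms(2)]) (use assms in auto)
  ultimately show ?thesis by (simp add: prod_eq_iff)
qed

lemma dyn_system_sub:
  assumes X: "dyn_system X S" and K: "closedin X K" "\<And>x n. x \<in> K \<Longrightarrow> act X S n x \<in> K"
  shows "dyn_system (subtopology X K) S"
proof -
  interpret X: dyn X S by unfold_locales (rule X)
  have sub: "K \<subseteq> X.T" by (rule closedin_subset[OF K(1)])
  then have top: "topspace (subtopology X K) = K" by auto
  have c: "continuous_map (subtopology X K) (subtopology X K) (act X S n)" for n
    using K(2) sub by (intro continuous_map_into_subtopology continuous_map_from_subtopology X.continuous_act) auto
  have "dyn_system (subtopology X K) (act X S 1)"
  proof (rule dyn_systemI)
    show "compact_space (subtopology X K)"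
      using K(1) X.compact by (simp add: closedin_compact_space compact_space_subtopology)
    show "Hausdorff_space (subtopology X K)" by (rule Hausdorff_space_subtopology[OF X.Hausdorff])
    fix x assume "x \<in> topspace (subtopology X K)"
    then have "x \<in> X.T" using sub by auto
    then show "act X S (- 1) (act X S 1 x) = x" "act X S 1 (act X S (- 1) x) = x"
      by simp_all
  qed (rule c)+
  moreover have "act X S 1 = S" by (rule ext, rule X.act_1)
  ultimately show ?thesis by simp
qed

lemma act_sub:
  assumes "dyn_system X S" "dyn_system (subtopology X K) S" "x \<in> topspace (subtopology X K)"
  shows "act (subtopology X K) S n x = act X S n x"
  using equivariant_act[OF assms(2,1), of "\<lambda>x. x" x n] assms(3) by auto

lemma (in dyn) orbit_closure_invariant:
  assumes "x \<in> X closure_of range (\<lambda>n. act X S n y)" "y \<in> T"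
  shows "act X S m x \<in> X closure_of range (\<lambda>n. act X S n y)"
proof (rule continuous_map_closure_mem[OF continuous_act assms(1) _ closedin_closure_of])
  fix a assume "a \<in> range (\<lambda>n. act X S n y)"
  then obtain n where "act X S m a = act X S (m + n) y" using act_add[OF assms(2)] by (elim rangeE) simp
  then show "act X S m a \<in> X closure_of range (\<lambda>n. act X S n y)"
    using subsetD[OF closure_of_subset[of "range (\<lambda>n. act X S n y)" X]] act_in[OF assms(2)] by (simp add: image_subset_iff)
qed

section \<open>The hyperspace of closed subsets\<close>

definition closed_sets :: "'a topology \<Rightarrow> 'a set set" where
  "closed_sets X = {A. closedin X A \<and> A \<noteq> {}}"

text \<open>Hit sets and containment sets, over arbitrary \<open>A\<close>; the restriction to
  nonempty closed sets is made in \<open>vietoris\<close>.\<close>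

definition vietoris_subbase :: "'a topology \<Rightarrow> 'a set set set" where
  "vietoris_subbase X = {{A. A \<inter> U \<noteq> {}} | U. openin X U} \<union> {{A. A \<subseteq> U} | U. openin X U}"

definition vietoris :: "'a topology \<Rightarrow> 'a set topology" where
  "vietoris X = topology (arbitrary union_of
     (finite intersection_of (\<lambda>W. W \<in> vietoris_subbase X) relative_to closed_sets X))"

lemma topspace_vietoris [simp]: "topspace (vietoris X) = closed_sets X"
  by (simp add: vietoris_def)

lemma openin_vietoris_subbase:
  assumes "W \<in> vietoris_subbase X"
  shows "openin (vietoris X) (closed_sets X \<inter> W)"
  unfolding vietoris_def openin_subbase
  by (intro arbitrary_union_of_inc relative_to_inc finite_intersection_of_inc assms)

lemma openin_hit: assumes "openin X U" shows "openin (vietoris X) {A \<in> closed_sets X. A \<inter> U \<noteq> {}}"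
proof -
  have "{A. A \<inter> U \<noteq> {}} \<in> vietoris_subbase X" unfolding vietoris_subbase_def using assms by blast
  from openin_vietoris_subbase[OF this] show ?thesis by (simp add: Collect_conj_eq)
qed

lemma openin_inside: assumes "openin X U" shows "openin (vietoris X) {A \<in> closed_sets X. A \<subseteq> U}"
proof -
  have "{A. A \<subseteq> U} \<in> vietoris_subbase X" unfolding vietoris_subbase_def using assms by blast
  from openin_vietoris_subbase[OF this] show ?thesis by (simp add: Collect_conj_eq)
qed

text \<open>By the Alexander subbase theorem. Let \<open>K\<close> be the part of \<open>X\<close>
  not covered by the open sets of the hit sets in the cover. If nonempty, it belongs to none of
  these hit sets and so to some \<open>{A. A \<subseteq> V}\<close> of the cover. Finitely many of
  those open sets together with \<open>V\<close> cover \<open>X\<close>, and a closed set meeting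
  none of the former lies in \<open>V\<close>.\<close>

lemma compact_vietoris:
  assumes "compact_space X" shows "compact_space (vietoris X)"
proof (rule Alexander_subbase_alt[OF _ _ vietoris_def[symmetric]])
  have "{A. A \<subseteq> topspace X} \<in> vietoris_subbase X" unfolding vietoris_subbase_def by blast
  then show "closed_sets X \<subseteq> \<Union>(vietoris_subbase X)"
    using closedin_subset unfolding closed_sets_def by blast
  fix C assume C: "C \<subseteq> vietoris_subbase X" "closed_sets X \<subseteq> \<Union>C"
  define \<U> where "\<U> = {U. openin X U \<and> {A. A \<inter> U \<noteq> {}} \<in> C}"
  define K where "K = topspace X - \<Union>\<U>"
  have opU: "\<And>U. U \<in> \<U> \<Longrightarrow> openin X U" by (simp add: \<U>_def)
  \<comment> \<open>For \<open>K = {}\<close> the choice \<open>V = {}\<close> stands for having no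
    containment set; a nonempty \<open>A\<close> is never inside it.\<close>
  have "\<exists>V. openin X V \<and> K \<subseteq> V \<and> (K = {} \<and> V = {} \<or> {A. A \<subseteq> V} \<in> C)"
  proof (cases "K = {}")
    case True
    then show ?thesis using openin_empty by blast
  next
    case False
    have "closedin X K" unfolding K_def using opU by (intro closedin_diff closedin_topspace openin_Union) auto
    then have "K \<in> closed_sets X" using False by (simp add: closed_sets_def)
    then obtain W where W: "W \<in> C" "K \<in> W" using C(2) by blast
    moreover have "W \<in> vietoris_subbase X" using C(1) W(1) by blast
    ultimately obtain V where "openin X V" "K \<subseteq> V" "W = {A. A \<subseteq> V}"
      unfolding vietoris_subbase_def by (auto simp: K_def \<U>_def)
    then show ?thesis using W(1) by blast
  qed
  then obtain V where V: "openin X V" "K \<subseteq> V" "K = {} \<and> V = {} \<or> {A. A \<subseteq> V} \<in> C" by blast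
  have "topspace X \<subseteq> \<Union>(insert V \<U>)" using V(2) unfolding K_def by blast
  moreover have "\<forall>U\<in>insert V \<U>. openin X U" using V(1) opU by blast
  ultimately obtain F where F: "finite F" "F \<subseteq> insert V \<U>" "topspace X \<subseteq> \<Union>F"
    using assms unfolding compact_space_alt by (metis (no_types, lifting))
  define C' where "C' = (\<lambda>U. {A. A \<inter> U \<noteq> {}}) ` (F \<inter> \<U>) \<union> ({{A. A \<subseteq> V}} \<inter> C)"
  show "\<exists>C'. finite C' \<and> C' \<subseteq> C \<and> closed_sets X \<subseteq> \<Union>C'"
  proof (intro exI conjI)
    show "finite C'" using F(1) by (simp add: C'_def)
    show "C' \<subseteq> C" by (auto simp: C'_def \<U>_def)
    show "closed_sets X \<subseteq> \<Union>C'"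
    proof
      fix A assume A: "A \<in> closed_sets X"
      then have AT: "A \<subseteq> topspace X" "A \<noteq> {}" using closedin_subset by (auto simp: closed_sets_def)
      show "A \<in> \<Union>C'"
      proof (cases "\<exists>U\<in>F \<inter> \<U>. A \<inter> U \<noteq> {}")
        case True
        then show ?thesis by (auto simp: C'_def)
      next
        case False
        have AV: "A \<subseteq> V"
        proof
          fix a assume a: "a \<in> A"
          then obtain U where U: "U \<in> F" "a \<in> U" using AT(1) F(3) by blast
          then have "U \<notin> \<U>" using False a by blast
          then show "a \<in> V" using U F(2) by blast
        qed
        then have "{A. A \<subseteq> V} \<in> C" using V(3) AT(2) by blast
        then show ?thesis using AV by (auto simp: C'_def)
      qed
    qed
  qed
qed

text \<open>A point of one set outside the other is separated from that compact set; hitting the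
  first neighbourhood excludes being inside the second.\<close>

lemma Hausdorff_vietoris:
  assumes "compact_space X" "Hausdorff_space X" shows "Hausdorff_space (vietoris X)"
proof -
  have *: "\<exists>U V. openin (vietoris X) U \<and> openin (vietoris X) V \<and> A \<in> U \<and> B \<in> V \<and> disjnt U V"
    if AB: "A \<in> closed_sets X" "B \<in> closed_sets X" and a: "a \<in> A" "a \<notin> B" for A B a
  proof -
    have "a \<in> topspace X" using AB(1) a(1) closedin_subset by (auto simp: closed_sets_def)
    moreover have "compactin X B" using AB(2) assms(1) by (simp add: closed_sets_def closedin_compact_space)
    ultimately obtain U V where UV: "openin X U" "openin X V" "{a} \<subseteq> U" "B \<subseteq> V" "disjnt U V"
      using Hausdorff_space_compact_separation[OF assms(2), of "{a}" B] a(2) by auto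
    have "A \<in> {A \<in> closed_sets X. A \<inter> U \<noteq> {}}" "B \<in> {A \<in> closed_sets X. A \<subseteq> V}"
      using AB a UV by auto
    moreover have "disjnt {A \<in> closed_sets X. A \<inter> U \<noteq> {}} {A \<in> closed_sets X. A \<subseteq> V}"
      using UV(5) by (auto simp: disjnt_def)
    ultimately show ?thesis using openin_hit[OF UV(1)] openin_inside[OF UV(2)] by blast
  qed
  show ?thesis
    unfolding Hausdorff_space_def topspace_vietoris
  proof (intro allI impI)
    fix A B assume AB: "A \<in> closed_sets X \<and> B \<in> closed_sets X \<and> A \<noteq> B"
    then consider a where "a \<in> A" "a \<notin> B" | a where "a \<in> B" "a \<notin> A" by blast
    then show "\<exists>U V. openin (vietoris X) U \<and> openin (vietoris X) V \<and> A \<in> U \<and> B \<in> V \<and> disjnt U V"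
    proof cases
      case 1
      then show ?thesis using *[of A B a] AB by blast
    next
      case 2
      then obtain U V where "openin (vietoris X) U" "openin (vietoris X) V" "B \<in> U" "A \<in> V" "disjnt U V"
        using *[of B A a] AB by blast
      then show ?thesis by (intro exI[of _ V] exI[of _ U]) (simp add: disjnt_sym)
    qed
  qed
qed

lemma continuous_map_vietoris:
  assumes "compact_space X" "Hausdorff_space X" and f: "continuous_map X X f"
  shows "continuous_map (vietoris X) (vietoris X) (image f)"
  unfolding vietoris_def[of X] 
proof (rule continuous_map_into_topology_subbase, unfold vietoris_def[symmetric] topspace_vietoris)
  have cl: "closed_map X X f" by (rule continuous_imp_closed_map[OF f assms(1,2)])
  show "f ` A \<in> closed_sets X" if "A \<in> closed_sets X" for A
    using that cl by (simp add: closed_sets_def closed_map_def)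
  fix W assume "W \<in> vietoris_subbase X"
  then obtain U where U: "openin X U" "W = {A. A \<inter> U \<noteq> {}} \<or> W = {A. A \<subseteq> U}"
    unfolding vietoris_subbase_def by blast
  have pre: "openin X {x \<in> topspace X. f x \<in> U}" by (rule openin_continuous_map_preimage[OF f U(1)])
  have sub: "A \<subseteq> topspace X" if "A \<in> closed_sets X" for A
    using that closedin_subset unfolding closed_sets_def by blast
  show "openin (vietoris X) {A \<in> closed_sets X. f ` A \<in> W}"
    using U(2)
  proof
    assume W: "W = {A. A \<inter> U \<noteq> {}}"
    have "{A \<in> closed_sets X. f ` A \<in> W} = {A \<in> closed_sets X. A \<inter> {x \<in> topspace X. f x \<in> U} \<noteq> {}}"
      unfolding W using sub by fast
    then show ?thesis using openin_hit[OF pre] by simp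
  next
    assume W: "W = {A. A \<subseteq> U}"
    have "{A \<in> closed_sets X. f ` A \<in> W} = {A \<in> closed_sets X. A \<subseteq> {x \<in> topspace X. f x \<in> U}}"
      unfolding W using sub by fast
    then show ?thesis using openin_inside[OF pre] by simp
  qed
qed

context dyn
begin

lemma closed_sets_subset: "A \<in> closed_sets X \<Longrightarrow> A \<subseteq> T"
  unfolding closed_sets_def using closedin_subset by blast

lemma dyn_system_vietoris: "dyn_system (vietoris X) (image S)"
proof (rule dyn_systemI[OF compact_vietoris[OF compact] Hausdorff_vietoris[OF compact Hausdorff]])
  show "continuous_map (vietoris X) (vietoris X) (image S)" "continuous_map (vietoris X) (vietoris X) (image (inv_into T S))"
    by (intro continuous_map_vietoris compact Hausdorff continuous_S continuous_inv)+
  fix A assume "A \<in> topspace (vietoris X)"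
  then have "A \<subseteq> T" using closed_sets_subset by simp
  then show "inv_into T S ` S ` A = A" "S ` inv_into T S ` A = A"
    by (force simp: image_image subset_iff)+
qed

lemma act_vietoris:
  assumes A: "A \<in> closed_sets X" shows "act (vietoris X) (image S) n A = act X S n ` A"
proof -
  interpret V: dyn "vietoris X" "image S" by unfold_locales (rule dyn_system_vietoris)
  have AV: "A \<in> V.T" and AT: "A \<subseteq> T" using A closed_sets_subset by simp_all
  have AS: "act X S (i + 1) ` A = S ` act X S i ` A" for i
    unfolding image_image using AT act_Suc by (intro image_cong refl) blast
  have cl: "act X S i ` A \<in> V.T" for i
    using A continuous_imp_closed_map[OF continuous_act compact Hausdorff] by (simp add: closed_sets_def closed_map_def)
  show ?thesis
  proof (induction n rule: int_induct[where k = 0])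
    case base
    then show ?case using image_ident[of A] by (simp only: V.act_0 act_0)
  next
    case (step1 i)
    then show ?case using V.act_Suc[OF AV, of i] AS[of i] by simp
  next
    case (step2 i)
    have "S ` act X S (i - 1) ` A = act X S i ` A" using AS[of "i - 1"] by simp
    then have "inv_into V.T (image S) (S ` act X S (i - 1) ` A) = act (vietoris X) (image S) (i - 1) A"
      using V.act_pred[OF AV, of i] step2 by simp
    then show ?case using V.inv_S[OF cl] by simp
  qed
qed

lemma closedin_membership: "closedin (prod_topology X (vietoris X)) {(x, A). A \<in> closed_sets X \<and> x \<in> A}"
proof -
  let ?M = "{(x, A). A \<in> closed_sets X \<and> x \<in> A}"
  have "openin (prod_topology X (vietoris X)) (topspace (prod_topology X (vietoris X)) - ?M)"
  proof (subst openin_subopen, intro ballI)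
    fix z assume z: "z \<in> topspace (prod_topology X (vietoris X)) - ?M"
    obtain x A where zx: "z = (x, A)" by (cases z)
    with z have x: "x \<in> T" "A \<in> closed_sets X" "x \<notin> A" by auto
    have "compactin X A" using x(2) compact by (simp add: closed_sets_def closedin_compact_space)
    then obtain U V where UV: "openin X U" "openin X V" "{x} \<subseteq> U" "A \<subseteq> V" "disjnt U V"
      using Hausdorff_space_compact_separation[OF Hausdorff, of "{x}" A] x by auto
    let ?W = "U \<times> {A \<in> closed_sets X. A \<subseteq> V}"
    have "openin (prod_topology X (vietoris X)) ?W"
      using openin_inside[OF UV(2)] UV(1) by (simp add: openin_prod_Times_iff)
    moreover have "z \<in> ?W" using UV x zx by auto
    moreover have "?W \<subseteq> topspace (prod_topology X (vietoris X)) - ?M"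
      using UV(5) openin_subset[OF UV(1)] by (auto simp: disjnt_def)
    ultimately show "\<exists>W. openin (prod_topology X (vietoris X)) W \<and> z \<in> W \<and>
        W \<subseteq> topspace (prod_topology X (vietoris X)) - ?M" by blast
  qed
  moreover have "?M \<subseteq> topspace (prod_topology X (vietoris X))"
    using closed_sets_subset by auto
  ultimately show ?thesis unfolding closedin_def by blast
qed

end

section \<open>Cubes and extensions\<close>

text \<open>Generating cubes map onto generating cubes, and compactness closes up the image. In
  particular cubes of the factor lift to cubes, which drives the fibre argument for
  \<open>X1\<close>.\<close>

lemma extension_Q:
  assumes X: "dyn_system X S" and Y: "dyn_system Y R" and e: "extension X S Y R \<phi>"
  shows "cube_map d \<phi> ` Q_cubes d X S = Q_cubes d Y R"
proof -
  interpret X: dyn X S by unfold_locales (rule X)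
  interpret Y: dyn Y R by unfold_locales (rule Y)
  have c: "continuous_map X Y \<phi>" and im: "\<phi> ` X.T = Y.T" using e unfolding extension_def by blast+
  have cc: "continuous_map (cube_space d X) (cube_space d Y) (cube_map d \<phi>)"
    unfolding cube_map_def using c by (intro continuous_map_coordinatewise)
  have gen: "cube_map d \<phi> (\<lambda>\<epsilon>\<in>vertices d. act X S (aff j n \<epsilon>) x) = (\<lambda>\<epsilon>\<in>vertices d. act Y R (aff j n \<epsilon>) (\<phi> x))"
    if "x \<in> X.T" for j n x
    unfolding cube_map_def using extension_act[OF X Y e that] by (intro restrict_ext) simp
  have "cube_map d \<phi> ` Q_cubes d X S = cube_space d Y closure_of
      (cube_map d \<phi> ` {(\<lambda>\<epsilon>\<in>vertices d. act X S (aff j n \<epsilon>) x) | j n x. x \<in> X.T})"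
    unfolding X.Q_eq
  proof (rule compact_image_closure[OF cc X.compact_cube Y.Hausdorff_cube], rule subsetI)
    fix p assume "p \<in> {(\<lambda>\<epsilon>\<in>vertices d. act X S (aff j n \<epsilon>) x) | j n x. x \<in> X.T}"
    then obtain j n x where "x \<in> X.T" "p = (\<lambda>\<epsilon>\<in>vertices d. act X S (aff j n \<epsilon>) x)" by (elim CollectE exE conjE)
    then show "p \<in> topspace (cube_space d X)"
      using subsetD[OF X.Q_subset X.Q_gen] by (simp only:)
  qed
  also have "cube_map d \<phi> ` {(\<lambda>\<epsilon>\<in>vertices d. act X S (aff j n \<epsilon>) x) | j n x. x \<in> X.T} =
      {(\<lambda>\<epsilon>\<in>vertices d. act Y R (aff j n \<epsilon>) y) | j n y. y \<in> Y.T}"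
  proof (intro equalityI subsetI)
    fix q assume "q \<in> cube_map d \<phi> ` {(\<lambda>\<epsilon>\<in>vertices d. act X S (aff j n \<epsilon>) x) | j n x. x \<in> X.T}"
    then obtain j n x where x: "x \<in> X.T" "q = (\<lambda>\<epsilon>\<in>vertices d. act Y R (aff j n \<epsilon>) (\<phi> x))"
      using gen by (elim imageE CollectE exE conjE) simp
    have "\<phi> x \<in> Y.T" using im x(1) by blast
    then show "q \<in> {(\<lambda>\<epsilon>\<in>vertices d. act Y R (aff j n \<epsilon>) y) | j n y. y \<in> Y.T}"
      using x(2) by (intro CollectI exI conjI)
  next
    fix q assume "q \<in> {(\<lambda>\<epsilon>\<in>vertices d. act Y R (aff j n \<epsilon>) y) | j n y. y \<in> Y.T}"
    then obtain j n y where y: "y \<in> Y.T" "q = (\<lambda>\<epsilon>\<in>vertices d. act Y R (aff j n \<epsilon>) y)" by (elim CollectE exE conjE)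
    then obtain x where x: "x \<in> X.T" "y = \<phi> x" using im by blast
    show "q \<in> cube_map d \<phi> ` {(\<lambda>\<epsilon>\<in>vertices d. act X S (aff j n \<epsilon>) x) | j n x. x \<in> X.T}"
    proof (rule image_eqI)
      show "q = cube_map d \<phi> (\<lambda>\<epsilon>\<in>vertices d. act X S (aff j n \<epsilon>) x)" by (simp only: y x gen[OF x(1)])
      show "(\<lambda>\<epsilon>\<in>vertices d. act X S (aff j n \<epsilon>) x) \<in> {(\<lambda>\<epsilon>\<in>vertices d. act X S (aff j n \<epsilon>) x) | j n x. x \<in> X.T}"
        using x(1) by blast
    qed
  qed
  finally show ?thesis unfolding Y.Q_eq .
qed

lemma extension_compose:
  assumes "extension X S Y R \<phi>" "extension Y R Z Q \<psi>" shows "extension X S Z Q (\<psi> \<circ> \<phi>)"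
  unfolding extension_def
proof (intro conjI ballI)
  show "continuous_map X Z (\<psi> \<circ> \<phi>)"
    using assms unfolding extension_def by (intro continuous_map_compose) blast+
  show "(\<psi> \<circ> \<phi>) ` topspace X = topspace Z"
    using assms unfolding extension_def image_comp[symmetric] by simp
  fix x assume x: "x \<in> topspace X"
  then have "\<phi> x \<in> topspace Y" using assms(1) unfolding extension_def by blast
  then show "(\<psi> \<circ> \<phi>) (S x) = Q ((\<psi> \<circ> \<phi>) x)"
    using assms x unfolding extension_def by simp
qed

section \<open>Isomorphic copies\<close>

text \<open>Transport into the fixed type over which existence is asserted. Pulling the topology
  back along the inverse \<open>e'\<close> makes both maps continuous.\<close>

lemma minimal_system_copy:
  assumes "minimal_system (X :: 'b topology) S"
  obtains X' :: "nat set set topology" and S' e e' where "minimal_system X' S'"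
    "extension X S X' S' e" "extension X' S' X S e'"
    "\<And>x. x \<in> topspace X \<Longrightarrow> e' (e x) = x" "\<And>y. y \<in> topspace X' \<Longrightarrow> e (e' y) = y"
proof -
  interpret minimal X S using assms by (simp add: minimal_iff)
  obtain e :: "'b \<Rightarrow> nat set set" where e: "inj_on e T" using minimal_system_embeds[OF assms] by blast
  define e' where "e' = inv_into T e"
  define X' where "X' = pullback_topology (e ` T) e' X"
  define S' where "S' = e \<circ> S \<circ> e'"
  have e'e: "e' (e x) = x" if "x \<in> T" for x using e that by (simp add: e'_def)
  have top: "topspace X' = e ` T"
    unfolding X'_def topspace_pullback_topology using e'e by auto
  have ee': "e (e' y) = y" "e' y \<in> T" if "y \<in> topspace X'" for y
    using that e'e unfolding top by auto
  have ce: "continuous_map X X' e"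
    unfolding X'_def
  proof (rule continuous_map_pullback')
    show "continuous_map X X (e' \<circ> e)"
      by (rule continuous_map_eq[OF continuous_map_id]) (simp add: e'e)
  qed blast
  have ce': "continuous_map X' X e'"
    using continuous_map_pullback[OF continuous_map_id, of "e ` T" e' X] by (simp add: X'_def)
  have eS: "e (S x) = S' (e x)" if "x \<in> T" for x using that by (simp add: S'_def e'e)
  have e'S: "e' (S' y) = S (e' y)" if "y \<in> topspace X'" for y using ee'[OF that] by (simp add: S'_def e'e)
  have dyn': "dyn_system X' S'"
  proof (rule dyn_systemI)
    have eT: "e ` T = topspace X'" by (simp add: top)
    have hm: "homeomorphic_maps X X' e e'"
      unfolding homeomorphic_maps_def using ce ce' e'e ee' by blast
    then have hs: "X homeomorphic_space X'" by (auto simp: homeomorphic_space_def)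
    show "compact_space X'" using homeomorphic_compact_space[OF hs] compact by blast
    show "Hausdorff_space X'" using homeomorphic_Hausdorff_space[OF hs] Hausdorff by blast
    show "continuous_map X' X' S'"
      unfolding S'_def by (rule continuous_map_compose[OF ce' continuous_map_compose[OF continuous_S ce], unfolded o_assoc])
    show "continuous_map X' X' (e \<circ> inv_into T S \<circ> e')"
      by (rule continuous_map_compose[OF ce' continuous_map_compose[OF continuous_inv ce], unfolded o_assoc])
    fix y assume "y \<in> topspace X'"
    from ee'[OF this] show "(e \<circ> inv_into T S \<circ> e') (S' y) = y" "S' ((e \<circ> inv_into T S \<circ> e') y) = y"
      by (simp_all add: S'_def e'e)
  qed
  have ext: "extension X S X' S' e" using ce top eS unfolding extension_def by blast
  have "e' ` topspace X' = T" unfolding top image_image using e'e by (simp add: image_iff)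
  then have ext': "extension X' S' X S e'" using ce' e'S unfolding extension_def by blast
  have "minimal_system X' S'"
    unfolding minimal_system_def
  proof (intro conjI dyn' ballI equalityI closure_of_subset_topspace subsetI)
    fix y z assume y: "y \<in> topspace X'" and z: "z \<in> topspace X'"
    interpret X': dyn X' S' by unfold_locales (rule dyn')
    have "e (e' z) \<in> X' closure_of range (\<lambda>n. act X' S' n y)"
    proof (rule continuous_map_closure_mem[OF ce _ _ closedin_closure_of])
      show "e' z \<in> X closure_of range (\<lambda>n. act X S n (e' y))" using orbit_dense[OF ee'(2)[OF y]] ee'(2)[OF z] by simp
      fix a assume "a \<in> range (\<lambda>n. act X S n (e' y))"
      then obtain n where "e a = act X' S' n y"
        using extension_act[OF dyn dyn' ext ee'(2)[OF y]] ee'(1)[OF y] by (elim rangeE) simp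
      then show "e a \<in> X' closure_of range (\<lambda>n. act X' S' n y)"
        using subsetD[OF closure_of_subset[of "range (\<lambda>n. act X' S' n y)" X']] X'.act_in[OF y]
        by (simp add: image_subset_iff)
    qed
    then show "z \<in> X' closure_of range (\<lambda>n. act X' S' n y)" using ee'[OF z] by simp
  qed
  from that[OF this ext ext' e'e ee'(1)] show ?thesis by blast
qed

lemma almost_one_to_one_copy:
  assumes "extension X S X' S' e" "extension X' S' X S e'"
    "\<And>x. x \<in> topspace X \<Longrightarrow> e' (e x) = x" "\<And>y. y \<in> topspace X' \<Longrightarrow> e (e' y) = y"
    and "almost_one_to_one X \<phi>"
  shows "almost_one_to_one X' (\<phi> \<circ> e')"
proof -
  obtain A where A: "gdelta_in X A" "X closure_of A = topspace X"
    "\<forall>x\<in>A. {x'\<in>topspace X. \<phi> x' = \<phi> x} = {x}"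
    using assms(5) unfolding almost_one_to_one_def by (elim exE conjE)
  have c: "continuous_map X X' e" "continuous_map X' X e'" and im: "e ` topspace X = topspace X'" "e' ` topspace X' = topspace X"
    using assms(1,2) unfolding extension_def by blast+
  have "homeomorphic_maps X X' e e'" unfolding homeomorphic_maps_def using c assms(3,4) by simp
  then have h: "homeomorphic_map X X' e" unfolding homeomorphic_map_maps by (rule exI[of _ e'])
  have AT: "A \<subseteq> topspace X" using A(1) by (rule gdelta_in_subset)
  have "gdelta_in X' (e ` A)" using homeomorphic_map_gdeltaness[OF h AT] A(1) by blast
  moreover have "X' closure_of (e ` A) = topspace X'"
    using homeomorphic_map_closure_of[OF h AT] A(2) im(1) by simp
  moreover have "{y'\<in>topspace X'. (\<phi> \<circ> e') y' = (\<phi> \<circ> e') y} = {y}" if yA: "y \<in> e ` A" for y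
  proof -
    obtain x where x: "x \<in> A" "y = e x" using yA by blast
    have xT: "x \<in> topspace X" using x AT by blast
    have f: "{x'\<in>topspace X. \<phi> x' = \<phi> x} = {x}" using A(3) x by blast
    have yT: "y \<in> topspace X'" using im(1) x xT by blast
    have "y' = y" if y': "y' \<in> topspace X'" "\<phi> (e' y') = \<phi> (e' y)" for y'
    proof -
      have "e' y' \<in> {x'\<in>topspace X. \<phi> x' = \<phi> x}" using y' im(2) assms(3)[OF xT] x(2) by auto
      then show ?thesis using f assms(4)[OF y'(1)] x(2) by simp
    qed
    then show ?thesis using yT by auto
  qed
  ultimately show ?thesis
    unfolding almost_one_to_one_def by (intro exI[of _ "e ` A"] conjI ballI)
qed

section \<open>The quotient by the regionally proximal relation\<close>

context minimal
begin

abbreviation "C x \<equiv> R `` {x}"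

lemma C_iff: "y \<in> C x \<longleftrightarrow> (x, y) \<in> R"
  by simp

lemma C_eq: "(x, y) \<in> R \<Longrightarrow> C x = C y"
  by (rule equiv_class_eq[OF equiv_RP_inf])

text \<open>Projection of a closed part of the relation along a compact factor.\<close>

lemma closedin_saturation:
  assumes K: "closedin X K" shows "closedin X (R `` K)"
proof -
  have "closedin (prod_topology X X) (R \<inter> (K \<times> T))"
    using K by (intro closedin_Int RP_inf_closed) (simp add: closedin_prod_Times_iff)
  moreover have "closed_map (prod_topology X X) X snd" by (rule closed_map_snd[OF compact])
  ultimately have "closedin X (snd ` (R \<inter> (K \<times> T)))" unfolding closed_map_def by blast
  moreover have "snd ` (R \<inter> (K \<times> T)) = R `` K" using RP_inf_in by force
  ultimately show ?thesis by simp
qed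

lemma C_closed: assumes "x \<in> T" shows "C x \<in> closed_sets X"
proof -
  have "closedin X {x}" by (simp add: closedin_Hausdorff_singleton Hausdorff assms)
  then have "closedin X (C x)" by (rule closedin_saturation)
  moreover have "x \<in> C x" using RP_inf_refl[OF assms] by simp
  ultimately show ?thesis unfolding closed_sets_def by blast
qed

lemma act_C: assumes "x \<in> T" shows "act X S n ` C x = C (act X S n x)"
proof (intro equalityI subsetI)
  fix y assume "y \<in> act X S n ` C x"
  then show "y \<in> C (act X S n x)" using RP_inf_act by auto
next
  fix y assume y: "y \<in> C (act X S n x)"
  then have yT: "y \<in> T" using RP_inf_in by auto
  have "(act X S (- n) (act X S n x), act X S (- n) y) \<in> R" using RP_inf_act y by simp
  then have "act X S (- n) y \<in> C x" using assms by simp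
  then show "y \<in> act X S n ` C x" using yT by (intro image_eqI[of _ _ "act X S (- n) y"]) simp_all
qed

lemma S_C: "x \<in> T \<Longrightarrow> S ` C x = C (S x)"
  using act_C[of x 1] by (simp only: act_1 cong: image_cong)

lemma pi_in: "x \<in> T \<Longrightarrow> C x \<in> topspace (X_inf X S)"
  unfolding topspace_X_inf by (rule quotientI)

lemma continuous_pi: "continuous_map X (X_inf X S) (pi_inf X S)"
  unfolding continuous_map_def pi_inf_def using pi_in by (auto simp: openin_X_inf)

lemma pi_image: "pi_inf X S ` T = topspace (X_inf X S)"
  unfolding topspace_X_inf pi_inf_def quotient_def by blast

lemma closed_pi: "closed_map X (X_inf X S) (pi_inf X S)"
  unfolding closed_map_def
proof (intro allI impI)
  fix K assume K: "closedin X K"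
  have KT: "K \<subseteq> T" by (rule closedin_subset[OF K])
  have sub: "pi_inf X S ` K \<subseteq> topspace (X_inf X S)" using pi_image KT by blast
  have "C x \<in> pi_inf X S ` K \<longleftrightarrow> x \<in> R `` K" if x: "x \<in> T" for x
  proof
    assume "C x \<in> pi_inf X S ` K"
    then obtain k where "k \<in> K" "C x = C k" unfolding pi_inf_def by blast
    then show "x \<in> R `` K" using RP_inf_refl[OF x] by (metis C_iff ImageI)
  next
    assume "x \<in> R `` K"
    then obtain k where "k \<in> K" "(k, x) \<in> R" by blast
    then show "C x \<in> pi_inf X S ` K" using C_eq unfolding pi_inf_def by blast
  qed
  then have "{x \<in> T. C x \<in> topspace (X_inf X S) - pi_inf X S ` K} = T - R `` K"
    using pi_in by blast
  moreover have "openin X (T - R `` K)" using closedin_saturation[OF K] by (intro openin_diff openin_topspace)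
  ultimately have "openin (X_inf X S) (topspace (X_inf X S) - pi_inf X S ` K)"
    unfolding openin_X_inf using topspace_X_inf[of X S] by auto
  then show "closedin (X_inf X S) (pi_inf X S ` K)" using sub unfolding closedin_def by blast
qed

text \<open>Normality passes to closed continuous images and singletons stay closed, so the quotient
  is regular; with compactness this gives Baire category in the space of classes.\<close>

lemma X_inf_Baire: "locally_compact_space (X_inf X S) \<and> regular_space (X_inf X S)"
proof -
  have "normal_space X" using compact Hausdorff compact_Hausdorff_or_regular_imp_normal_space by blast
  then have "normal_space (X_inf X S)"
    by (rule normal_space_continuous_closed_map_image[OF _ continuous_pi closed_pi pi_image])
  moreover have "t1_space (X_inf X S)"
    using Hausdorff by (intro t1_space_closed_map_image[OF closed_pi pi_image] Hausdorff_imp_t1_space)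
  moreover have "compact_space (X_inf X S)"
    using image_compactin[OF _ continuous_pi, of T] compact pi_image unfolding compact_space_def by simp
  ultimately show ?thesis
    using normal_t1_imp_regular_space compact_imp_locally_compact_space by blast
qed

text \<open>The points at which the upper semicontinuous map \<open>x \<mapsto> R `` {x}\<close> into the hyperspace is continuous,
  tested on the members of a base.\<close>

definition continuity_point :: "'a set set \<Rightarrow> 'a \<Rightarrow> bool" where
  "continuity_point \<B> x \<longleftrightarrow> x \<in> T \<and> (\<forall>B\<in>\<B>. x \<in> R `` (X closure_of B) \<longrightarrow>
     (\<exists>W. openin X W \<and> R `` W \<subseteq> W \<and> x \<in> W \<and> W \<subseteq> R `` (X closure_of B)))"

lemma continuity_point_in: "continuity_point \<B> x \<Longrightarrow> x \<in> T"
  by (simp add: continuity_point_def)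

lemma continuity_point_class: assumes "continuity_point \<B> x" "(x, y) \<in> R" shows "continuity_point \<B> y"
  unfolding continuity_point_def
proof (intro conjI ballI impI)
  show "y \<in> T" using RP_inf_in[OF assms(2)] by blast
  fix B assume B: "B \<in> \<B>" "y \<in> R `` (X closure_of B)"
  then have "x \<in> R `` (X closure_of B)" using RP_inf_sym[OF assms(2)] RP_inf_trans by blast
  then obtain W where W: "openin X W" "R `` W \<subseteq> W" "x \<in> W" "W \<subseteq> R `` (X closure_of B)"
    using assms(1) B(1) unfolding continuity_point_def by blast
  then have "y \<in> W" using assms(2) by blast
  with W show "\<exists>W. openin X W \<and> R `` W \<subseteq> W \<and> y \<in> W \<and> W \<subseteq> R `` (X closure_of B)" by blast
qed

text \<open>Saturated open sets of \<open>X\<close> correspond to open sets of the quotient. The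
  test for \<open>B\<close> thus says that the class lies outside the closed image
  \<open>K B\<close> or in its interior, which is an open dense condition; countably many of them
  are intersected.\<close>

lemma gdelta_continuity_points:
  assumes \<B>: "countable \<B>" "\<B> \<noteq> {}"
  shows "gdelta_in (X_inf X S) (pi_inf X S ` {x. continuity_point \<B> x})" and "T \<noteq> {} \<Longrightarrow> \<exists>x. continuity_point \<B> x"
proof -
  let ?Y = "X_inf X S" and ?p = "pi_inf X S"
  define K where "K B = ?p ` (X closure_of B)" for B
  have K: "closedin ?Y (K B)" for B
    unfolding K_def using closed_pi by (simp add: closed_map_def)
  define O' where "O' B = (topspace ?Y - K B) \<union> ?Y interior_of (K B)" for B
  have op: "openin ?Y (O' B)" for B
    unfolding O'_def using K by (intro openin_Un openin_diff openin_topspace openin_interior_of)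
  have dense: "?Y closure_of (O' B) = topspace ?Y" for B
  proof (intro equalityI closure_of_subset_topspace subsetI)
    fix y assume y: "y \<in> topspace ?Y"
    show "y \<in> ?Y closure_of (O' B)"
      unfolding in_closure_of
    proof (intro conjI allI impI y)
      fix U assume U: "y \<in> U \<and> openin ?Y U"
      show "\<exists>z. z \<in> O' B \<and> z \<in> U"
      proof (cases "U \<subseteq> K B")
        case True
        then have "U \<subseteq> ?Y interior_of (K B)" using U by (simp add: interior_of_maximal)
        then show ?thesis using U by (auto simp: O'_def)
      next
        case False
        then show ?thesis using openin_subset[of ?Y U] U by (auto simp: O'_def)
      qed
    qed
  qed
  have pK: "?p x \<in> K B \<longleftrightarrow> x \<in> R `` (X closure_of B)" if x: "x \<in> T" for x B
  proof
    assume "?p x \<in> K B"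
    then obtain k where "k \<in> X closure_of B" "C x = C k" unfolding pi_inf_def K_def by blast
    then show "x \<in> R `` (X closure_of B)" using RP_inf_refl[OF x] by (metis C_iff ImageI)
  next
    assume "x \<in> R `` (X closure_of B)"
    then obtain k where "k \<in> X closure_of B" "(k, x) \<in> R" by blast
    then show "?p x \<in> K B" using C_eq unfolding pi_inf_def K_def by blast
  qed
  have O_iff: "?p x \<in> O' B \<longleftrightarrow> (x \<in> R `` (X closure_of B) \<longrightarrow>
     (\<exists>W. openin X W \<and> R `` W \<subseteq> W \<and> x \<in> W \<and> W \<subseteq> R `` (X closure_of B)))" if x: "x \<in> T" for x B
  proof -
    have "?p x \<in> ?Y interior_of (K B) \<longleftrightarrow> (\<exists>W. openin X W \<and> R `` W \<subseteq> W \<and> x \<in> W \<and> W \<subseteq> R `` (X closure_of B))"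
    proof
      assume int: "?p x \<in> ?Y interior_of (K B)"
      let ?W = "{x \<in> T. ?p x \<in> ?Y interior_of (K B)}"
      have "openin X ?W" by (rule openin_continuous_map_preimage[OF continuous_pi openin_interior_of])
      moreover have "R `` ?W \<subseteq> ?W"
      proof
        fix z assume "z \<in> R `` ?W"
        then obtain v where v: "v \<in> ?W" "(v, z) \<in> R" by blast
        then show "z \<in> ?W" using C_eq[OF v(2)] RP_inf_in[OF v(2)] by (simp add: pi_inf_def)
      qed
      moreover have "?W \<subseteq> R `` (X closure_of B)"
      proof
        fix z assume z: "z \<in> ?W"
        then have "?p z \<in> K B" using interior_of_subset by (metis (no_types, lifting) mem_Collect_eq subsetD)
        then show "z \<in> R `` (X closure_of B)" using pK z by blast
      qed
      ultimately show "\<exists>W. openin X W \<and> R `` W \<subseteq> W \<and> x \<in> W \<and> W \<subseteq> R `` (X closure_of B)"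
        using int x by (intro exI[of _ ?W]) simp
    next
      assume "\<exists>W. openin X W \<and> R `` W \<subseteq> W \<and> x \<in> W \<and> W \<subseteq> R `` (X closure_of B)"
      then obtain W where W: "openin X W" "R `` W \<subseteq> W" "x \<in> W" "W \<subseteq> R `` (X closure_of B)" by blast
      have WT: "W \<subseteq> T" by (rule openin_subset[OF W(1)])
      have "{z \<in> T. C z \<in> ?p ` W} = W"
      proof (intro equalityI subsetI)
        fix z assume z: "z \<in> {z \<in> T. C z \<in> ?p ` W}"
        then obtain v where v: "v \<in> W" "C z = C v" unfolding pi_inf_def by blast
        then have "(v, z) \<in> R" using RP_inf_refl z by (metis (no_types, lifting) C_iff mem_Collect_eq)
        then show "z \<in> W" using W(2) v by blast
      qed (use WT in \<open>auto simp: pi_inf_def\<close>)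
      then have "openin ?Y (?p ` W)"
        unfolding openin_X_inf using W(1) WT pi_image topspace_X_inf[of X S] by (metis image_mono)
      moreover have "?p ` W \<subseteq> K B" using W(4) WT pK by blast
      ultimately have "?p ` W \<subseteq> ?Y interior_of (K B)" by (simp add: interior_of_maximal)
      then show "?p x \<in> ?Y interior_of (K B)" using W(3) by blast
    qed
    then show ?thesis unfolding O'_def using pK[OF x] pi_in[OF x] by (auto simp: pi_inf_def)
  qed
  have eq: "?p ` {x. continuity_point \<B> x} = \<Inter>(O' ` \<B>)"
  proof (intro equalityI subsetI)
    fix y assume "y \<in> ?p ` {x. continuity_point \<B> x}"
    then obtain x where x: "y = ?p x" "continuity_point \<B> x" by blast
    then show "y \<in> \<Inter>(O' ` \<B>)" using O_iff[OF continuity_point_in[OF x(2)]] unfolding continuity_point_def by simp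
  next
    fix y assume y: "y \<in> \<Inter>(O' ` \<B>)"
    then have "y \<in> topspace ?Y" using \<B>(2) op openin_subset by blast
    then obtain x where x: "x \<in> T" "y = ?p x" using pi_image by blast
    then have "continuity_point \<B> x" unfolding continuity_point_def using O_iff[OF x(1)] y by simp
    then show "y \<in> ?p ` {x. continuity_point \<B> x}" using x by blast
  qed
  show "gdelta_in ?Y (?p ` {x. continuity_point \<B> x})"
    unfolding eq using \<B> op by (intro gdelta_in_Inter) (auto intro: open_imp_gdelta_in)
  assume "T \<noteq> {}"
  then have ne: "topspace ?Y \<noteq> {}" using pi_image by blast
  have "?Y closure_of \<Inter>(O' ` \<B>) = topspace ?Y"
    by (rule Baire_category) (use X_inf_Baire \<B>(1) op dense in auto)
  then have "\<Inter>(O' ` \<B>) \<noteq> {}" using ne by (metis closure_of_empty)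
  then show "\<exists>x. continuity_point \<B> x" unfolding eq[symmetric] by blast
qed

end

text \<open>Invariance of the base under translations makes the set of continuity points invariant.
  It then contains the orbit of \<open>x0\<close>, from which the density required for the almost
  one-to-one extensions follows.\<close>

locale hyperspace_extension = minimal +
  fixes \<B> x0
  assumes countable_B: "countable \<B>" and open_B: "B \<in> \<B> \<Longrightarrow> openin X B"
    and base_B: "openin X U \<Longrightarrow> x \<in> U \<Longrightarrow> \<exists>B\<in>\<B>. x \<in> B \<and> B \<subseteq> U"
    and invariant_B: "B \<in> \<B> \<Longrightarrow> act X S n ` B \<in> \<B>"
    and continuity_point_x0: "continuity_point \<B> x0"

lemma (in minimal) hyperspace_extension_exists:
  assumes "metrizable_space X" "T \<noteq> {}"
  shows "\<exists>\<B> x0. hyperspace_extension X S \<B> x0"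
proof -
  obtain \<B> where \<B>: "countable \<B>" "\<And>B. B \<in> \<B> \<Longrightarrow> openin X B"
    "\<And>U x. openin X U \<Longrightarrow> x \<in> U \<Longrightarrow> \<exists>B\<in>\<B>. x \<in> B \<and> B \<subseteq> U"
    by (rule countable_base[OF assms(1)]) (rule that)
  define \<B>' where "\<B>' = (\<lambda>(n, B). act X S n ` B) ` (UNIV \<times> \<B>)"
  have BT: "B \<subseteq> T" if "B \<in> \<B>" for B by (rule openin_subset[OF \<B>(2)[OF that]])
  have mem: "act X S n ` B \<in> \<B>'" if "B \<in> \<B>" for n B
    unfolding \<B>'_def using that by (intro image_eqI[of _ _ "(n, B)"]) simp_all
  have id: "act X S 0 ` B = B" for B by (simp add: act_def)
  have "\<B> \<noteq> {}" using \<B>(3)[OF openin_topspace] assms(2) by blast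
  then have ne: "\<B>' \<noteq> {}" by (simp add: \<B>'_def)
  have op: "openin X (act X S n ` B)" if B: "openin X B" for n B
  proof -
    have "act X S n ` B = {x \<in> T. act X S (- n) x \<in> B}"
    proof (intro equalityI subsetI)
      fix x assume "x \<in> {x \<in> T. act X S (- n) x \<in> B}"
      then show "x \<in> act X S n ` B" by (intro image_eqI[of _ _ "act X S (- n) x"]) simp_all
    qed (use openin_subset[OF B] in auto)
    then show ?thesis using openin_continuous_map_preimage[OF continuous_act B] by simp
  qed
  have cnt: "countable \<B>'" unfolding \<B>'_def using \<B>(1) by (intro countable_image countable_SIGMA) auto
  obtain x0 where "continuity_point \<B>' x0" using gdelta_continuity_points(2)[OF cnt ne assms(2)] by blast
  moreover have "openin X B" if "B \<in> \<B>'" for B using that op \<B>(2) unfolding \<B>'_def by auto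
  moreover have "\<exists>B\<in>\<B>'. x \<in> B \<and> B \<subseteq> U" if "openin X U" "x \<in> U" for U x
    using \<B>(3)[OF that] mem[of _ 0] unfolding id by blast
  moreover have "act X S n ` B \<in> \<B>'" if "B \<in> \<B>'" for n B
  proof -
    obtain m B0 where B0: "B0 \<in> \<B>" "B = act X S m ` B0"
      using \<open>B \<in> \<B>'\<close> unfolding \<B>'_def by (elim imageE SigmaE) (simp only: case_prod_conv)
    have "act X S n ` B = act X S (n + m) ` B0"
      unfolding B0(2) image_image using BT[OF B0(1)] act_add by (intro image_cong refl) auto
    then show ?thesis using mem[OF B0(1)] by simp
  qed
  ultimately have "hyperspace_extension X S \<B>' x0"
    using cnt by (intro hyperspace_extension.intro hyperspace_extension_axioms.intro minimal_axioms) auto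
  then show ?thesis by blast
qed

section \<open>The orbit closure of a class in the hyperspace\<close>

context hyperspace_extension
begin

lemma x0_in: "x0 \<in> T" by (rule continuity_point_in[OF continuity_point_x0])

text \<open>The test is stated for closures of basic sets because their saturations are closed;
  regularity fits such a closure inside \<open>U\<close>. The outcome is lower semicontinuity of the
  class map: all classes near \<open>x\<close> meet \<open>U\<close>.\<close>

lemma continuity_point_open:
  assumes "continuity_point \<B> x" "(x, c) \<in> R" "openin X U" "c \<in> U"
  shows "\<exists>W. openin X W \<and> R `` W \<subseteq> W \<and> x \<in> W \<and> W \<subseteq> R `` U"
proof -
  have "regular_space X" using compact Hausdorff by (simp add: compact_Hausdorff_imp_regular_space)
  moreover have "closedin X (T - U)" "c \<in> T - (T - U)"
    using assms openin_subset by auto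
  ultimately obtain N where N: "openin X N" "c \<in> N" "disjnt (T - U) (X closure_of N)"
    unfolding regular_space by blast
  obtain B where B: "B \<in> \<B>" "c \<in> B" "B \<subseteq> N" using base_B[OF N(1,2)] by blast
  have BU: "X closure_of B \<subseteq> U"
    using closure_of_mono[OF B(3), of X] N(3) closure_of_subset_topspace[of X N] by (auto simp: disjnt_def)
  have "c \<in> X closure_of B" using B closure_of_subset[of B X] openin_subset[OF open_B[OF B(1)]] by blast
  then have "x \<in> R `` (X closure_of B)" using RP_inf_sym[OF assms(2)] by blast
  then obtain W where "openin X W" "R `` W \<subseteq> W" "x \<in> W" "W \<subseteq> R `` (X closure_of B)"
    using assms(1) B(1) unfolding continuity_point_def by blast
  moreover have "R `` (X closure_of B) \<subseteq> R `` U" using BU by (rule Image_mono[OF subset_refl])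
  ultimately show ?thesis by (intro exI[of _ W] conjI) simp_all
qed

lemma continuity_point_act: assumes "continuity_point \<B> x" shows "continuity_point \<B> (act X S n x)"
  unfolding continuity_point_def
proof (intro conjI ballI impI)
  have x: "x \<in> T" by (rule continuity_point_in[OF assms])
  show "act X S n x \<in> T" using x by simp
  fix B assume B: "B \<in> \<B>" "act X S n x \<in> R `` (X closure_of B)"
  have BT: "B \<subseteq> T" by (rule openin_subset[OF open_B[OF B(1)]])
  let ?B = "act X S (- n) ` B"
  have cl: "X closure_of ?B = act X S (- n) ` (X closure_of B)"
    by (rule compact_image_closure[OF continuous_act compact Hausdorff BT, symmetric])
  obtain b where b: "b \<in> X closure_of B" "(b, act X S n x) \<in> R" using B(2) by blast
  have "(act X S (- n) b, x) \<in> R" using RP_inf_act[OF b(2), of "- n"] x by simp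
  then have "x \<in> R `` (X closure_of ?B)" unfolding cl using b(1) by blast
  then obtain W where W: "openin X W" "R `` W \<subseteq> W" "x \<in> W" "W \<subseteq> R `` (X closure_of ?B)"
    using assms invariant_B[OF B(1)] unfolding continuity_point_def by blast
  let ?W = "{z \<in> T. act X S (- n) z \<in> W}"
  have "openin X ?W" by (rule openin_continuous_map_preimage[OF continuous_act W(1)])
  moreover have "R `` ?W \<subseteq> ?W" using RP_inf_act W(2) RP_inf_in by blast
  moreover have "act X S n x \<in> ?W" using x W(3) by simp
  moreover have "?W \<subseteq> R `` (X closure_of B)"
  proof
    fix z assume z: "z \<in> ?W"
    then obtain a where a: "a \<in> X closure_of B" "(act X S (- n) a, act X S (- n) z) \<in> R"
      using W(4) unfolding cl by blast
    have "a \<in> T" using a(1) closure_of_subset_topspace[of X B] by blast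
    then have "(a, z) \<in> R" using RP_inf_act[OF a(2), of n] z by simp
    then show "z \<in> R `` (X closure_of B)" using a(1) by blast
  qed
  ultimately show "\<exists>W. openin X W \<and> R `` W \<subseteq> W \<and> act X S n x \<in> W \<and> W \<subseteq> R `` (X closure_of B)" by blast
qed

abbreviation "V \<equiv> vietoris X"

definition Ys :: "'a set set" where "Ys = V closure_of range (\<lambda>n. act X S n ` C x0)"

lemma dyn_V: "dyn V (image S)"
  by unfold_locales (rule dyn_system_vietoris)

lemma Ys_orbit: "Ys = V closure_of range (\<lambda>n. act V (image S) n (C x0))"
  unfolding Ys_def act_vietoris[OF C_closed[OF x0_in]] ..

lemma Ys_closed: "closedin V Ys" by (simp add: Ys_def)

lemma Ys_sets: "A \<in> Ys \<Longrightarrow> A \<in> closed_sets X"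
  using closedin_subset[OF Ys_closed] by auto

lemma Ys_act: assumes "A \<in> Ys" shows "act X S n ` A \<in> Ys"
proof -
  have "act V (image S) n A \<in> Ys"
    unfolding Ys_orbit using assms C_closed[OF x0_in]
    by (intro dyn.orbit_closure_invariant[OF dyn_V]) (simp_all add: Ys_orbit)
  then show ?thesis using act_vietoris[OF Ys_sets[OF assms]] by simp
qed

lemma Ys_meets: assumes "A \<in> Ys" "openin V W" "A \<in> W"
  obtains n where "C (act X S n x0) \<in> W"
proof -
  obtain B where "B \<in> range (\<lambda>n. act X S n ` C x0)" "B \<in> W"
    using closure_meets[OF assms(1)[unfolded Ys_def] assms(2,3)] by metis
  then show ?thesis using that act_C[OF x0_in] by auto
qed

text \<open>The relation is closed: two unrelated points of \<open>A\<close> would have a product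
  neighbourhood missing it, and a translate of the class of \<open>x0\<close> close to
  \<open>A\<close> would meet both factors.\<close>

lemma Ys_class: assumes A: "A \<in> Ys" and ab: "a \<in> A" "b \<in> A" shows "(a, b) \<in> R"
proof (rule ccontr)
  assume nR: "(a, b) \<notin> R"
  have AT: "A \<subseteq> T" by (rule closed_sets_subset[OF Ys_sets[OF A]])
  have "openin (prod_topology X X) (topspace (prod_topology X X) - R)"
    by (rule openin_diff[OF openin_topspace RP_inf_closed])
  moreover have "(a, b) \<in> topspace (prod_topology X X) - R" using nR ab AT by auto
  ultimately obtain U W where UW: "openin X U" "openin X W" "a \<in> U" "b \<in> W" "U \<times> W \<subseteq> topspace (prod_topology X X) - R"
    unfolding openin_prod_topology_alt by metis
  let ?O = "{A \<in> closed_sets X. A \<inter> U \<noteq> {}} \<inter> {A \<in> closed_sets X. A \<inter> W \<noteq> {}}"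
  have "openin V ?O" using openin_hit[OF UW(1)] openin_hit[OF UW(2)] by (rule openin_Int)
  moreover have "A \<in> ?O" using Ys_sets[OF A] ab UW by blast
  ultimately obtain n where "C (act X S n x0) \<in> ?O" using Ys_meets[OF A] by blast
  then obtain u v where uv: "u \<in> C (act X S n x0)" "u \<in> U" "v \<in> C (act X S n x0)" "v \<in> W" by blast
  then have "(u, v) \<in> R" using RP_inf_sym RP_inf_trans by (meson C_iff)
  then show False using uv UW(5) by blast
qed

text \<open>If some \<open>c\<close> in the class of \<open>a\<close> were missing from
  \<open>A\<close>, a class \<open>C (act X S n x0)\<close> near \<open>A\<close> would avoid a
  neighbourhood \<open>U\<close> of \<open>c\<close> while lying in a region where, by continuity at
  \<open>a\<close>, every class meets \<open>U\<close>.\<close>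

lemma Ys_fiber: assumes A: "A \<in> Ys" and a: "a \<in> A" "continuity_point \<B> a" shows "A = C a"
proof
  show "A \<subseteq> C a" using Ys_class[OF A a(1)] by blast
  show "C a \<subseteq> A"
  proof
    fix c assume c: "c \<in> C a"
    show "c \<in> A"
    proof (rule ccontr)
      assume nA: "c \<notin> A"
      have cT: "c \<in> T" using c RP_inf_in by auto
      have "compactin X A" using Ys_sets[OF A] compact by (simp add: closed_sets_def closedin_compact_space)
      then obtain U N where UN: "openin X U" "openin X N" "{c} \<subseteq> U" "A \<subseteq> N" "disjnt U N"
        using Hausdorff_space_compact_separation[OF Hausdorff, of "{c}" A] nA cT by auto
      obtain W where W: "openin X W" "R `` W \<subseteq> W" "a \<in> W" "W \<subseteq> R `` U"
        using continuity_point_open[OF a(2) _ UN(1), of c] c UN(3) by auto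
      have "A \<subseteq> W" using Ys_class[OF A a(1)] W(2,3) by blast
      then have "A \<in> {A \<in> closed_sets X. A \<subseteq> N \<inter> W}" using Ys_sets[OF A] UN(4) by blast
      moreover have "openin V {A \<in> closed_sets X. A \<subseteq> N \<inter> W}" using UN(2) W(1) by (intro openin_inside openin_Int)
      ultimately obtain n where n: "C (act X S n x0) \<in> {A \<in> closed_sets X. A \<subseteq> N \<inter> W}" using Ys_meets[OF A] by blast
      let ?e = "act X S n x0"
      have "?e \<in> C ?e" using RP_inf_refl[OF act_in[OF x0_in]] by simp
      then have "?e \<in> R `` U" using n W(4) by blast
      then obtain w where w: "w \<in> U" "(w, ?e) \<in> R" by blast
      then have "w \<in> C ?e" using RP_inf_sym by simp
      then show False using n w(1) UN(5) by (auto simp: disjnt_def)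
    qed
  qed
qed

section \<open>Pairs of a point and a member of the orbit closure containing it\<close>

abbreviation "Pr \<equiv> prod_topology X V"
abbreviation "SP \<equiv> map_prod S (image S)"

definition Xs :: "('a \<times> 'a set) set" where "Xs = {(x, A). A \<in> Ys \<and> x \<in> A}"

lemma dyn_Pr: "dyn_system Pr SP"
  by (rule dyn_system_prod[OF dyn dyn_system_vietoris])

lemma Xs_closed: "closedin Pr Xs"
proof -
  have "Xs = {(x, A). A \<in> closed_sets X \<and> x \<in> A} \<inter> (T \<times> Ys)"
    unfolding Xs_def using Ys_sets closed_sets_subset by blast
  moreover have "closedin Pr (T \<times> Ys)" using Ys_closed by (simp add: closedin_prod_Times_iff)
  ultimately show ?thesis using closedin_Int[OF closedin_membership] by simp
qed

lemma Xs_in: "(x, A) \<in> Xs \<Longrightarrow> x \<in> T" "(x, A) \<in> Xs \<Longrightarrow> A \<in> closed_sets X"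
  using Ys_sets closed_sets_subset unfolding Xs_def by blast+

lemma act_Pr: assumes "x \<in> T" "A \<in> closed_sets X" shows "act Pr SP n (x, A) = (act X S n x, act X S n ` A)"
  using act_prod[OF dyn dyn_system_vietoris, of x A n] assms act_vietoris[OF assms(2)] by simp

lemma Xs_act: assumes "z \<in> Xs" shows "act Pr SP n z \<in> Xs"
proof -
  obtain x A where z: "z = (x, A)" by (cases z)
  have "act Pr SP n z = (act X S n x, act X S n ` A)" unfolding z using assms Xs_in z by (intro act_Pr) auto
  then show ?thesis using assms Ys_act unfolding z Xs_def by auto
qed

text \<open>By minimality \<open>Z\<close> projects onto \<open>X\<close>, and over a point of the
  class of \<open>x0\<close> the only available member of \<open>Ys\<close> is that class.\<close>

lemma Xs_over:
  assumes zA: "(a, A) \<in> Xs" and Z: "closedin Pr Z" "Z \<subseteq> Xs" "(a, A) \<in> Z" "\<And>z n. z \<in> Z \<Longrightarrow> act Pr SP n z \<in> Z"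
    and c: "(x0, c) \<in> R"
  shows "(c, C x0) \<in> Z"
proof -
  have "closed_map Pr X fst" by (rule closed_map_fst[OF compact_vietoris[OF compact]])
  then have "closedin X (fst ` Z)" using Z(1) by (simp add: closed_map_def)
  moreover have "act X S n x \<in> fst ` Z" if x: "x \<in> fst ` Z" for x n
  proof -
    obtain B where B: "(x, B) \<in> Z" using x by force
    then have "act Pr SP n (x, B) = (act X S n x, act X S n ` B)" using Z(2) Xs_in by (intro act_Pr) blast+
    then show ?thesis using Z(4)[OF B, of n] by force
  qed
  ultimately have "fst ` Z = T" using Z(3) by (intro closed_invariant) auto
  moreover have "c \<in> T" using RP_inf_in[OF c] by blast
  ultimately obtain B where B: "(c, B) \<in> Z" by force
  then have "B \<in> Ys" "c \<in> B" using Z(2) unfolding Xs_def by blast+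
  then have "B = C c" using Ys_fiber continuity_point_class[OF continuity_point_x0 c] by blast
  then show ?thesis using B C_eq[OF c] by simp
qed

text \<open>The pairs over translates of the class of \<open>x0\<close> lie in \<open>Z\<close> and
  are dense: near \<open>(y, B)\<close> take a translate of the class that is close to
  \<open>B\<close> and meets the given neighbourhood of \<open>y\<close>.\<close>

lemma Xs_minimal:
  assumes zA: "(a, A) \<in> Xs" and Z: "closedin Pr Z" "Z \<subseteq> Xs" "(a, A) \<in> Z" "\<And>z n. z \<in> Z \<Longrightarrow> act Pr SP n z \<in> Z"
  shows "Z = Xs"
proof (intro equalityI Z(2) subsetI)
  fix z assume z: "z \<in> Xs"
  have "z \<in> Pr closure_of Z"
    unfolding in_closure_of
  proof (intro conjI allI impI)
    show "z \<in> topspace Pr" using closedin_subset[OF Xs_closed] z by blast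
    obtain y B where yB: "z = (y, B)" by (cases z)
    have B: "B \<in> Ys" "y \<in> B" using z unfolding yB Xs_def by blast+
    fix W assume "z \<in> W \<and> openin Pr W"
    then obtain U N where UN: "openin X U" "openin V N" "y \<in> U" "B \<in> N" "U \<times> N \<subseteq> W"
      unfolding openin_prod_topology_alt yB by blast
    let ?O = "N \<inter> {A \<in> closed_sets X. A \<inter> U \<noteq> {}}"
    have "openin V ?O" using UN(2) openin_hit[OF UN(1)] by (rule openin_Int)
    moreover have "B \<in> ?O" using UN B Ys_sets by blast
    ultimately obtain n where n: "C (act X S n x0) \<in> ?O" using Ys_meets[OF B(1)] by blast
    then obtain e where e: "e \<in> act X S n ` C x0" "e \<in> U" unfolding act_C[OF x0_in] by blast
    then obtain c where c: "c \<in> C x0" "e = act X S n c" by blast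
    have "(c, C x0) \<in> Z" by (rule Xs_over[OF zA Z c(1)[unfolded C_iff]])
    then have "act Pr SP n (c, C x0) \<in> Z" by (rule Z(4))
    moreover have "act Pr SP n (c, C x0) = (e, C (act X S n x0))"
      using act_Pr[OF _ C_closed[OF x0_in], of c n] c RP_inf_in act_C[OF x0_in] by auto
    moreover have "(e, C (act X S n x0)) \<in> W" using e n UN(5) by blast
    ultimately show "\<exists>y. y \<in> Z \<and> y \<in> W" by metis
  qed
  then show "z \<in> Z" using closure_of_closedin[OF Z(1)] by simp
qed

abbreviation "X1 \<equiv> subtopology Pr Xs"
abbreviation "Y1 \<equiv> subtopology V Ys"

lemma top_X1: "topspace X1 = Xs" and top_Y1: "topspace Y1 = Ys"
  using closedin_subset[OF Xs_closed] closedin_subset[OF Ys_closed] by auto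

lemma dyn_X1: "dyn_system X1 SP"
  by (rule dyn_system_sub[OF dyn_Pr Xs_closed Xs_act])

lemma dyn_Y1: "dyn_system Y1 (image S)"
proof (rule dyn_system_sub[OF dyn_system_vietoris Ys_closed])
  fix A n assume "A \<in> Ys"
  then show "act V (image S) n A \<in> Ys" using Ys_act act_vietoris[OF Ys_sets] by simp
qed

lemma act_X1: "z \<in> Xs \<Longrightarrow> act X1 SP n z = act Pr SP n z"
  using act_sub[OF dyn_Pr dyn_X1] top_X1 by blast

lemma act_Y1: "A \<in> Ys \<Longrightarrow> act Y1 (image S) n A = act X S n ` A"
  using act_sub[OF dyn_system_vietoris dyn_Y1] top_Y1 act_vietoris[OF Ys_sets] by metis

lemma minimal_X1: "minimal_system X1 SP"
  unfolding minimal_system_def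
proof (intro conjI dyn_X1 ballI)
  interpret X1: dyn X1 SP by unfold_locales (rule dyn_X1)
  fix z assume z: "z \<in> topspace X1"
  let ?Z = "X1 closure_of range (\<lambda>n. act X1 SP n z)"
  obtain a A where aA: "z = (a, A)" by (cases z)
  have zs: "(a, A) \<in> Xs" using z top_X1 aA by simp
  have sub: "?Z \<subseteq> Xs" using closure_of_subset_topspace[of X1] unfolding top_X1 .
  have "?Z = Xs"
  proof (rule Xs_minimal[OF zs _ sub])
    show "closedin Pr ?Z" by (rule closedin_trans_full[OF closedin_closure_of Xs_closed])
    have "z \<in> range (\<lambda>n. act X1 SP n z)" by (rule range_eqI[of _ _ 0]) simp
    moreover have "range (\<lambda>n. act X1 SP n z) \<subseteq> topspace X1" using X1.act_in[OF z] by blast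
    ultimately show "(a, A) \<in> ?Z" unfolding aA[symmetric] using subsetD[OF closure_of_subset] by metis
    fix w n assume w: "w \<in> ?Z"
    then have "act X1 SP n w \<in> ?Z" by (rule X1.orbit_closure_invariant[OF _ z])
    then show "act Pr SP n w \<in> ?Z" using act_X1[OF subsetD[OF sub w]] by simp
  qed
  then show "?Z = topspace X1" using top_X1 by simp
qed

lemma extension_snd: "extension X1 SP Y1 (image S) snd"
  unfolding extension_def top_X1 top_Y1
proof (intro conjI ballI)
  show "continuous_map X1 Y1 snd"
    by (intro continuous_map_into_subtopology continuous_map_from_subtopology continuous_map_snd)
      (auto simp: Xs_def)
  show "snd ` Xs = Ys"
  proof (intro equalityI subsetI)
    fix A assume A: "A \<in> Ys"
    then obtain x where "x \<in> A" using Ys_sets unfolding closed_sets_def by blast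
    then show "A \<in> snd ` Xs" using A unfolding Xs_def by force
  qed (auto simp: Xs_def)
qed auto

lemma Xs_nonempty: "(x0, C x0) \<in> Xs"
proof -
  have "C x0 \<in> range (\<lambda>n. act X S n ` C x0)" by (rule range_eqI[of _ _ 0]) simp
  moreover have "range (\<lambda>n. act X S n ` C x0) \<subseteq> closed_sets X"
    using act_C[OF x0_in] C_closed[OF act_in[OF x0_in]] by auto
  ultimately have "C x0 \<in> Ys" unfolding Ys_def using closure_of_subset[of _ V] by (metis subsetD topspace_vietoris)
  then show ?thesis using RP_inf_refl[OF x0_in] unfolding Xs_def by simp
qed

lemma extension_fst: "extension X1 SP X S fst"
  unfolding extension_def top_X1
proof (intro conjI ballI)
  show "continuous_map X1 X fst"
    by (intro continuous_map_from_subtopology continuous_map_fst)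
  have "closed_map Pr X fst" by (rule closed_map_fst[OF compact_vietoris[OF compact]])
  then have "closedin X (fst ` Xs)" using Xs_closed by (simp add: closed_map_def)
  moreover have "act X S n x \<in> fst ` Xs" if x: "x \<in> fst ` Xs" for x n
  proof -
    obtain B where B: "(x, B) \<in> Xs" using x by force
    then have "act Pr SP n (x, B) = (act X S n x, act X S n ` B)" using Xs_in by (intro act_Pr) blast+
    then show ?thesis using Xs_act[OF B, of n] by force
  qed
  ultimately show "fst ` Xs = T" using Xs_nonempty by (intro closed_invariant) auto
qed auto

lemma minimal_Y1: "minimal_system Y1 (image S)"
  unfolding minimal_system_def
proof (intro conjI dyn_Y1 ballI)
  fix A assume "A \<in> topspace Y1"
  then obtain z where z: "z \<in> Xs" "A = snd z" using extension_snd top_X1 unfolding extension_def by (metis imageE)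
  interpret X1: minimal X1 SP using minimal_X1 by (simp add: minimal_iff)
  interpret Y1: dyn Y1 "image S" by unfold_locales (rule dyn_Y1)
  have "snd ` (X1 closure_of range (\<lambda>n. act X1 SP n z)) = Y1 closure_of (snd ` range (\<lambda>n. act X1 SP n z))"
  proof (rule compact_image_closure[OF _ X1.compact Y1.Hausdorff])
    show "continuous_map X1 Y1 snd" using extension_snd unfolding extension_def by blast
    show "range (\<lambda>n. act X1 SP n z) \<subseteq> topspace X1" using X1.act_in z(1) top_X1 by blast
  qed
  moreover have "snd ` range (\<lambda>n. act X1 SP n z) = range (\<lambda>n. act Y1 (image S) n A)"
    unfolding image_image z(2) using extension_act[OF dyn_X1 dyn_Y1 extension_snd, of z] z(1) unfolding top_X1 by simp
  moreover have "snd ` (X1 closure_of range (\<lambda>n. act X1 SP n z)) = topspace Y1"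
    using X1.orbit_dense[of z] z(1) top_X1 extension_snd unfolding extension_def by metis
  ultimately show "Y1 closure_of range (\<lambda>n. act Y1 (image S) n A) = topspace Y1" by simp
qed

text \<open>The saturation of a member of \<open>Ys\<close>, which by \<open>Ys_class\<close> is the
  one class containing it.\<close>

definition theta :: "'a set \<Rightarrow> 'a set" where "theta A = R `` A"

lemma theta_eq: assumes "A \<in> Ys" "a \<in> A" shows "theta A = C a"
proof -
  have "C b = C a" if "b \<in> A" for b using C_eq[OF Ys_class[OF assms(1) that assms(2)]] .
  then show ?thesis using assms(2) unfolding theta_def by blast
qed

lemma Ys_nonempty: "A \<in> Ys \<Longrightarrow> \<exists>a\<in>T. a \<in> A"
  using Ys_sets closed_sets_subset unfolding closed_sets_def by blast

lemma extension_theta: "extension Y1 (image S) (X_inf X S) (S_inf S) theta"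
  unfolding extension_def top_Y1
proof (intro conjI ballI)
  show "continuous_map Y1 (X_inf X S) theta"
    unfolding continuous_map_def top_Y1
  proof (intro conjI allI impI)
    show "theta \<in> Ys \<rightarrow> topspace (X_inf X S)"
      using Ys_nonempty theta_eq pi_in by (metis Pi_I)
    fix U assume U: "openin (X_inf X S) U"
    let ?U = "{x \<in> T. C x \<in> U}"
    have op: "openin X ?U" using U unfolding openin_X_inf by simp
    have "{A \<in> Ys. theta A \<in> U} = {A \<in> closed_sets X. A \<subseteq> ?U} \<inter> Ys"
    proof (intro equalityI subsetI)
      fix A assume A: "A \<in> {A \<in> Ys. theta A \<in> U}"
      then have "C a \<in> U \<and> a \<in> T" if "a \<in> A" for a
        using theta_eq[of A a] that closed_sets_subset[OF Ys_sets] by auto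
      then show "A \<in> {A \<in> closed_sets X. A \<subseteq> ?U} \<inter> Ys" using A Ys_sets by blast
    next
      fix A assume A: "A \<in> {A \<in> closed_sets X. A \<subseteq> ?U} \<inter> Ys"
      then obtain a where "a \<in> A" using Ys_nonempty by blast
      then show "A \<in> {A \<in> Ys. theta A \<in> U}" using A theta_eq by auto
    qed
    then show "openin Y1 {A \<in> Ys. theta A \<in> U}"
      using openin_inside[OF op] by (simp add: openin_subtopology) blast
  qed
  show "theta ` Ys = topspace (X_inf X S)"
  proof (intro equalityI subsetI)
    fix y assume "y \<in> topspace (X_inf X S)"
    then obtain x where x: "x \<in> T" "y = C x" using pi_image unfolding pi_inf_def by blast
    then obtain A where "(x, A) \<in> Xs" using extension_fst top_X1 unfolding extension_def by force
    then have "A \<in> Ys" "x \<in> A" unfolding Xs_def by blast+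
    then show "y \<in> theta ` Ys" using theta_eq x by blast
  next
    fix y assume "y \<in> theta ` Ys"
    then obtain A where A: "A \<in> Ys" "y = theta A" by blast
    obtain a where "a \<in> T" "a \<in> A" using Ys_nonempty[OF A(1)] by blast
    then show "y \<in> topspace (X_inf X S)" using theta_eq[OF A(1)] A(2) pi_in by simp
  qed
next
  fix A assume A: "A \<in> Ys"
  obtain a where a: "a \<in> T" "a \<in> A" using Ys_nonempty[OF A] by blast
  have "S ` A = act X S 1 ` A" by (intro image_cong refl) (simp add: act_1)
  then have "S ` A \<in> Ys" "S a \<in> S ` A" using Ys_act[OF A] a by auto
  then have "theta (S ` A) = C (S a)" by (rule theta_eq)
  then show "theta (S ` A) = S_inf S (theta A)"
    unfolding S_inf_def theta_eq[OF A a(2)] using S_C[OF a(1)] by simp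
qed

lemma continuity_point_theta: assumes "A \<in> Ys" "theta A \<in> pi_inf X S ` {x. continuity_point \<B> x}" "a \<in> A" shows "continuity_point \<B> a"
proof -
  obtain x where x: "continuity_point \<B> x" "C a = C x" using assms theta_eq[OF assms(1,3)] unfolding pi_inf_def by auto
  have "a \<in> T" using assms(1,3) closed_sets_subset[OF Ys_sets] by blast
  then have "(x, a) \<in> R" using x(2) RP_inf_refl by (metis C_iff)
  then show ?thesis by (rule continuity_point_class[OF x(1)])
qed

lemma gdelta_preimage:
  assumes "continuous_map Z Y f" "gdelta_in Y G" shows "gdelta_in Z {z \<in> topspace Z. f z \<in> G}"
proof -
  obtain \<U> where \<U>: "countable \<U>" "\<And>U. U \<in> \<U> \<Longrightarrow> openin Y U" "\<Inter>\<U> = G"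
    using assms(2) unfolding gdelta_in_alt intersection_of_def by blast
  have "gdelta_in Z (\<Inter>(insert (topspace Z) ((\<lambda>U. {z \<in> topspace Z. f z \<in> U}) ` \<U>)))"
    using \<U>(1,2) openin_continuous_map_preimage[OF assms(1)]
    by (intro gdelta_in_Inter) (auto intro: open_imp_gdelta_in)
  moreover have "\<Inter>(insert (topspace Z) ((\<lambda>U. {z \<in> topspace Z. f z \<in> U}) ` \<U>)) = {z \<in> topspace Z. f z \<in> G}"
    unfolding \<U>(3)[symmetric] by auto
  ultimately show ?thesis by simp
qed

lemma B_nonempty: "\<B> \<noteq> {}"
  using base_B[OF openin_topspace x0_in] by blast

text \<open>The G-delta set is pulled back from the classes of continuity points and is dense
  because it contains the orbit of \<open>C x0\<close>. Over such a class the only member of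
  \<open>Ys\<close> is the class itself.\<close>

lemma almost_one_to_one_theta: "almost_one_to_one Y1 theta"
  unfolding almost_one_to_one_def
proof (intro exI conjI ballI)
  let ?G = "{A \<in> topspace Y1. theta A \<in> pi_inf X S ` {x. continuity_point \<B> x}}"
  interpret Y1: minimal Y1 "image S" using minimal_Y1 by (simp add: minimal_iff)
  have c: "continuous_map Y1 (X_inf X S) theta" using extension_theta unfolding extension_def by blast
  show "gdelta_in Y1 ?G" by (rule gdelta_preimage[OF c gdelta_continuity_points(1)[OF countable_B B_nonempty]])
  have C0: "C x0 \<in> Ys" using Xs_nonempty unfolding Xs_def by blast
  have "act Y1 (image S) n (C x0) \<in> ?G" for n
  proof -
    have "act Y1 (image S) n (C x0) = C (act X S n x0)" using act_Y1[OF C0] act_C[OF x0_in] by simp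
    moreover have "C (act X S n x0) \<in> Ys" using Ys_act[OF C0] act_C[OF x0_in] by simp
    moreover have "theta (C (act X S n x0)) = pi_inf X S (act X S n x0)"
      unfolding pi_inf_def using calculation(2) RP_inf_refl[OF act_in[OF x0_in]] by (intro theta_eq) simp_all
    ultimately show ?thesis using continuity_point_act[OF continuity_point_x0] top_Y1 by simp
  qed
  then have "range (\<lambda>n. act Y1 (image S) n (C x0)) \<subseteq> ?G" by blast
  then show "Y1 closure_of ?G = topspace Y1"
    by (rule closure_of_superset) (rule Y1.orbit_dense, simp only: top_Y1 C0)
  fix A assume "A \<in> ?G"
  then have A: "A \<in> Ys" "theta A \<in> pi_inf X S ` {x. continuity_point \<B> x}" using top_Y1 by auto
  obtain a where a: "a \<in> A" using Ys_nonempty[OF A(1)] by blast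
  have Aa: "A = C a" by (rule Ys_fiber[OF A(1) a continuity_point_theta[OF A a]])
  have "B = A" if B: "B \<in> Ys" "theta B = theta A" for B
  proof -
    obtain b where b: "b \<in> B" using Ys_nonempty[OF B(1)] by blast
    have "continuity_point \<B> b" using continuity_point_theta[OF B(1) _ b] A(2) B(2) by simp
    then have "B = C b" by (rule Ys_fiber[OF B(1) b])
    then show ?thesis using Aa theta_eq[OF B(1) b] theta_eq[OF A(1) a] B(2) by simp
  qed
  then show "{B \<in> topspace Y1. theta B = theta A} = {A}" using A(1) top_Y1 by auto
qed

text \<open>The same G-delta set of classes is pulled back through \<open>X\<close>; the only pair
  over a continuity point \<open>x\<close> is \<open>(x, C x)\<close>.\<close>

lemma almost_one_to_one_fst: "almost_one_to_one X1 fst"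
  unfolding almost_one_to_one_def
proof (intro exI conjI ballI)
  let ?G = "{z \<in> topspace X1. pi_inf X S (fst z) \<in> pi_inf X S ` {x. continuity_point \<B> x}}"
  interpret X1: minimal X1 SP using minimal_X1 by (simp add: minimal_iff)
  have "continuous_map X1 X fst" using extension_fst unfolding extension_def by blast
  from continuous_map_compose[OF this continuous_pi]
  have c: "continuous_map X1 (X_inf X S) (\<lambda>z. pi_inf X S (fst z))" by (simp add: o_def)
  show "gdelta_in X1 ?G" by (rule gdelta_preimage[OF c gdelta_continuity_points(1)[OF countable_B B_nonempty]])
  have z0: "(x0, C x0) \<in> topspace X1" using Xs_nonempty top_X1 by simp
  have "act X1 SP n (x0, C x0) \<in> ?G" for n
  proof -
    have "fst (act X1 SP n (x0, C x0)) = act X S n x0"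
      using extension_act[OF dyn_X1 dyn extension_fst z0] by simp
    then show ?thesis using continuity_point_act[OF continuity_point_x0] X1.act_in[OF z0] by simp
  qed
  then have "range (\<lambda>n. act X1 SP n (x0, C x0)) \<subseteq> ?G" by blast
  then show "X1 closure_of ?G = topspace X1"
    by (rule closure_of_superset) (rule X1.orbit_dense[OF z0])
  fix z assume z: "z \<in> ?G"
  obtain x A where xA: "z = (x, A)" by (cases z)
  have A: "A \<in> Ys" "x \<in> A" using z top_X1 unfolding xA Xs_def by auto
  have "theta A \<in> pi_inf X S ` {x. continuity_point \<B> x}" using z theta_eq[OF A] unfolding xA pi_inf_def by simp
  then have g: "continuity_point \<B> x" by (rule continuity_point_theta[OF A(1) _ A(2)])
  have BA: "B = A" if "(x, B) \<in> Xs" for B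
  proof -
    have B: "B \<in> Ys" "x \<in> B" using that unfolding Xs_def by blast+
    show ?thesis using Ys_fiber[OF B g] Ys_fiber[OF A g] by simp
  qed
  have xAs: "(x, A) \<in> Xs" using A unfolding Xs_def by blast
  show "{z' \<in> topspace X1. fst z' = fst z} = {z}"
    unfolding xA top_X1
  proof (intro equalityI subsetI)
    fix z' assume z': "z' \<in> {z' \<in> Xs. fst z' = fst (x, A)}"
    then obtain B where "z' = (x, B)" by (cases z') simp
    then show "z' \<in> {(x, A)}" using BA[of B] z' by simp
  qed (use xAs in simp)
qed

text \<open>Genericity for cubes is known at \<open>x1\<close>, continuity of the class map at
  \<open>x0\<close>. A member \<open>A\<close> of \<open>Ys\<close> through \<open>x1\<close> lies
  in the class of \<open>x1\<close>, so its tuples are cubes; translates of \<open>A\<close> come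
  close to \<open>C x0\<close>, and a common translation preserves cubes.\<close>

lemma class_cubes_x0:
  assumes "metrizable_space X" and d: "d \<ge> 1"
    and c: "c \<in> topspace (cube_space d X)" "\<And>\<epsilon>. \<epsilon> \<in> vertices d \<Longrightarrow> c \<epsilon> \<in> C x0"
  shows "c \<in> Q d"
proof -
  obtain x1 where x1: "x1 \<in> T" "\<And>k z. z \<in> Q k \<Longrightarrow> z {} = x1 \<Longrightarrow> z \<in> F_closure k (\<lambda>\<epsilon>\<in>vertices k. x1)"
    using generic_point[OF assms(1)] x0_in by blast
  obtain A where "(x1, A) \<in> Xs" using extension_fst top_X1 x1(1) unfolding extension_def by force
  then have A: "A \<in> Ys" "x1 \<in> A" unfolding Xs_def by blast+
  have AT: "A \<subseteq> T" by (rule closed_sets_subset[OF Ys_sets[OF A(1)]])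
  have AQ: "p \<in> Q d" if "p \<in> topspace (cube_space d X)" "\<And>\<epsilon>. \<epsilon> \<in> vertices d \<Longrightarrow> p \<epsilon> \<in> A" for p
    by (rule class_cubes[OF _ x1(1) d that(1)]) (use x1(2) Ys_class[OF A] that(2) in auto)
  interpret Y1: minimal Y1 "image S" using minimal_Y1 by (simp add: minimal_iff)
  have C0: "C x0 \<in> Ys" using Xs_nonempty unfolding Xs_def by blast
  have "c \<in> cube_space d X closure_of Q d"
    unfolding in_closure_of
  proof (intro conjI allI impI c(1))
    fix W assume W: "c \<in> W \<and> openin (cube_space d X) W"
    then have W': "openin (cube_space d X) W" "c \<in> W" by simp_all
    obtain U where U: "\<And>\<epsilon>. \<epsilon> \<in> vertices d \<Longrightarrow> openin X (U \<epsilon>)" "c \<in> Pi\<^sub>E (vertices d) U" "Pi\<^sub>E (vertices d) U \<subseteq> W"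
      by (rule product_neighbourhood[OF W']) (rule that)
    \<comment> \<open>Hitting every \<open>U \<epsilon>\<close> is an open condition that
      \<open>C x0\<close> satisfies, so some translate of \<open>A\<close> satisfies it too.\<close>
    let ?O = "\<Inter>\<epsilon>\<in>vertices d. {A \<in> closed_sets X. A \<inter> U \<epsilon> \<noteq> {}} \<inter> Ys"
    have op: "openin Y1 ?O"
    proof (rule openin_INT2)
      fix \<epsilon> assume "\<epsilon> \<in> vertices d"
      then show "openin Y1 ({A \<in> closed_sets X. A \<inter> U \<epsilon> \<noteq> {}} \<inter> Ys)"
        unfolding openin_subtopology using openin_hit[OF U(1)] by blast
    qed auto
    have "C x0 \<in> ?O"
      using C0 Ys_sets[OF C0] c(2) PiE_mem[OF U(2)] by blast
    then obtain n where n: "act Y1 (image S) n A \<in> ?O"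
      using Y1.orbit_meets[of A ?O] op A(1) top_Y1 by blast
    then have "\<forall>\<epsilon>\<in>vertices d. \<exists>a. a \<in> A \<and> act X S n a \<in> U \<epsilon>"
      unfolding act_Y1[OF A(1)] by blast
    then obtain a where a: "\<And>\<epsilon>. \<epsilon> \<in> vertices d \<Longrightarrow> a \<epsilon> \<in> A \<and> act X S n (a \<epsilon>) \<in> U \<epsilon>" by metis
    have aQ: "(\<lambda>\<epsilon>\<in>vertices d. a \<epsilon>) \<in> Q d"
    proof (rule AQ)
      show "(\<lambda>\<epsilon>\<in>vertices d. a \<epsilon>) \<in> topspace (cube_space d X)"
        unfolding topspace_product_topology restrict_PiE_iff using a AT by blast
    qed (use a in simp)
    have "(\<lambda>\<epsilon>\<in>vertices d. act X S (aff n (\<lambda>_. 0) \<epsilon>) ((\<lambda>\<epsilon>\<in>vertices d. a \<epsilon>) \<epsilon>)) \<in> Q d"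
      by (rule Q_act[OF aQ])
    moreover have "(\<lambda>\<epsilon>\<in>vertices d. act X S (aff n (\<lambda>_. 0) \<epsilon>) ((\<lambda>\<epsilon>\<in>vertices d. a \<epsilon>) \<epsilon>)) \<in> W"
    proof (rule subsetD[OF U(3)])
      show "(\<lambda>\<epsilon>\<in>vertices d. act X S (aff n (\<lambda>_. 0) \<epsilon>) ((\<lambda>\<epsilon>\<in>vertices d. a \<epsilon>) \<epsilon>)) \<in> Pi\<^sub>E (vertices d) U"
        unfolding restrict_PiE_iff using a by (intro ballI) (simp add: aff_def del: Pow_iff)
    qed
    ultimately show "\<exists>y. y \<in> Q d \<and> y \<in> W" by blast
  qed
  then show ?thesis using closure_of_closedin[OF closedin_Q] by simp
qed

theorem Q_saturated:
  assumes met: "metrizable_space X" and d: "d \<ge> 1"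
  shows "Q_cubes d X1 SP = {p \<in> topspace (cube_space d X1). cube_map d snd p \<in> Q_cubes d Y1 (image S)}"
proof (intro equalityI subsetI)
  interpret X1: minimal X1 SP using minimal_X1 by (simp add: minimal_iff)
  fix p assume p: "p \<in> Q_cubes d X1 SP"
  have "cube_map d snd p \<in> Q_cubes d Y1 (image S)"
    unfolding extension_Q[OF dyn_X1 dyn_Y1 extension_snd, of d, symmetric] by (rule imageI[OF p])
  moreover have "p \<in> topspace (cube_space d X1)" by (rule subsetD[OF X1.Q_subset p])
  ultimately show "p \<in> {p \<in> topspace (cube_space d X1). cube_map d snd p \<in> Q_cubes d Y1 (image S)}" by blast
next
  interpret X1: minimal X1 SP using minimal_X1 by (simp add: minimal_iff)
  interpret Y1: minimal Y1 "image S" using minimal_Y1 by (simp add: minimal_iff)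
  have C0: "C x0 \<in> Ys" using Xs_nonempty unfolding Xs_def by blast
  have C0T: "C x0 \<subseteq> T" by (rule closed_sets_subset[OF Ys_sets[OF C0]])
  \<comment> \<open>A cube of \<open>X\<close> inside the class of \<open>x0\<close> lifts to a cube
    of \<open>X1\<close>, and its second coordinates are forced because all points of that class are
    continuity points.\<close>
  have fiber: "(\<lambda>\<epsilon>\<in>vertices d. (c \<epsilon>, C x0)) \<in> Q_cubes d X1 SP"
    if c: "\<And>\<epsilon>. \<epsilon> \<in> vertices d \<Longrightarrow> c \<epsilon> \<in> C x0" for c
  proof -
    have "(\<lambda>\<epsilon>\<in>vertices d. c \<epsilon>) \<in> Q d"
    proof (rule class_cubes_x0[OF met d])
      show "(\<lambda>\<epsilon>\<in>vertices d. c \<epsilon>) \<in> topspace (cube_space d X)"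
        unfolding topspace_product_topology restrict_PiE_iff using c C0T by blast
    qed (use c in \<open>simp del: C_iff\<close>)
    then have "(\<lambda>\<epsilon>\<in>vertices d. c \<epsilon>) \<in> cube_map d fst ` Q_cubes d X1 SP"
      unfolding extension_Q[OF dyn_X1 dyn extension_fst] .
    then obtain q where q: "q \<in> Q_cubes d X1 SP" "(\<lambda>\<epsilon>\<in>vertices d. c \<epsilon>) = cube_map d fst q" by (elim imageE)
    have qt: "q \<in> vertices d \<rightarrow>\<^sub>E topspace X1"
      using subsetD[OF X1.Q_subset q(1)] unfolding topspace_product_topology .
    have eq: "q \<epsilon> = (c \<epsilon>, C x0) \<and> (c \<epsilon>, C x0) \<in> topspace X1" if e: "\<epsilon> \<in> vertices d" for \<epsilon>
    proof -
      have f: "fst (q \<epsilon>) = c \<epsilon>" using fun_cong[OF q(2), of \<epsilon>] e by (simp add: cube_map_def del: Pow_iff)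
      have qs: "q \<epsilon> \<in> Xs" using PiE_mem[OF qt e] unfolding top_X1 .
      obtain B where B: "q \<epsilon> = (c \<epsilon>, B)" using f by (cases "q \<epsilon>") simp
      have r: "(x0, c \<epsilon>) \<in> R" using c[OF e] by simp
      have "B = C (c \<epsilon>)" using qs continuity_point_class[OF continuity_point_x0 r] unfolding B Xs_def by (intro Ys_fiber) auto
      then have "B = C x0" using C_eq[OF r] by simp
      then show ?thesis using B qs unfolding top_X1 by simp
    qed
    have "q = (\<lambda>\<epsilon>\<in>vertices d. (c \<epsilon>, C x0))"
    proof (rule PiE_ext[OF qt])
      show "(\<lambda>\<epsilon>\<in>vertices d. (c \<epsilon>, C x0)) \<in> vertices d \<rightarrow>\<^sub>E topspace X1"
        unfolding restrict_PiE_iff using eq by blast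
      show "q \<epsilon> = (\<lambda>\<epsilon>\<in>vertices d. (c \<epsilon>, C x0)) \<epsilon>" if "\<epsilon> \<in> vertices d" for \<epsilon>
        using eq[OF that] that by (simp only: restrict_apply')
    qed
    then show ?thesis using q(1) by simp
  qed
  fix p assume "p \<in> {p \<in> topspace (cube_space d X1). cube_map d snd p \<in> Q_cubes d Y1 (image S)}"
  then have pt: "p \<in> topspace (cube_space d X1)" and pQ: "cube_map d snd p \<in> Q_cubes d Y1 (image S)" by blast+
  have pX: "p \<epsilon> \<in> Xs" if "\<epsilon> \<in> vertices d" for \<epsilon>
    using pt that top_X1 unfolding topspace_product_topology by (metis PiE_mem)
  have "p \<in> cube_space d X1 closure_of Q_cubes d X1 SP"
    unfolding in_closure_of
  proof (intro conjI allI impI pt)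
    fix W assume W: "p \<in> W \<and> openin (cube_space d X1) W"
    then have W': "openin (cube_space d X1) W" "p \<in> W" by simp_all
    obtain O1 where O1: "\<And>\<epsilon>. \<epsilon> \<in> vertices d \<Longrightarrow> openin X1 (O1 \<epsilon>)" "p \<in> Pi\<^sub>E (vertices d) O1" "Pi\<^sub>E (vertices d) O1 \<subseteq> W"
      by (rule product_neighbourhood[OF W']) (rule that)
    have "\<exists>U N. openin X U \<and> openin V N \<and> fst (p \<epsilon>) \<in> U \<and> snd (p \<epsilon>) \<in> N \<and> (U \<times> N) \<inter> Xs \<subseteq> O1 \<epsilon>"
      if e: "\<epsilon> \<in> vertices d" for \<epsilon>
    proof -
      obtain O2 where O2: "openin Pr O2" "O1 \<epsilon> = O2 \<inter> Xs" using O1(1)[OF e] unfolding openin_subtopology by blast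
      have "(fst (p \<epsilon>), snd (p \<epsilon>)) \<in> O2" using PiE_mem[OF O1(2) e] O2(2) by simp
      then obtain U N where "openin X U" "openin V N" "fst (p \<epsilon>) \<in> U" "snd (p \<epsilon>) \<in> N" "U \<times> N \<subseteq> O2"
        using O2(1) unfolding openin_prod_topology_alt by metis
      then show ?thesis unfolding O2(2) by (intro exI[of _ U] exI[of _ N]) auto
    qed
    then obtain U N where UN: "\<And>\<epsilon>. \<epsilon> \<in> vertices d \<Longrightarrow> openin X (U \<epsilon>) \<and> openin V (N \<epsilon>) \<and> fst (p \<epsilon>) \<in> U \<epsilon> \<and>
        snd (p \<epsilon>) \<in> N \<epsilon> \<and> (U \<epsilon> \<times> N \<epsilon>) \<inter> Xs \<subseteq> O1 \<epsilon>" by metis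
    \<comment> \<open>The image under \<open>snd\<close> of a basic neighbourhood of
      \<open>p \<epsilon>\<close> in \<open>Xs\<close>. That it is open is the openness of the
      projection, and it allows \<open>cube_map d snd p\<close> to be approximated inside the
      product of these sets.\<close>
    define M where "M \<epsilon> = (N \<epsilon> \<inter> {A \<in> closed_sets X. A \<inter> U \<epsilon> \<noteq> {}}) \<inter> Ys" for \<epsilon>
    have Mop: "openin Y1 (M \<epsilon>)" if e: "\<epsilon> \<in> vertices d" for \<epsilon>
    proof -
      have "openin V (N \<epsilon> \<inter> {A \<in> closed_sets X. A \<inter> U \<epsilon> \<noteq> {}})"
        using UN[OF e] openin_hit by (intro openin_Int) blast+
      then show ?thesis unfolding M_def openin_subtopology by blast
    qed
    have fin: "finite (vertices d)" by simp
    have MO: "openin (cube_space d Y1) (Pi\<^sub>E (vertices d) M)"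
      unfolding openin_PiE[OF fin] by (intro disjI2 ballI Mop)
    have pM: "cube_map d snd p \<in> Pi\<^sub>E (vertices d) M"
      unfolding cube_map_def restrict_PiE_iff
    proof
      fix \<epsilon> assume e: "\<epsilon> \<in> vertices d"
      have "fst (p \<epsilon>) \<in> snd (p \<epsilon>)" "snd (p \<epsilon>) \<in> Ys" using pX[OF e] unfolding Xs_def by auto
      then show "snd (p \<epsilon>) \<in> M \<epsilon>" using UN[OF e] Ys_sets unfolding M_def by blast
    qed
    obtain q where q: "q \<in> (\<lambda>f. \<lambda>\<epsilon>\<in>vertices d. act Y1 (image S) (f \<epsilon>) (C x0)) ` range (\<lambda>(j, n). aff j n)"
        "q \<in> Pi\<^sub>E (vertices d) M"
    proof -
      have "C x0 \<in> topspace Y1" unfolding top_Y1 by (rule C0)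
      from closure_meets[OF Y1.Q_orbit[OF this pQ] MO pM] that show ?thesis by metis
    qed
    then obtain j n where jn: "q = (\<lambda>\<epsilon>\<in>vertices d. act Y1 (image S) (aff j n \<epsilon>) (C x0))"
      by (elim imageE rangeE) (simp add: case_prod_unfold)
    have m: "act X S (aff j n \<epsilon>) ` C x0 \<in> M \<epsilon>" if e: "\<epsilon> \<in> vertices d" for \<epsilon>
      using PiE_mem[OF q(2) e] unfolding jn restrict_apply'[OF e] act_Y1[OF C0] .
    have "\<forall>\<epsilon>\<in>vertices d. \<exists>c. c \<in> C x0 \<and> act X S (aff j n \<epsilon>) c \<in> U \<epsilon>"
    proof
      fix \<epsilon> assume "\<epsilon> \<in> vertices d"
      from m[OF this] have "act X S (aff j n \<epsilon>) ` C x0 \<inter> U \<epsilon> \<noteq> {}" unfolding M_def by blast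
      then show "\<exists>c. c \<in> C x0 \<and> act X S (aff j n \<epsilon>) c \<in> U \<epsilon>" by blast
    qed
    then obtain c where c: "\<And>\<epsilon>. \<epsilon> \<in> vertices d \<Longrightarrow> c \<epsilon> \<in> C x0 \<and> act X S (aff j n \<epsilon>) (c \<epsilon>) \<in> U \<epsilon>" by metis
    \<comment> \<open>The points found in the translated classes are pulled back to
      \<open>C x0\<close>, where every tuple is a cube, and then moved by the same affine
      element.\<close>
    let ?q = "\<lambda>\<epsilon>\<in>vertices d. (c \<epsilon>, C x0)"
    have "?q \<in> Q_cubes d X1 SP" by (rule fiber) (use c in blast)
    from X1.Q_act[OF this]
    have "(\<lambda>\<epsilon>\<in>vertices d. act X1 SP (aff j n \<epsilon>) (?q \<epsilon>)) \<in> Q_cubes d X1 SP" .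
    moreover have "(\<lambda>\<epsilon>\<in>vertices d. act X1 SP (aff j n \<epsilon>) (?q \<epsilon>)) \<in> W"
    proof (rule subsetD[OF O1(3)])
      show "(\<lambda>\<epsilon>\<in>vertices d. act X1 SP (aff j n \<epsilon>) (?q \<epsilon>)) \<in> Pi\<^sub>E (vertices d) O1"
        unfolding restrict_PiE_iff
      proof
        fix \<epsilon> assume e: "\<epsilon> \<in> vertices d"
        have cs: "(c \<epsilon>, C x0) \<in> Xs" using c[OF e] C0 unfolding Xs_def by blast
        have eq: "act X1 SP (aff j n \<epsilon>) (?q \<epsilon>) = (act X S (aff j n \<epsilon>) (c \<epsilon>), act X S (aff j n \<epsilon>) ` C x0)"
          unfolding restrict_apply'[OF e] act_X1[OF cs] by (rule act_Pr[OF Xs_in[OF cs]])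
        have "act Pr SP (aff j n \<epsilon>) (c \<epsilon>, C x0) \<in> Xs" by (rule Xs_act[OF cs])
        then have "act X1 SP (aff j n \<epsilon>) (?q \<epsilon>) \<in> Xs" unfolding restrict_apply'[OF e] act_X1[OF cs] .
        moreover have "act X1 SP (aff j n \<epsilon>) (?q \<epsilon>) \<in> U \<epsilon> \<times> N \<epsilon>"
        proof -
          have "act X S (aff j n \<epsilon>) ` C x0 \<in> N \<epsilon>" using m[OF e] unfolding M_def by (elim IntE)
          then show ?thesis unfolding eq using c[OF e] by (intro SigmaI) simp_all
        qed
        ultimately show "act X1 SP (aff j n \<epsilon>) (?q \<epsilon>) \<in> O1 \<epsilon>" using UN[OF e] by (elim conjE) (erule subsetD, rule IntI)
      qed
    qed
    ultimately show "\<exists>y. y \<in> Q_cubes d X1 SP \<and> y \<in> W" by blast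
  qed
  then show "p \<in> Q_cubes d X1 SP" using closure_of_closedin[OF X1.closedin_Q] by simp
qed

end

lemma almost_one_to_one_empty: "almost_one_to_one trivial_topology f"
  unfolding almost_one_to_one_def by (intro exI[of _ "{}"]) simp

theorem theorem5p19:
  fixes X :: "'a topology" and S :: "'a \<Rightarrow> 'a"
  assumes "minimal_system X S" and "metrizable_space X"
  shows "\<exists>(X' :: nat set set topology) S' (Y' :: nat set set topology) R' \<theta>' \<pi>' \<theta>.
    minimal_system X' S' \<and> minimal_system Y' R' \<and>
    extension X' S' X S \<theta>' \<and>
    extension X' S' Y' R' \<pi>' \<and>
    extension Y' R' (X_inf X S) (S_inf S) \<theta> \<and>
    (\<forall>x\<in>topspace X'. pi_inf X S (\<theta>' x) = \<theta> (\<pi>' x)) \<and>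
    almost_one_to_one Y' \<theta> \<and>
    almost_one_to_one X' \<theta>' \<and>
    (\<forall>d\<ge>1. Q_cubes d X' S' =
       {p \<in> topspace (cube_space d X'). cube_map d \<pi>' p \<in> Q_cubes d Y' R'})"
proof (cases "topspace X = {}")
  case True
  \<comment> \<open>The empty system satisfies the definition of minimality but has no point
    \<open>x0\<close> to start from; here both new systems are empty.\<close>
  let ?E = "trivial_topology :: nat set set topology"
  interpret dyn ?E id
    by unfold_locales (simp add: dyn_system_def)
  have m: "minimal_system ?E id"
    using dyn by (simp add: minimal_system_def)
  have XE: "X = trivial_topology" using True by simp
  have YE: "X_inf X S = trivial_topology"
    using topspace_X_inf[of X S] True by (simp add: quotient_def)
  have 1: "extension ?E id X S f" for f using XE by (simp add: extension_def)
  have 2: "extension ?E id ?E id id" by (simp add: extension_def)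
  have 3: "extension ?E id (X_inf X S) (S_inf S) f" for f using YE by (simp add: extension_def)
  have t: "topspace (cube_space d ?E) = {}" for d by (auto simp: PiE_eq_empty_iff)
  have q: "Q_cubes d ?E id = {p \<in> topspace (cube_space d ?E). cube_map d id p \<in> Q_cubes d ?E id}" for d
    using Q_subset[of d] t[of d] by blast
  show ?thesis
    by (rule exI[of _ ?E], rule exI[of _ id], rule exI[of _ ?E], rule exI[of _ id],
        rule exI[of _ "\<lambda>_. undefined"], rule exI[of _ id], rule exI[of _ "\<lambda>_. undefined"])
      (use m 1 2 3 q in \<open>simp add: almost_one_to_one_empty\<close>)
next
  case False
  interpret minimal X S using assms(1) by (simp add: minimal_iff)
  obtain \<B> x0 where "hyperspace_extension X S \<B> x0" using hyperspace_extension_exists[OF assms(2) False] by blast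
  then interpret hyperspace_extension X S \<B> x0 .
  obtain X' :: "nat set set topology" and S' e e' where X': "minimal_system X' S'"
    "extension X1 SP X' S' e" "extension X' S' X1 SP e'"
    "\<And>x. x \<in> topspace X1 \<Longrightarrow> e' (e x) = x" "\<And>y. y \<in> topspace X' \<Longrightarrow> e (e' y) = y"
    by (rule minimal_system_copy[OF minimal_X1]) (rule that)
  obtain Y' :: "nat set set topology" and R' g g' where Y': "minimal_system Y' R'"
    "extension Y1 (image S) Y' R' g" "extension Y' R' Y1 (image S) g'"
    "\<And>x. x \<in> topspace Y1 \<Longrightarrow> g' (g x) = x" "\<And>y. y \<in> topspace Y' \<Longrightarrow> g (g' y) = y"
    by (rule minimal_system_copy[OF minimal_Y1]) (rule that)
  define \<pi>' where "\<pi>' = g \<circ> snd \<circ> e'"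
  have dX': "dyn_system X' S'" and dY': "dyn_system Y' R'"
    using X'(1) Y'(1) by (simp_all add: minimal_system_def)
  have \<pi>': "extension X' S' Y' R' \<pi>'"
    unfolding \<pi>'_def o_assoc[symmetric]
    by (rule extension_compose[OF extension_compose[OF X'(3) extension_snd] Y'(2), unfolded o_assoc[symmetric]])
  have e'T: "e' x \<in> topspace X1" if "x \<in> topspace X'" for x using X'(3) that unfolding extension_def by blast
  have snd_T: "snd z \<in> topspace Y1" if "z \<in> topspace X1" for z using extension_snd that unfolding extension_def by blast
  have comm: "pi_inf X S ((fst \<circ> e') x) = (theta \<circ> g') (\<pi>' x)" if x: "x \<in> topspace X'" for x
  proof -
    obtain a A where aA: "e' x = (a, A)" by (cases "e' x")
    then have "A \<in> Ys" "a \<in> A" using e'T[OF x] unfolding top_X1 Xs_def by auto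
    then have "theta A = C a" by (rule theta_eq)
    moreover have "g' (\<pi>' x) = A" using Y'(4)[OF snd_T[OF e'T[OF x]]] aA by (simp add: \<pi>'_def)
    ultimately show ?thesis using aA by (simp add: pi_inf_def)
  qed
  have Qs: "Q_cubes d X' S' = {p \<in> topspace (cube_space d X'). cube_map d \<pi>' p \<in> Q_cubes d Y' R'}" if d: "d \<ge> 1" for d
  proof (intro equalityI subsetI)
    interpret X': dyn X' S' by unfold_locales (rule dX')
    fix p assume p: "p \<in> Q_cubes d X' S'"
    have "cube_map d \<pi>' p \<in> Q_cubes d Y' R'"
      unfolding extension_Q[OF dX' dY' \<pi>', symmetric] by (rule imageI[OF p])
    then show "p \<in> {p \<in> topspace (cube_space d X'). cube_map d \<pi>' p \<in> Q_cubes d Y' R'}"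
      using subsetD[OF X'.Q_subset p] by blast
  next
    fix p assume "p \<in> {p \<in> topspace (cube_space d X'). cube_map d \<pi>' p \<in> Q_cubes d Y' R'}"
    then have pt: "p \<in> topspace (cube_space d X')" and pQ: "cube_map d \<pi>' p \<in> Q_cubes d Y' R'" by blast+
    have pT: "p \<epsilon> \<in> topspace X'" if "\<epsilon> \<in> vertices d" for \<epsilon>
      using pt that unfolding topspace_product_topology by (rule PiE_mem)
    define q where "q = cube_map d e' p"
    have qt: "q \<in> topspace (cube_space d X1)"
      unfolding q_def cube_map_def topspace_product_topology restrict_PiE_iff using e'T pT by blast
    \<comment> \<open>Cubes are carried to \<open>Y1\<close> along \<open>g'\<close>, saturation is
      applied there, and the resulting cube of \<open>X1\<close> returns along
      \<open>e\<close>.\<close>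
    have "cube_map d g' (cube_map d \<pi>' p) \<in> Q_cubes d Y1 (image S)"
      unfolding extension_Q[OF dY' dyn_Y1 Y'(3), symmetric] by (rule imageI[OF pQ])
    moreover have "cube_map d g' (cube_map d \<pi>' p) = cube_map d snd q"
      unfolding cube_map_def q_def
    proof (rule restrict_ext)
      fix \<epsilon> assume \<epsilon>: "\<epsilon> \<in> vertices d"
      show "g' ((\<lambda>\<epsilon>\<in>vertices d. \<pi>' (p \<epsilon>)) \<epsilon>) = snd ((\<lambda>\<epsilon>\<in>vertices d. e' (p \<epsilon>)) \<epsilon>)"
        using Y'(4)[OF snd_T[OF e'T[OF pT[OF \<epsilon>]]]] \<epsilon> by (simp add: \<pi>'_def del: Pow_iff)
    qed
    ultimately have "q \<in> Q_cubes d X1 SP" using qt unfolding Q_saturated[OF assms(2) d] by simp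
    then have "cube_map d e q \<in> Q_cubes d X' S'"
      unfolding extension_Q[OF dyn_X1 dX' X'(2), symmetric] by (rule imageI)
    moreover have "cube_map d e q = p"
    proof (rule PiE_ext[of _ "vertices d" "\<lambda>_. UNIV"])
      show "p \<in> vertices d \<rightarrow>\<^sub>E UNIV" using pt by (simp add: PiE_iff)
      show "cube_map d e q \<epsilon> = p \<epsilon>" if "\<epsilon> \<in> vertices d" for \<epsilon>
        using X'(5)[OF pT[OF that]] that by (simp add: cube_map_def q_def del: Pow_iff)
    qed (simp add: cube_map_def)
    ultimately show "p \<in> Q_cubes d X' S'" by simp
  qed
  have \<theta>: "extension Y' R' (X_inf X S) (S_inf S) (theta \<circ> g')" by (rule extension_compose[OF Y'(3) extension_theta])
  have \<theta>': "extension X' S' X S (fst \<circ> e')" by (rule extension_compose[OF X'(3) extension_fst])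
  have a: "almost_one_to_one Y' (theta \<circ> g')"
    by (rule almost_one_to_one_copy[OF Y'(2,3,4,5) almost_one_to_one_theta])
  have a': "almost_one_to_one X' (fst \<circ> e')"
    by (rule almost_one_to_one_copy[OF X'(2,3,4,5) almost_one_to_one_fst])
  show ?thesis
    by (rule exI[of _ X'], rule exI[of _ S'], rule exI[of _ Y'], rule exI[of _ R'],
        rule exI[of _ "fst \<circ> e'"], rule exI[of _ \<pi>'], rule exI[of _ "theta \<circ> g'"])
      (intro conjI ballI allI impI X'(1) Y'(1) \<theta>' \<pi>' \<theta> comm a a' Qs)
qed

end
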